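(* Let $C$ be a complex projective curve of genus $g>1$, let $\Gamma=(\mathcal{V},\mathcal{E})$ be a chordal graph, and let $\mathcal{A}=\mathcal{A}(\Gamma,C)$ be the associated chordal arrangement in $C^{\mathcal{V}}$. Then the graded algebra $A(\mathcal{A})$ (defined in the context) is Koszul.
   Context: Curves are smooth and connected. Graphs are finite and simple. A graph is chordal if every cycle with more than three vertices has a chord. The vertices of a chordal graph are ordered by a perfect elimination ordering: a total order such that every vertex $v$ is simplicial (its neighbors form a clique) in the graph obtained by deleting all vertices $v'>v$; such an order exists if and only if the graph is chordal. For an edge $e$, $h(e)$ is its larger and $t(e)$ its smaller vertex. Edges are ordered by $e<e'$ if $h(e)<h(e')$, or $h(e)=h(e')$ and $t(e)<t(e')$. The arrangement $\mathcal{A}(\Gamma,C)$ is $\{H_e\mid e\in\mathcal{E}\}$ where $H_e=\{x\in C^{\mathcal{V}}\mid x_{h(e)}=x_{t(e)}\}$. The algebra $A(\mathcal{A})$ is the exterior algebra on the $\mathbb{Q}$-vector space with basis $\{x^i_v,y^i_v,g_e\mid v\in\mathcal{V},e\in\mathcal{E},i=1,\dots,g\}$ (all generators in degree 1) modulo the ideal generated by: (i) $\sum_j(-1)^jg_{e_1}\cdots\hat g_{e_j}\cdots g_{e_k}$ whenever $\{e_1<\dots<e_k\}$ is (the edge set of) a cycle; (ii) $(x^i_{h(e)}-x^i_{t(e)})g_e$ and $(y^i_{h(e)}-y^i_{t(e)})g_e$ for each $e\in\mathcal{E}$ and each $i$; (iiia) $x_v^iy_v^j$, $x_v^ix_v^j$,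 $y_v^iy_v^j$ for $v\in\mathcal{V}$, $i\neq j$; (iiib) $x_v^iy_v^i-x_v^jy_v^j$ for $v\in\mathcal{V}$ and all $i,j$. (It also carries a differential, ignored here.) A connected graded $\mathbb{Q}$-algebra $A$ is Koszul if $\mathrm{Ext}_A^{i}(\mathbb{Q},\mathbb{Q})$ is concentrated in internal degree $i$ for all $i$. *)

theory Defs
  imports
    "HOL-Analysis.Analysis"
    "HOL-Algebra.Algebra"
    "HOL-Algebra.Algebraic_Closure_Type"
    "HOL-Homology.Homology"
    "HOL-Library.Poly_Mapping"
begin

section \<open>Complex projective curves\<close>

text \<open>A point of the projective space of \<open>complex ^ 'n\<close> is a line through the origin.\<close>

definition proj_point :: "complex ^ 'n \<Rightarrow> (complex ^ 'n) set" where
  "proj_point z = vec.span {z}"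

definition proj_points :: "(complex ^ 'n) set set" where
  "proj_points = proj_point ` (- {0})"

text \<open>The classical topology, i.e. the quotient topology along \<^const>\<open>proj_point\<close>.\<close>

definition proj_space :: "(complex ^ 'n) set topology" where
  "proj_space = topology (\<lambda>U. U \<subseteq> proj_points \<and> open {z. z \<noteq> 0 \<and> proj_point z \<in> U})"

lemma openin_proj_space:
  fixes U :: "(complex ^ 'n) set set"
  shows "openin proj_space U \<longleftrightarrow> U \<subseteq> proj_points \<and> open {z. z \<noteq> 0 \<and> proj_point z \<in> U}"
proof -
  have "istopology (\<lambda>U. U \<subseteq> proj_points \<and> open {z::complex^'n. z \<noteq> 0 \<and> proj_point z \<in> U})"
    unfolding istopology_def
  proof (intro conjI allI impI)
    fix S T :: "(complex ^ 'n) set set"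
    assume S: "S \<subseteq> proj_points \<and> open {z. z \<noteq> 0 \<and> proj_point z \<in> S}"
      and T: "T \<subseteq> proj_points \<and> open {z. z \<noteq> 0 \<and> proj_point z \<in> T}"
    show "S \<inter> T \<subseteq> proj_points" using S by blast
    have "{z. z \<noteq> 0 \<and> proj_point z \<in> S \<inter> T} =
          {z. z \<noteq> 0 \<and> proj_point z \<in> S} \<inter> {z. z \<noteq> 0 \<and> proj_point z \<in> T}" by blast
    then show "open {z. z \<noteq> 0 \<and> proj_point z \<in> S \<inter> T}" using S T by (simp only: open_Int)
  next
    fix K :: "(complex ^ 'n) set set set"
    assume K: "\<forall>S\<in>K. S \<subseteq> proj_points \<and> open {z. z \<noteq> 0 \<and> proj_point z \<in> S}"
    show "\<Union> K \<subseteq> proj_points" using K by blast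
    have "{z. z \<noteq> 0 \<and> proj_point z \<in> \<Union> K} = (\<Union>S\<in>K. {z. z \<noteq> 0 \<and> proj_point z \<in> S})" by blast
    then show "open {z. z \<noteq> 0 \<and> proj_point z \<in> \<Union> K}" using K by (simp add: open_UN)
  qed
  then show ?thesis unfolding proj_space_def by (simp add: topology_inverse')
qed

type_synonym 'n mpoly = "('n \<Rightarrow>\<^sub>0 nat) \<Rightarrow>\<^sub>0 complex"

definition mpoly_eval :: "'n::finite mpoly \<Rightarrow> complex ^ 'n \<Rightarrow> complex" where
  "mpoly_eval p z =
     (\<Sum>m\<in>Poly_Mapping.keys p. Poly_Mapping.lookup p m * (\<Prod>i\<in>UNIV. (z $ i) ^ Poly_Mapping.lookup m i))"

definition homogeneous_mpoly :: "'n::finite mpoly \<Rightarrow> bool" where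
  "homogeneous_mpoly p \<longleftrightarrow>
     (\<exists>d. \<forall>m\<in>Poly_Mapping.keys p. (\<Sum>i\<in>UNIV. Poly_Mapping.lookup m i) = d)"

definition mpoly_partial :: "'n::finite mpoly \<Rightarrow> 'n \<Rightarrow> complex ^ 'n \<Rightarrow> complex" where
  "mpoly_partial p i z = deriv (\<lambda>w. mpoly_eval p (\<chi> k. if k = i then w else z $ k)) (z $ i)"

definition proj_zeros :: "'n::finite mpoly set \<Rightarrow> (complex ^ 'n) set set" where
  "proj_zeros S = {L \<in> proj_points. \<forall>p\<in>S. \<forall>z\<in>L. mpoly_eval p z = 0}"

definition vanishing_mpolys :: "(complex ^ 'n::finite) set set \<Rightarrow> 'n mpoly set" where
  "vanishing_mpolys C = {p. homogeneous_mpoly p \<and> (\<forall>L\<in>C. \<forall>z\<in>L. mpoly_eval p z = 0)}"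

text \<open>The Zariski tangent space at \<open>z\<close> of the affine cone over \<open>C\<close>.  Since all vanishing polynomials
  (not just some defining equations) are used, dimension 2 at all nonzero points of the cone means
  that \<open>C\<close> is smooth of pure dimension 1.\<close>

definition cone_tangent_space ::
  "(complex ^ 'n::finite) set set \<Rightarrow> complex ^ 'n \<Rightarrow> (complex ^ 'n) set" where
  "cone_tangent_space C z =
     {v. \<forall>p\<in>vanishing_mpolys C. (\<Sum>i\<in>UNIV. mpoly_partial p i z * v $ i) = 0}"

definition smooth_connected_projective_curve :: "(complex ^ 'n::finite) set set \<Rightarrow> bool" where
  "smooth_connected_projective_curve C \<longleftrightarrow>
     (\<exists>S. (\<forall>p\<in>S. homogeneous_mpoly p) \<and> C = proj_zeros S) \<and>
     (\<forall>L\<in>C. \<forall>z\<in>L. z \<noteq> 0 \<longrightarrow> vec.dim (cone_tangent_space C z) = 2) \<and>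
     C \<noteq> {} \<and> connectedin proj_space C"

text \<open>The genus, through \<open>H\<^sub>1(C; \<int>) \<cong> \<int>\<^sup>2\<^sup>g\<close>.\<close>

definition has_genus :: "(complex ^ 'n::finite) set set \<Rightarrow> nat \<Rightarrow> bool" where
  "has_genus C g \<longleftrightarrow>
     homology_group 1 (subtopology proj_space C) \<cong> free_Abelian_group {..<2 * g}"


section \<open>Chordal graphs and perfect elimination orderings\<close>

definition simple_graph :: "'v set \<Rightarrow> 'v set set \<Rightarrow> bool" where
  "simple_graph V E \<longleftrightarrow> finite V \<and> (\<forall>e\<in>E. e \<subseteq> V \<and> card e = 2)"

definition cycle_edges :: "'v list \<Rightarrow> 'v set set" where
  "cycle_edges vs = {{vs ! i, vs ! (Suc i mod length vs)} | i. i < length vs}"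

definition graph_cycle :: "'v set set \<Rightarrow> 'v list \<Rightarrow> bool" where
  "graph_cycle E vs \<longleftrightarrow> length vs \<ge> 3 \<and> distinct vs \<and> cycle_edges vs \<subseteq> E"

definition chordal :: "'v set \<Rightarrow> 'v set set \<Rightarrow> bool" where
  "chordal V E \<longleftrightarrow> simple_graph V E \<and>
     (\<forall>vs. graph_cycle E vs \<and> length vs > 3 \<longrightarrow> (\<exists>e\<in>E. e \<subseteq> set vs \<and> e \<notin> cycle_edges vs))"

text \<open>Total orders are reflexive relations: \<open>(u, v) \<in> r\<close> means \<open>u \<le> v\<close>.\<close>

definition perfect_elimination_ordering :: "'v set \<Rightarrow> 'v set set \<Rightarrow> 'v rel \<Rightarrow> bool" where
  "perfect_elimination_ordering V E r \<longleftrightarrow> linear_order_on V r \<and>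
     (\<forall>v\<in>V. \<forall>u\<in>V. \<forall>w\<in>V. (u, v) \<in> r \<and> (w, v) \<in> r \<and> {u, v} \<in> E \<and> {w, v} \<in> E \<and> u \<noteq> w
        \<longrightarrow> {u, w} \<in> E)"

definition edge_head :: "'v rel \<Rightarrow> 'v set \<Rightarrow> 'v" where
  "edge_head r e = (THE v. v \<in> e \<and> (\<forall>u\<in>e. (u, v) \<in> r))"

definition edge_tail :: "'v rel \<Rightarrow> 'v set \<Rightarrow> 'v" where
  "edge_tail r e = (THE v. v \<in> e \<and> (\<forall>u\<in>e. (v, u) \<in> r))"

definition edge_less :: "'v rel \<Rightarrow> 'v set \<Rightarrow> 'v set \<Rightarrow> bool" where
  "edge_less r e e' \<longleftrightarrow>
     (edge_head r e, edge_head r e') \<in> r - Id \<or>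
     edge_head r e = edge_head r e' \<and> (edge_tail r e, edge_tail r e') \<in> r - Id"


section \<open>Graded algebras over the rationals\<close>

record 'a graded_algebra = "(rat, 'a) module" +
  grade :: "nat \<Rightarrow> 'a set"

definition homogeneous_decomposition ::
  "('a, 'm) graded_algebra_scheme \<Rightarrow> (nat \<Rightarrow> 'a) \<Rightarrow> 'a \<Rightarrow> bool" where
  "homogeneous_decomposition A c x \<longleftrightarrow>
     (\<forall>n. c n \<in> grade A n) \<and> finite {n. c n \<noteq> \<zero>\<^bsub>A\<^esub>} \<and>
     x = finsum A c {n. c n \<noteq> \<zero>\<^bsub>A\<^esub>}"

definition connected_graded_algebra :: "('a, 'm) graded_algebra_scheme \<Rightarrow> bool" where
  "connected_graded_algebra A \<longleftrightarrow>
     ring A \<and> module ring_of_type_algebra A \<and>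
     (\<forall>c. \<forall>x\<in>carrier A. \<forall>y\<in>carrier A.
        (c \<odot>\<^bsub>A\<^esub> x) \<otimes>\<^bsub>A\<^esub> y = c \<odot>\<^bsub>A\<^esub> (x \<otimes>\<^bsub>A\<^esub> y) \<and> x \<otimes>\<^bsub>A\<^esub> (c \<odot>\<^bsub>A\<^esub> y) = c \<odot>\<^bsub>A\<^esub> (x \<otimes>\<^bsub>A\<^esub> y)) \<and>
     (\<forall>n. submodule (grade A n) ring_of_type_algebra A) \<and>
     (\<forall>x\<in>carrier A. \<exists>!c. homogeneous_decomposition A c x) \<and>
     (\<forall>m n. \<forall>x\<in>grade A m. \<forall>y\<in>grade A n. x \<otimes>\<^bsub>A\<^esub> y \<in> grade A (m + n)) \<and>
     \<one>\<^bsub>A\<^esub> \<noteq> \<zero>\<^bsub>A\<^esub> \<and> grade A 0 = {c \<odot>\<^bsub>A\<^esub> \<one>\<^bsub>A\<^esub> | c. True}"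

definition augmentation :: "('a, 'm) graded_algebra_scheme \<Rightarrow> 'a \<Rightarrow> rat" where
  "augmentation A x = (THE q. \<exists>c. homogeneous_decomposition A c x \<and> c 0 = q \<odot>\<^bsub>A\<^esub> \<one>\<^bsub>A\<^esub>)"


subsection \<open>Ext of the trivial module\<close>

text \<open>
  \<open>Ext\<^sub>A(\<rat>, \<rat>)\<close> is computed from the bar resolution of the trivial left module \<open>\<rat>\<close>.  This is the
  resolution by the free left \<open>A\<close>-modules \<open>P\<^sub>n = A\<^sup>\<otimes>\<^sup>(\<^sup>n\<^sup>+\<^sup>1\<^sup>)\<close> (tensor product over \<open>\<rat>\<close>, with \<open>A\<close> acting on
  the first factor), augmented by \<open>\<epsilon> : P\<^sub>0 = A \<rightarrow> \<rat>\<close>, with differential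
  \<open>d(a\<^sub>0 \<otimes> \<dots> \<otimes> a\<^sub>n) = (\<Sum>k<n. (-1)^k a\<^sub>0 \<otimes> \<dots> \<otimes> a\<^sub>k a\<^sub>k\<^sub>+\<^sub>1 \<otimes> \<dots> \<otimes> a\<^sub>n) + (-1)^n \<epsilon>(a\<^sub>n) a\<^sub>0 \<otimes> \<dots> \<otimes> a\<^sub>n\<^sub>-\<^sub>1\<close>.

  An element of \<open>Hom\<^sub>A(P\<^sub>n, \<rat>)\<close> is represented by the corresponding multilinear function of
  \<open>(a\<^sub>0, \<dots>, a\<^sub>n)\<close>, which is \<open>A\<close>-linear in \<open>a\<^sub>0\<close>; a tuple is a list of length \<open>n + 1\<close>, and the function is
  taken to be 0 on all other lists.  The internal degree is \<open>j\<close> if the function factors through the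
  degree \<open>j\<close> part of \<open>P\<^sub>n\<close>.
\<close>

definition bar_tuples :: "('a, 'm) graded_algebra_scheme \<Rightarrow> nat \<Rightarrow> 'a list set" where
  "bar_tuples A n = {as. length as = Suc n \<and> set as \<subseteq> carrier A}"

definition bar_cochains :: "('a, 'm) graded_algebra_scheme \<Rightarrow> nat \<Rightarrow> nat \<Rightarrow> ('a list \<Rightarrow> rat) set" where
  "bar_cochains A n j = {\<phi>.
     (\<forall>as. as \<notin> bar_tuples A n \<longrightarrow> \<phi> as = 0) \<and>
     (\<forall>as\<in>bar_tuples A n. \<forall>k\<le>n. \<forall>x\<in>carrier A. \<forall>y\<in>carrier A.
        \<phi> (as[k := x \<oplus>\<^bsub>A\<^esub> y]) = \<phi> (as[k := x]) + \<phi> (as[k := y])) \<and>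
     (\<forall>as\<in>bar_tuples A n. \<forall>k\<le>n. \<forall>c. \<forall>x\<in>carrier A.
        \<phi> (as[k := c \<odot>\<^bsub>A\<^esub> x]) = c * \<phi> (as[k := x])) \<and>
     (\<forall>as\<in>bar_tuples A n. \<forall>b\<in>carrier A.
        \<phi> (as[0 := b \<otimes>\<^bsub>A\<^esub> (as ! 0)]) = augmentation A b * \<phi> as) \<and>
     (\<forall>as\<in>bar_tuples A n. \<forall>ds. length ds = Suc n \<and> (\<forall>k\<le>n. as ! k \<in> grade A (ds ! k)) \<and>
        sum_list ds \<noteq> j \<longrightarrow> \<phi> as = 0)}"

definition bar_cochain_group ::
  "('a, 'm) graded_algebra_scheme \<Rightarrow> nat \<Rightarrow> nat \<Rightarrow> ('a list \<Rightarrow> rat) monoid" where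
  "bar_cochain_group A n j =
     \<lparr>carrier = bar_cochains A n j, monoid.mult = (\<lambda>\<phi> \<psi> as. \<phi> as + \<psi> as), one = (\<lambda>as. 0)\<rparr>"

definition bar_coboundary ::
  "('a, 'm) graded_algebra_scheme \<Rightarrow> nat \<Rightarrow> ('a list \<Rightarrow> rat) \<Rightarrow> 'a list \<Rightarrow> rat" where
  "bar_coboundary A n \<phi> as =
     (if as \<in> bar_tuples A (Suc n)
      then (\<Sum>k<Suc n. (-1) ^ k *
              \<phi> (take k as @ (as ! k \<otimes>\<^bsub>A\<^esub> as ! Suc k) # drop (Suc (Suc k)) as))
           + (-1) ^ Suc n * (augmentation A (last as) * \<phi> (butlast as))
      else 0)"

definition bar_coboundaries ::
  "('a, 'm) graded_algebra_scheme \<Rightarrow> nat \<Rightarrow> nat \<Rightarrow> ('a list \<Rightarrow> rat) set" where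
  "bar_coboundaries A i j =
     (case i of 0 \<Rightarrow> {\<lambda>as. 0} | Suc n \<Rightarrow> bar_coboundary A n ` bar_cochains A n j)"

text \<open>The part of \<open>Ext\<^sup>i\<^sub>A(\<rat>, \<rat>)\<close> of internal degree \<open>j\<close>.\<close>

definition Ext_group ::
  "('a, 'm) graded_algebra_scheme \<Rightarrow> nat \<Rightarrow> nat \<Rightarrow> ('a list \<Rightarrow> rat) set monoid" where
  "Ext_group A i j =
     (bar_cochain_group A i j)
       \<lparr>carrier := kernel (bar_cochain_group A i j) (bar_cochain_group A (Suc i) j) (bar_coboundary A i)\<rparr>
     Mod bar_coboundaries A i j"

definition Koszul :: "('a, 'm) graded_algebra_scheme \<Rightarrow> bool" where
  "Koszul A \<longleftrightarrow> connected_graded_algebra A \<and>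
     (\<forall>i j. j \<noteq> i \<longrightarrow> trivial_group (Ext_group A i j))"


section \<open>Exterior algebras and quotients\<close>

text \<open>With concatenation as addition of lists, \<^typ>\<open>'x list \<Rightarrow>\<^sub>0 rat\<close> is the free
  associative algebra on \<^typ>\<open>'x\<close>.\<close>

instantiation list :: (type) monoid_add
begin

definition zero_list :: "'a list" where "zero_list = []"

definition plus_list :: "'a list \<Rightarrow> 'a list \<Rightarrow> 'a list" where "plus_list xs ys = xs @ ys"

instance by standard (simp_all add: zero_list_def plus_list_def)

end

definition free_algebra :: "'x set \<Rightarrow> ('x list \<Rightarrow>\<^sub>0 rat) graded_algebra" where
  "free_algebra B =
     \<lparr>carrier = {p. Poly_Mapping.keys p \<subseteq> lists B},
      monoid.mult = (*), one = 1, ring.zero = 0, add = (+),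
      smult = (\<lambda>c p. Poly_Mapping.single 0 c * p),
      grade = (\<lambda>n. {p. Poly_Mapping.keys p \<subseteq> {w \<in> lists B. length w = n}})\<rparr>"

definition quotient_algebra ::
  "('a, 'm) graded_algebra_scheme \<Rightarrow> 'a set \<Rightarrow> 'a set graded_algebra" where
  "quotient_algebra A I =
     \<lparr>carrier = carrier (A Quot I),
      monoid.mult = monoid.mult (A Quot I), one = \<one>\<^bsub>A Quot I\<^esub>,
      ring.zero = \<zero>\<^bsub>A Quot I\<^esub>, add = add (A Quot I),
      smult = (\<lambda>c S. \<Union>x\<in>S. I +>\<^bsub>A\<^esub> (c \<odot>\<^bsub>A\<^esub> x)),
      grade = (\<lambda>n. (\<lambda>x. I +>\<^bsub>A\<^esub> x) ` grade A n)\<rparr>"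

text \<open>The exterior algebra on the vector space with basis \<open>B\<close>, as a quotient of the tensor algebra.\<close>

definition exterior_ideal :: "'x set \<Rightarrow> ('x list \<Rightarrow>\<^sub>0 rat) set" where
  "exterior_ideal B = Idl\<^bsub>free_algebra B\<^esub> {v * v | v. v \<in> grade (free_algebra B) 1}"

definition exterior_algebra :: "'x set \<Rightarrow> ('x list \<Rightarrow>\<^sub>0 rat) set graded_algebra" where
  "exterior_algebra B = quotient_algebra (free_algebra B) (exterior_ideal B)"


section \<open>The algebra of a chordal arrangement\<close>

datatype 'v arr_gen = GenX nat 'v | GenY nat 'v | GenE "'v set"

definition arr_gens :: "nat \<Rightarrow> 'v set \<Rightarrow> 'v set set \<Rightarrow> 'v arr_gen set" where
  "arr_gens g V E = {GenX i v | i v. i \<in> {1..g} \<and> v \<in> V} \<union>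
     {GenY i v | i v. i \<in> {1..g} \<and> v \<in> V} \<union> GenE ` E"

definition xg :: "nat \<Rightarrow> 'v \<Rightarrow> 'v arr_gen list \<Rightarrow>\<^sub>0 rat" where
  "xg i v = Poly_Mapping.single [GenX i v] 1"

definition yg :: "nat \<Rightarrow> 'v \<Rightarrow> 'v arr_gen list \<Rightarrow>\<^sub>0 rat" where
  "yg i v = Poly_Mapping.single [GenY i v] 1"

definition eg :: "'v set \<Rightarrow> 'v arr_gen list \<Rightarrow>\<^sub>0 rat" where
  "eg e = Poly_Mapping.single [GenE e] 1"

text \<open>The relations are written as representatives in the tensor algebra.\<close>

definition cycle_relations :: "'v set set \<Rightarrow> 'v rel \<Rightarrow> ('v arr_gen list \<Rightarrow>\<^sub>0 rat) set" where
  "cycle_relations E r =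
     {\<Sum>j<length es. (-1) ^ Suc j * prod_list (map eg (take j es @ drop (Suc j) es)) | es.
        sorted_wrt (edge_less r) es \<and> (\<exists>vs. graph_cycle E vs \<and> set es = cycle_edges vs)}"

definition edge_relations ::
  "nat \<Rightarrow> 'v set set \<Rightarrow> 'v rel \<Rightarrow> ('v arr_gen list \<Rightarrow>\<^sub>0 rat) set" where
  "edge_relations g E r =
     {(xg i (edge_head r e) - xg i (edge_tail r e)) * eg e | i e. i \<in> {1..g} \<and> e \<in> E} \<union>
     {(yg i (edge_head r e) - yg i (edge_tail r e)) * eg e | i e. i \<in> {1..g} \<and> e \<in> E}"

definition vertex_relations :: "nat \<Rightarrow> 'v set \<Rightarrow> ('v arr_gen list \<Rightarrow>\<^sub>0 rat) set" where
  "vertex_relations g V =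
     {xg i v * yg j v | i j v. i \<in> {1..g} \<and> j \<in> {1..g} \<and> i \<noteq> j \<and> v \<in> V} \<union>
     {xg i v * xg j v | i j v. i \<in> {1..g} \<and> j \<in> {1..g} \<and> i \<noteq> j \<and> v \<in> V} \<union>
     {yg i v * yg j v | i j v. i \<in> {1..g} \<and> j \<in> {1..g} \<and> i \<noteq> j \<and> v \<in> V} \<union>
     {xg i v * yg i v - xg j v * yg j v | i j v. i \<in> {1..g} \<and> j \<in> {1..g} \<and> v \<in> V}"

text \<open>The algebra \<open>A(\<A>)\<close> depends on the curve only through its genus \<open>g\<close>, and on the arrangement
  through the graph \<open>(V, E)\<close> indexing the subspaces \<open>H\<^sub>e\<close> and the ordering \<open>r\<close> of its vertices.\<close>

definition arrangement_algebra ::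
  "nat \<Rightarrow> 'v set \<Rightarrow> 'v set set \<Rightarrow> 'v rel \<Rightarrow> ('v arr_gen list \<Rightarrow>\<^sub>0 rat) set set graded_algebra" where
  "arrangement_algebra g V E r =
     (let B = arr_gens g V E; \<Lambda> = exterior_algebra B
      in quotient_algebra \<Lambda> (Idl\<^bsub>\<Lambda>\<^esub> ((\<lambda>p. exterior_ideal B +>\<^bsub>free_algebra B\<^esub> p) `
           (cycle_relations E r \<union> edge_relations g E r \<union> vertex_relations g V))))"

end

theory Submission
  imports Defs
begin

text \<open>
  The reason why \<open>A = A(\<A>)\<close> is Koszul is that it has a basis of words in its generators that is
  described by forbidding certain pairs of adjacent letters.  Number the vertices in the elimination
  order and say that \<open>x\<^sub>v\<^sup>i\<close>, \<open>y\<^sub>v\<^sup>i\<close> and the edges with head \<open>v\<close> have level \<open>v\<close>.  A word is normal if it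
  is a product of blocks of strictly decreasing levels, where the block of level \<open>v\<close> is empty, one
  letter, or \<open>y\<^sub>v\<^sup>1 x\<^sub>v\<^sup>1\<close>.  Adding the vertex \<open>v\<close> thus multiplies the algebra by the free module on
  \<open>1, x\<^sub>v\<^sup>i, y\<^sub>v\<^sup>i, y\<^sub>v\<^sup>1 x\<^sub>v\<^sup>1\<close> and the edges at \<open>v\<close>, as the cohomology of a punctured curve suggests.

  Koszulness follows from a Koszul filtration: a family of left ideals containing 0 and \<open>A\<^sub>+\<close> such that
  each nonzero member \<open>I\<close> is \<open>J + A x\<close> with \<open>J\<close> in the family, \<open>x\<close> of degree 1, and the colon ideal \<open>J : x\<close>
  again in the family.  The long exact sequence of \<open>0 \<rightarrow> A/(J : x)(-1) \<rightarrow> A/J \<rightarrow> A/I \<rightarrow> 0\<close> and induction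
  show that \<open>Ext\<^sup>n(A/I, \<rat>)\<close> lives in degree \<open>n\<close>; this is carried out on bar cochains in
  \<open>koszul_step_exact\<close> and \<open>Koszul_if_filtration\<close>.  Here the ideals are spanned by the words
  whose last letter belongs to an initial segment of the generators, ordered by level and, in each
  level, with \<open>x\<^sup>1\<close> first and \<open>y\<^sup>1\<close> last.  Their colon ideals are seen on normal words
  (\<open>Koszul_if_normal_words\<close>).

  Two things have to be known about \<open>A\<close>.  First, the quadratic relations move small letters to the
  right (\<open>reduces_colon\<close>); chordality is used here, since for two edges \<open>{u, v}\<close>, \<open>{w, v}\<close> with head \<open>v\<close>
  the triangle relation rewrites \<open>g\<^sub>u\<^sub>v g\<^sub>w\<^sub>v\<close> in terms of the third edge \<open>{u, w}\<close>.  Spanning by normal words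
  is then automatic.  Second, the normal words are linearly independent.  For each forest on the
  vertices, given by parents \<open>p v < v\<close>, there is a homomorphism from \<open>A\<close> to the tensor product of a copy of
  \<open>H\<^sup>*(C)\<close> for each root and an exterior algebra with one generator \<open>\<eta>\<^sub>v\<close> for each other vertex.  Here
  \<open>x\<^sub>v\<close> goes to \<open>x\<close> at the root of \<open>v\<close>, and the edge \<open>{u, v}\<close> to \<open>\<eta>\<^sub>z\<close>, where \<open>z\<close> is the
  vertex whose move to its parent makes \<open>u\<close> and \<open>v\<close> meet, or to 0 if they never meet.  The labels \<open>z\<close>
  behave like an ultrametric, so that the smallest label on a cycle occurs twice, and this kills all
  cycle relations (\<open>cycle_labels_coincide\<close>).  Applied to the vacuum, these homomorphisms yield a basis
  dual to the normal words (\<open>functional_dual\<close>).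
\<close>

section \<open>The bar complex\<close>

definition merge_at :: "('a \<Rightarrow> 'a \<Rightarrow> 'a) \<Rightarrow> nat \<Rightarrow> 'a list \<Rightarrow> 'a list" where
  "merge_at f k xs = take k xs @ f (xs ! k) (xs ! Suc k) # drop (Suc (Suc k)) xs"

lemma length_merge_at: "Suc k < length xs \<Longrightarrow> length (merge_at f k xs) = length xs - 1"
  by (simp add: merge_at_def)

lemma nth_merge_at:
  assumes "Suc k < length xs" "i < length xs - 1"
  shows "merge_at f k xs ! i =
    (if i < k then xs ! i else if i = k then f (xs ! k) (xs ! Suc k) else xs ! Suc i)"
proof -
  have "i - k = Suc (i - Suc k)" if "k < i" using that by simp
  with assms show ?thesis
    by (auto simp: merge_at_def nth_append not_less nth_Cons split: nat.split)
qed

lemma set_merge_at: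
  "Suc k < length xs \<Longrightarrow> set (merge_at f k xs) \<subseteq> insert (f (xs ! k) (xs ! Suc k)) (set xs)"
  by (auto simp: merge_at_def dest: in_set_takeD in_set_dropD)

lemma sum_list_merge_at:
  fixes ds :: "nat list"
  assumes "Suc k < length ds"
  shows "sum_list (merge_at (+) k ds) = sum_list ds"
proof -
  have "ds = take k ds @ ds ! k # ds ! Suc k # drop (Suc (Suc k)) ds"
    using assms by (simp add: Cons_nth_drop_Suc)
  then have "sum_list ds = sum_list (take k ds @ ds ! k # ds ! Suc k # drop (Suc (Suc k)) ds)"
    by simp
  then show ?thesis by (simp add: merge_at_def)
qed

lemma merge_at_append1:
  assumes "Suc k < length xs"
  shows "merge_at f k (xs @ [y]) = merge_at f k xs @ [y]"
  using assms by (simp add: merge_at_def nth_append)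

lemma merge_at_append1_last:
  assumes "length xs = Suc k"
  shows "merge_at f k (xs @ [y]) = xs[k := f (xs ! k) y]"
proof -
  have "take k (xs @ [y]) = take k xs" "drop (Suc (Suc k)) (xs @ [y]) = []"
    "(xs @ [y]) ! k = xs ! k" "(xs @ [y]) ! Suc k = y"
    using assms by (simp_all add: nth_append)
  moreover have "xs[k := f (xs ! k) y] = take k xs @ [f (xs ! k) y]"
    using assms by (simp add: upd_conv_take_nth_drop)
  ultimately show ?thesis by (simp add: merge_at_def)
qed

lemma merge_at_update:
  assumes "Suc k < length xs" "m < length xs"
  shows "m < k \<Longrightarrow> merge_at f k (xs[m := x]) = (merge_at f k xs)[m := x]"
    and "m = k \<Longrightarrow> merge_at f k (xs[m := x]) = (merge_at f k xs)[k := f x (xs ! Suc k)]"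
    and "m = Suc k \<Longrightarrow> merge_at f k (xs[m := x]) = (merge_at f k xs)[k := f (xs ! k) x]"
    and "m > Suc k \<Longrightarrow> merge_at f k (xs[m := x]) = (merge_at f k xs)[m - 1 := x]"
  using assms
  by (auto intro!: nth_equalityI simp: length_merge_at nth_merge_at nth_list_update)

text \<open>The simplicial identity behind \<open>d \<circ> d = 0\<close>; for \<open>k = m\<close> it is associativity.\<close>

lemma merge_at_merge_at:
  assumes "k \<le> m" "Suc (Suc m) < length xs"
    and "\<And>i. i < length xs - 2 \<Longrightarrow>
          f (f (xs ! i) (xs ! Suc i)) (xs ! Suc (Suc i)) = f (xs ! i) (f (xs ! Suc i) (xs ! Suc (Suc i)))"
  shows "merge_at f k (merge_at f (Suc m) xs) = merge_at f m (merge_at f k xs)"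
proof (rule nth_equalityI)
  show "length (merge_at f k (merge_at f (Suc m) xs)) = length (merge_at f m (merge_at f k xs))"
    using assms by (simp add: length_merge_at)
next
  fix i assume "i < length (merge_at f k (merge_at f (Suc m) xs))"
  then have "i < length xs - 2" using assms by (simp add: length_merge_at)
  then show "merge_at f k (merge_at f (Suc m) xs) ! i = merge_at f m (merge_at f k xs) ! i"
    using assms by (auto simp: length_merge_at nth_merge_at)
qed

text \<open>In a connected graded algebra the augmentation is a homomorphism.  Assuming this avoids the
  calculation with homogeneous decompositions; for a quotient of a free algebra the augmentation is
  the constant coefficient, where the assumptions are evident.\<close>

locale augmented_algebra =
  fixes A :: "('a, 'm) graded_algebra_scheme" (structure)
  assumes connected_graded: "connected_graded_algebra A"
    and aug_add: "x \<in> carrier A \<Longrightarrow> y \<in> carrier A \<Longrightarrow>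
          augmentation A (x \<oplus> y) = augmentation A x + augmentation A y"
    and aug_smult: "x \<in> carrier A \<Longrightarrow> augmentation A (c \<odot>\<^bsub>A\<^esub> x) = c * augmentation A x"
    and aug_mult: "x \<in> carrier A \<Longrightarrow> y \<in> carrier A \<Longrightarrow>
          augmentation A (x \<otimes> y) = augmentation A x * augmentation A y"
    and aug_one: "augmentation A \<one> = 1"
    and aug_grade: "x \<in> grade A (Suc n) \<Longrightarrow> augmentation A x = 0"

sublocale augmented_algebra \<subseteq> ring A
  using connected_graded by (simp add: connected_graded_algebra_def)

context augmented_algebra
begin

abbreviation eps :: "'a \<Rightarrow> rat" where "eps \<equiv> augmentation A"

lemma scalar_module: "module ring_of_type_algebra A"
  using connected_graded by (simp add: connected_graded_algebra_def)

lemma smult_in [simp]: "x \<in> carrier A \<Longrightarrow> c \<odot>\<^bsub>A\<^esub> x \<in> carrier A"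
  using module.smult_closed[OF scalar_module, of c x] by (simp add: ring_of_type_algebra_def)

lemma smult_mult:
  assumes "x \<in> carrier A" "y \<in> carrier A"
  shows "(c \<odot>\<^bsub>A\<^esub> x) \<otimes> y = c \<odot>\<^bsub>A\<^esub> (x \<otimes> y)" "x \<otimes> (c \<odot>\<^bsub>A\<^esub> y) = c \<odot>\<^bsub>A\<^esub> (x \<otimes> y)"
  using connected_graded assms by (simp_all add: connected_graded_algebra_def)

lemma grade_submodule: "submodule (grade A n) ring_of_type_algebra A"
  using connected_graded by (simp add: connected_graded_algebra_def)

lemma grade_carrier: "x \<in> grade A n \<Longrightarrow> x \<in> carrier A"
  using grade_submodule[of n] subgroup.subset[of "grade A n" "add_monoid A"]
  by (auto simp: submodule_def)

lemma grade_mult: "x \<in> grade A m \<Longrightarrow> y \<in> grade A n \<Longrightarrow> x \<otimes> y \<in> grade A (m + n)"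
  using connected_graded by (simp add: connected_graded_algebra_def)

lemma smult_one': "x \<in> carrier A \<Longrightarrow> 1 \<odot>\<^bsub>A\<^esub> x = x"
  using module.smult_one[OF scalar_module, of x] by (simp add: ring_of_type_algebra_def)

lemma one_grade: "\<one> \<in> grade A 0"
proof -
  have "grade A 0 = {c \<odot>\<^bsub>A\<^esub> \<one> | c. True}"
    using connected_graded by (simp add: connected_graded_algebra_def)
  then show ?thesis using smult_one'[of \<one>] by (metis (mono_tags, lifting) mem_Collect_eq one_closed)
qed

definition tuples :: "nat \<Rightarrow> 'a list set" where
  "tuples L = {as. length as = L \<and> set as \<subseteq> carrier A}"

lemma tuples_update: "as \<in> tuples L \<Longrightarrow> x \<in> carrier A \<Longrightarrow> as[k := x] \<in> tuples L"
  using set_update_subset_insert[of as k x] by (auto simp: tuples_def)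

lemma tuples_nth: "as \<in> tuples L \<Longrightarrow> k < L \<Longrightarrow> as ! k \<in> carrier A"
  by (auto simp: tuples_def)

lemma tuples_merge:
  assumes "as \<in> tuples (Suc L)" "k < L"
  shows "merge_at (\<otimes>) k as \<in> tuples L"
proof -
  have "as ! k \<otimes> as ! Suc k \<in> carrier A" using assms by (simp add: tuples_nth)
  moreover have "Suc k < length as" using assms by (simp add: tuples_def)
  ultimately show ?thesis
    using set_merge_at[of k as "(\<otimes>)"] assms by (auto simp: tuples_def length_merge_at)
qed

lemma bar_tuples_eq: "bar_tuples A n = tuples (Suc n)"
  by (simp add: bar_tuples_def tuples_def)

text \<open>
  For a graded left ideal \<open>I\<close> these are the cochains, in the internal degrees in \<open>S\<close>, of the bar
  complex computing \<open>Ext\<^sub>A(A/I, \<rat>)\<close>: functions of \<open>(a\<^sub>0, \<dots>, a\<^sub>n, m)\<close> in which the last argument only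
  matters modulo \<open>I\<close>.  A set of degrees, rather than a single one, makes the shift by one degree
  harmless in degree 0.
\<close>

definition cochains :: "nat \<Rightarrow> 'a set \<Rightarrow> nat set \<Rightarrow> ('a list \<Rightarrow> rat) set" where
  "cochains L I S = {\<phi>.
     (\<forall>as. as \<notin> tuples L \<longrightarrow> \<phi> as = 0) \<and>
     (\<forall>as\<in>tuples L. \<forall>k<L. \<forall>x\<in>carrier A. \<forall>y\<in>carrier A.
        \<phi> (as[k := x \<oplus> y]) = \<phi> (as[k := x]) + \<phi> (as[k := y])) \<and>
     (\<forall>as\<in>tuples L. \<forall>k<L. \<forall>c. \<forall>x\<in>carrier A. \<phi> (as[k := c \<odot>\<^bsub>A\<^esub> x]) = c * \<phi> (as[k := x])) \<and>
     (\<forall>as\<in>tuples L. \<forall>b\<in>carrier A. \<phi> (as[0 := b \<otimes> (as ! 0)]) = eps b * \<phi> as) \<and>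
     (\<forall>as\<in>tuples L. as ! (L - 1) \<in> I \<longrightarrow> \<phi> as = 0) \<and>
     (\<forall>as\<in>tuples L. \<forall>ds. length ds = L \<and> (\<forall>k<L. as ! k \<in> grade A (ds ! k)) \<and>
        sum_list ds \<notin> S \<longrightarrow> \<phi> as = 0)}"

lemma cochainsI:
  assumes "\<And>as. as \<notin> tuples L \<Longrightarrow> \<phi> as = 0"
    and "\<And>as k x y. \<lbrakk>as \<in> tuples L; k < L; x \<in> carrier A; y \<in> carrier A\<rbrakk> \<Longrightarrow>
        \<phi> (as[k := x \<oplus> y]) = \<phi> (as[k := x]) + \<phi> (as[k := y])"
    and "\<And>as k c x. \<lbrakk>as \<in> tuples L; k < L; x \<in> carrier A\<rbrakk> \<Longrightarrow>
        \<phi> (as[k := c \<odot>\<^bsub>A\<^esub> x]) = c * \<phi> (as[k := x])"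
    and "\<And>as b. as \<in> tuples L \<Longrightarrow> b \<in> carrier A \<Longrightarrow> \<phi> (as[0 := b \<otimes> (as ! 0)]) = eps b * \<phi> as"
    and "\<And>as. as \<in> tuples L \<Longrightarrow> as ! (L - 1) \<in> I \<Longrightarrow> \<phi> as = 0"
    and "\<And>as ds. \<lbrakk>as \<in> tuples L; length ds = L; \<And>k. k < L \<Longrightarrow> as ! k \<in> grade A (ds ! k);
        sum_list ds \<notin> S\<rbrakk> \<Longrightarrow> \<phi> as = 0"
  shows "\<phi> \<in> cochains L I S"
  unfolding cochains_def mem_Collect_eq
proof (intro conjI ballI allI impI; (elim conjE)?)
qed (use assms in \<open>simp_all\<close>)

lemma cochainsD:
  assumes "\<phi> \<in> cochains L I S"
  shows "\<And>as. as \<notin> tuples L \<Longrightarrow> \<phi> as = 0"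
    and "\<And>as k x y. \<lbrakk>as \<in> tuples L; k < L; x \<in> carrier A; y \<in> carrier A\<rbrakk> \<Longrightarrow>
        \<phi> (as[k := x \<oplus> y]) = \<phi> (as[k := x]) + \<phi> (as[k := y])"
    and "\<And>as k c x. \<lbrakk>as \<in> tuples L; k < L; x \<in> carrier A\<rbrakk> \<Longrightarrow>
        \<phi> (as[k := c \<odot>\<^bsub>A\<^esub> x]) = c * \<phi> (as[k := x])"
    and "\<And>as b. as \<in> tuples L \<Longrightarrow> b \<in> carrier A \<Longrightarrow> \<phi> (as[0 := b \<otimes> (as ! 0)]) = eps b * \<phi> as"
    and "\<And>as. as \<in> tuples L \<Longrightarrow> as ! (L - 1) \<in> I \<Longrightarrow> \<phi> as = 0"
    and "\<And>as ds. \<lbrakk>as \<in> tuples L; length ds = L; \<And>k. k < L \<Longrightarrow> as ! k \<in> grade A (ds ! k);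
        sum_list ds \<notin> S\<rbrakk> \<Longrightarrow> \<phi> as = 0"
  using assms unfolding cochains_def mem_Collect_eq by (blast intro: allI)+

lemma bar_cochains_eq: "bar_cochains A n j = cochains (Suc n) {} {j}"
  by (simp add: bar_cochains_def cochains_def bar_tuples_eq less_Suc_eq_le)

lemma cochains_mono: "\<phi> \<in> cochains L I S \<Longrightarrow> J \<subseteq> I \<Longrightarrow> \<phi> \<in> cochains L J S"
  unfolding cochains_def by auto

lemma cochains_diff:
  assumes "\<phi> \<in> cochains L I S" "\<psi> \<in> cochains L I S"
  shows "(\<lambda>as. \<phi> as - \<psi> as) \<in> cochains L I S"
  using assms unfolding cochains_def by (auto simp: algebra_simps)

lemma cochains_scale:
  assumes "\<phi> \<in> cochains L I S"
  shows "(\<lambda>as. c * \<phi> as) \<in> cochains L I S"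
  using assms unfolding cochains_def by (auto simp: algebra_simps)

lemma cochains_zero: "(\<lambda>as. 0) \<in> cochains L I S"
  unfolding cochains_def by simp

lemma cochains_add:
  assumes "\<phi> \<in> cochains L I S" "\<psi> \<in> cochains L I S"
  shows "(\<lambda>as. \<phi> as + \<psi> as) \<in> cochains L I S"
  using cochains_diff[OF assms(1) cochains_scale[OF assms(2), of "-1"]] by simp

lemma cochains_update_zero:
  assumes "\<phi> \<in> cochains L I S" "as \<in> tuples L" "k < L"
  shows "\<phi> (as[k := \<zero>]) = 0"
  using cochainsD(2)[OF assms(1,2,3), of \<zero> \<zero>] by simp

lemma cochains_zero_ideal:
  assumes "\<phi> \<in> cochains L {} S" "0 < L"
  shows "\<phi> \<in> cochains L {\<zero>} S"
proof -
  have "\<phi> as = 0" if "as \<in> tuples L" "as ! (L - 1) = \<zero>" for as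
    using cochains_update_zero[OF assms(1) that(1), of "L - 1"] that assms(2)
      list_update_id[of as "L - 1"] by simp
  then show ?thesis using assms(1) unfolding cochains_def by auto
qed

definition delta :: "nat \<Rightarrow> ('a list \<Rightarrow> rat) \<Rightarrow> 'a list \<Rightarrow> rat" where
  "delta L \<phi> as = (if as \<in> tuples (Suc L) then (\<Sum>k<L. (-1) ^ k * \<phi> (merge_at (\<otimes>) k as)) else 0)"

lemma delta_diff: "delta L (\<lambda>as. \<phi> as - \<psi> as) = (\<lambda>as. delta L \<phi> as - delta L \<psi> as)"
  by (auto simp: delta_def algebra_simps sum_subtractf)

lemma delta_scale: "delta L (\<lambda>as. c * \<phi> as) = (\<lambda>as. c * delta L \<phi> as)"
  by (auto simp: delta_def sum_distrib_left algebra_simps)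

definition left_ideal :: "'a set \<Rightarrow> bool" where
  "left_ideal I \<longleftrightarrow> I \<subseteq> carrier A \<and> (\<forall>a\<in>carrier A. \<forall>x\<in>I. a \<otimes> x \<in> I)"

lemma delta_cochains:
  assumes phi: "\<phi> \<in> cochains L I S" and I: "left_ideal I" and "0 < L"
  shows "delta L \<phi> \<in> cochains (Suc L) I S"
proof (rule cochainsI)
  fix as k x y assume as: "as \<in> tuples (Suc L)" and k: "k < Suc L"
    and xy: "x \<in> carrier A" "y \<in> carrier A"
  have len: "length as = Suc L" using as by (simp add: tuples_def)
  have "\<phi> (merge_at (\<otimes>) i (as[k := x \<oplus> y])) =
        \<phi> (merge_at (\<otimes>) i (as[k := x])) + \<phi> (merge_at (\<otimes>) i (as[k := y]))" if i: "i < L" for i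
  proof -
    note t = tuples_merge[OF as i]
    note c = tuples_nth[OF as] 
    consider "k < i" | "k = i" | "k = Suc i" | "k > Suc i" by linarith
    then show ?thesis
      using i k xy t c len
      by cases (simp_all add: merge_at_update cochainsD(2)[OF phi] l_distr r_distr)
  qed
  then show "delta L \<phi> (as[k := x \<oplus> y]) = delta L \<phi> (as[k := x]) + delta L \<phi> (as[k := y])"
    using as xy by (simp add: delta_def tuples_update sum.distrib algebra_simps)
next
  fix as k c x assume as: "as \<in> tuples (Suc L)" and k: "k < Suc L" and x: "x \<in> carrier A"
  have len: "length as = Suc L" using as by (simp add: tuples_def)
  have "\<phi> (merge_at (\<otimes>) i (as[k := c \<odot>\<^bsub>A\<^esub> x])) = c * \<phi> (merge_at (\<otimes>) i (as[k := x]))"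
    if i: "i < L" for i
  proof -
    note t = tuples_merge[OF as i]
    note c = tuples_nth[OF as] 
    consider "k < i" | "k = i" | "k = Suc i" | "k > Suc i" by linarith
    then show ?thesis
      using i k x t c len
      by cases (simp_all add: merge_at_update cochainsD(3)[OF phi] smult_mult)
  qed
  then show "delta L \<phi> (as[k := c \<odot>\<^bsub>A\<^esub> x]) = c * delta L \<phi> (as[k := x])"
    using as x by (simp add: delta_def tuples_update sum_distrib_left algebra_simps)
next
  fix as b assume as: "as \<in> tuples (Suc L)" and b: "b \<in> carrier A"
  have len: "length as = Suc L" using as by (simp add: tuples_def)
  have "\<phi> (merge_at (\<otimes>) i (as[0 := b \<otimes> as ! 0])) = eps b * \<phi> (merge_at (\<otimes>) i as)"
    if i: "i < L" for i
  proof -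
    note t = tuples_merge[OF as i]
    have "merge_at (\<otimes>) i (as[0 := b \<otimes> as ! 0]) = (merge_at (\<otimes>) i as)[0 := b \<otimes> (merge_at (\<otimes>) i as) ! 0]"
      using i len b tuples_nth[OF as]
      by (cases i) (simp_all add: merge_at_update nth_merge_at m_assoc)
    then show ?thesis using cochainsD(4)[OF phi t b] by simp
  qed
  then show "delta L \<phi> (as[0 := b \<otimes> as ! 0]) = eps b * delta L \<phi> as"
    using as b tuples_nth[OF as]
    by (simp add: delta_def tuples_update sum_distrib_left algebra_simps)
next
  fix as assume as: "as \<in> tuples (Suc L)" and l: "as ! (Suc L - 1) \<in> I"
  have len: "length as = Suc L" using as by (simp add: tuples_def)
  have "\<phi> (merge_at (\<otimes>) i as) = 0" if i: "i < L" for i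
  proof (rule cochainsD(5)[OF phi tuples_merge[OF as i]])
    show "merge_at (\<otimes>) i as ! (L - 1) \<in> I"
      using i l len I tuples_nth[OF as, of i] by (auto simp: nth_merge_at left_ideal_def)
  qed
  then show "delta L \<phi> as = 0" by (simp add: delta_def)
next
  fix as ds assume as: "as \<in> tuples (Suc L)" and ds: "length ds = Suc L"
    and g: "\<And>k. k < Suc L \<Longrightarrow> as ! k \<in> grade A (ds ! k)" and s: "sum_list ds \<notin> S"
  have len: "length as = Suc L" using as by (simp add: tuples_def)
  have "\<phi> (merge_at (\<otimes>) i as) = 0" if i: "i < L" for i
  proof (rule cochainsD(6)[OF phi tuples_merge[OF as i]])
    show "length (merge_at (+) i ds) = L" using i ds by (simp add: length_merge_at)
    show "sum_list (merge_at (+) i ds) \<notin> S" using s i ds by (simp add: sum_list_merge_at)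
    show "merge_at (\<otimes>) i as ! k \<in> grade A (merge_at (+) i ds ! k)" if "k < L" for k
      using that i ds len g by (simp add: nth_merge_at grade_mult)
  qed
  then show "delta L \<phi> as = 0" by (simp add: delta_def)
qed (simp add: delta_def)

lemma delta_delta:
  "delta (Suc L) (delta L \<phi>) = (\<lambda>as. 0)"
proof
  fix as
  show "delta (Suc L) (delta L \<phi>) as = 0"
  proof (cases "as \<in> tuples (Suc (Suc L))")
    case True
    let ?t = "\<lambda>k m. (-1) ^ (k + m) * \<phi> (merge_at (\<otimes>) m (merge_at (\<otimes>) k as))"
    have len: "length as = Suc (Suc L)" using True by (simp add: tuples_def)
    define D where "D = {(k, m). k \<le> m \<and> m < L}"
    have "delta (Suc L) (delta L \<phi>) as = (\<Sum>k<Suc L. \<Sum>m<L. ?t k m)"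
      using True tuples_merge[OF True]
      by (simp add: delta_def sum_distrib_left power_add mult.assoc del: sum.lessThan_Suc)
    also have "\<dots> = (\<Sum>(k, m)\<in>{..<Suc L} \<times> {..<L}. ?t k m)"
      by (simp add: sum.cartesian_product)
    also have "{..<Suc L} \<times> {..<L} = D \<union> {(k, m). m < k \<and> k < Suc L}"
      by (auto simp: D_def)
    also have "(\<Sum>(k, m)\<in>\<dots>. ?t k m) =
        (\<Sum>(k, m)\<in>D. ?t k m) + (\<Sum>(k, m)\<in>{(k, m). m < k \<and> k < Suc L}. ?t k m)"
    proof (rule sum.union_disjoint)
      show "finite D" unfolding D_def by (rule finite_subset[of _ "{..<L} \<times> {..<L}"]) auto
      show "finite {(k, m). m < k \<and> k < Suc L}"
        by (rule finite_subset[of _ "{..<Suc L} \<times> {..<Suc L}"]) auto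
    qed (auto simp: D_def)
    also have "(\<Sum>(k, m)\<in>{(k, m). m < k \<and> k < Suc L}. ?t k m) =
        (\<Sum>(k, m)\<in>D. ?t (Suc m) k)"
    proof (rule sum.reindex_bij_witness[of _ "\<lambda>(k, m). (Suc m, k)" "\<lambda>(k, m). (m, k - 1)"])
      fix p assume "p \<in> {(k, m). m < k \<and> k < Suc L}"
      then obtain k m where p: "p = (Suc k, m)" "m \<le> k" "k < L"
        by (cases p) (auto simp: less_Suc_eq_le gr0_conv_Suc elim!: less_natE)
      show "(case case p of (k, m) \<Rightarrow> (m, k - 1) of (k, m) \<Rightarrow> ?t (Suc m) k) = (case p of (k, m) \<Rightarrow> ?t k m)"
        by (simp add: p add.commute)
    qed (auto simp: D_def)
    also have "(\<Sum>(k, m)\<in>D. ?t (Suc m) k) =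
        (\<Sum>(k, m)\<in>D. - ?t k m)"
    proof (rule sum.cong[OF refl], unfold D_def, clarify)
      fix k m assume "k \<le> m" "m < L"
      then have "merge_at (\<otimes>) k (merge_at (\<otimes>) (Suc m) as) = merge_at (\<otimes>) m (merge_at (\<otimes>) k as)"
        using len tuples_nth[OF True] by (intro merge_at_merge_at) (auto simp: m_assoc)
      then show "?t (Suc m) k = - ?t k m" by (simp add: add.commute)
    qed
    finally show ?thesis by (simp add: sum_negf split_def)
  qed (simp add: delta_def)
qed

text \<open>Right multiplication by \<open>x\<close> maps \<open>A/L\<close> to \<open>A/J\<close>, and a splitting \<open>\<rho>\<close> goes back; both act on cochains through the
  last argument.\<close>

definition pull_last :: "nat \<Rightarrow> ('a \<Rightarrow> 'a) \<Rightarrow> ('a list \<Rightarrow> rat) \<Rightarrow> 'a list \<Rightarrow> rat" where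
  "pull_last L h \<phi> as = (if as \<in> tuples L then \<phi> (as[L - 1 := h (as ! (L - 1))]) else 0)"

definition linear_endo :: "('a \<Rightarrow> 'a) \<Rightarrow> bool" where
  "linear_endo h \<longleftrightarrow> (\<forall>x\<in>carrier A. h x \<in> carrier A) \<and>
     (\<forall>x\<in>carrier A. \<forall>y\<in>carrier A. h (x \<oplus> y) = h x \<oplus> h y) \<and>
     (\<forall>c. \<forall>x\<in>carrier A. h (c \<odot>\<^bsub>A\<^esub> x) = c \<odot>\<^bsub>A\<^esub> h x)"

lemma pull_last_cochains:
  assumes phi: "\<phi> \<in> cochains L I S" and h: "linear_endo h" and L: "2 \<le> L"
    and I': "\<And>m. m \<in> I' \<Longrightarrow> h m \<in> I"
    and gr: "\<And>m d. m \<in> grade A d \<Longrightarrow> h m = \<zero> \<or> (\<exists>d'. h m \<in> grade A d' \<and> (\<forall>s. s + d' \<in> S \<longrightarrow> s + d \<in> S'))"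
  shows "pull_last L h \<phi> \<in> cochains L I' S'"
proof -
  have hc: "h x \<in> carrier A" if "x \<in> carrier A" for x using h that by (simp add: linear_endo_def)
  have hadd: "h (x \<oplus> y) = h x \<oplus> h y" if "x \<in> carrier A" "y \<in> carrier A" for x y
    using h that by (simp add: linear_endo_def)
  have hsm: "h (c \<odot>\<^bsub>A\<^esub> x) = c \<odot>\<^bsub>A\<^esub> h x" if "x \<in> carrier A" for x c
    using h that by (simp add: linear_endo_def)
  show ?thesis
  proof (rule cochainsI)
    fix as k x y assume as: "as \<in> tuples L" and k: "k < L" and xy: "x \<in> carrier A" "y \<in> carrier A"
    have len: "length as = L" using as by (simp add: tuples_def)
    show "pull_last L h \<phi> (as[k := x \<oplus> y]) = pull_last L h \<phi> (as[k := x]) + pull_last L h \<phi> (as[k := y])"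
    proof (cases "k = L - 1")
      case True
      then show ?thesis using as xy k len L
        by (simp add: pull_last_def tuples_update hadd hc cochainsD(2)[OF phi])
    next
      case False
      let ?bs = "as[L - 1 := h (as ! (L - 1))]"
      have "?bs \<in> tuples L" using as L by (intro tuples_update hc tuples_nth[of _ L]) auto
      moreover have "as[k := z, L - 1 := w] = as[L - 1 := w, k := z]" for z w
        using False by (rule list_update_swap)
      ultimately show ?thesis using cochainsD(2)[OF phi _ k xy, of ?bs] as xy k len False
        by (simp add: pull_last_def tuples_update del: One_nat_def)
    qed
  next
    fix as k c x assume as: "as \<in> tuples L" and k: "k < L" and x: "x \<in> carrier A"
    have len: "length as = L" using as by (simp add: tuples_def)
    show "pull_last L h \<phi> (as[k := c \<odot>\<^bsub>A\<^esub> x]) = c * pull_last L h \<phi> (as[k := x])"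
    proof (cases "k = L - 1")
      case True
      then show ?thesis using as x k len L
        by (simp add: pull_last_def tuples_update hsm hc cochainsD(3)[OF phi])
    next
      case False
      let ?bs = "as[L - 1 := h (as ! (L - 1))]"
      have "?bs \<in> tuples L" using as L by (intro tuples_update hc tuples_nth[of _ L]) auto
      moreover have "as[k := z, L - 1 := w] = as[L - 1 := w, k := z]" for z w
        using False by (rule list_update_swap)
      ultimately show ?thesis using cochainsD(3)[OF phi _ k x, of ?bs] as x k len False
        by (simp add: pull_last_def tuples_update del: One_nat_def)
    qed
  next
    fix as b assume as: "as \<in> tuples L" and b: "b \<in> carrier A"
    have len: "length as = L" using as by (simp add: tuples_def)
    let ?bs = "as[L - 1 := h (as ! (L - 1))]"
    have "?bs \<in> tuples L" using as L by (intro tuples_update hc tuples_nth[of _ L]) auto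
    moreover have "as[0 := z, L - 1 := w] = as[L - 1 := w, 0 := z]" for z w
      using L by (intro list_update_swap) simp
    ultimately show "pull_last L h \<phi> (as[0 := b \<otimes> as ! 0]) = eps b * pull_last L h \<phi> as"
      using cochainsD(4)[OF phi _ b, of ?bs] as b len L tuples_nth[OF as, of 0]
      by (simp add: pull_last_def tuples_update del: One_nat_def)
  next
    fix as assume as: "as \<in> tuples L" and l: "as ! (L - 1) \<in> I'"
    have len: "length as = L" using as by (simp add: tuples_def)
    let ?bs = "as[L - 1 := h (as ! (L - 1))]"
    have "?bs \<in> tuples L" using as L by (intro tuples_update hc tuples_nth[of _ L]) auto
    then have "\<phi> ?bs = 0" using I'[OF l] len L by (intro cochainsD(5)[OF phi]) auto
    then show "pull_last L h \<phi> as = 0" by (simp add: pull_last_def)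
  next
    fix as ds assume as: "as \<in> tuples L" and ds: "length ds = L"
      and g: "\<And>k. k < L \<Longrightarrow> as ! k \<in> grade A (ds ! k)" and s: "sum_list ds \<notin> S'"
    have len: "length as = L" using as by (simp add: tuples_def)
    let ?bs = "as[L - 1 := h (as ! (L - 1))]"
    have bs: "?bs \<in> tuples L" using as L by (intro tuples_update hc tuples_nth[of _ L]) auto
    have "as ! (L - 1) \<in> grade A (ds ! (L - 1))" using g L by simp
    from gr[OF this] have "\<phi> ?bs = 0"
    proof
      assume "h (as ! (L - 1)) = \<zero>"
      then show ?thesis using cochains_update_zero[OF phi as, of "L - 1"] L by simp
    next
      assume "\<exists>d'. h (as ! (L - 1)) \<in> grade A d' \<and> (\<forall>s. s + d' \<in> S \<longrightarrow> s + ds ! (L - 1) \<in> S')"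
      then obtain d' where d': "h (as ! (L - 1)) \<in> grade A d'"
        "\<And>s. s + d' \<in> S \<Longrightarrow> s + ds ! (L - 1) \<in> S'" by blast
      have "take (L - 1) ds @ [ds ! (L - 1)] = ds"
        using take_Suc_conv_app_nth[of "L - 1" ds] ds L by simp
      then have "sum_list ds = sum_list (take (L - 1) ds @ [ds ! (L - 1)])" by simp
      then have sd: "sum_list ds = sum_list (take (L - 1) ds) + ds ! (L - 1)" by simp
      show ?thesis
      proof (rule cochainsD(6)[OF phi bs])
        show "length (ds[L - 1 := d']) = L" using ds by simp
        have "ds[L - 1 := d'] = take (L - 1) ds @ [d']"
          using ds L by (simp add: upd_conv_take_nth_drop)
        then show "sum_list (ds[L - 1 := d']) \<notin> S" using d'(2) s sd by auto
        show "?bs ! k \<in> grade A (ds[L - 1 := d'] ! k)" if "k < L" for k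
          using that g d'(1) len ds by (auto simp: nth_list_update)
      qed
    qed
    then show "pull_last L h \<phi> as = 0" by (simp add: pull_last_def)
  qed (simp add: pull_last_def)
qed

lemma linear_endo_rmult: "x \<in> carrier A \<Longrightarrow> linear_endo (\<lambda>m. m \<otimes> x)"
  by (simp add: linear_endo_def l_distr smult_mult)

lemma delta_pull_last:
  assumes x: "x \<in> carrier A" and L: "2 \<le> L"
  shows "delta L (pull_last L (\<lambda>m. m \<otimes> x) \<phi>) = pull_last (Suc L) (\<lambda>m. m \<otimes> x) (delta L \<phi>)"
proof
  fix as
  show "delta L (pull_last L (\<lambda>m. m \<otimes> x) \<phi>) as = pull_last (Suc L) (\<lambda>m. m \<otimes> x) (delta L \<phi>) as"
  proof (cases "as \<in> tuples (Suc L)")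
    case True
    have len: "length as = Suc L" using True by (simp add: tuples_def)
    have bs: "as[L := as ! L \<otimes> x] \<in> tuples (Suc L)"
      using True x by (simp add: tuples_update tuples_nth)
    have "(merge_at (\<otimes>) k as)[L - 1 := merge_at (\<otimes>) k as ! (L - 1) \<otimes> x] =
          merge_at (\<otimes>) k (as[L := as ! L \<otimes> x])" if k: "k < L" for k
    proof -
      consider "Suc k < L" | "L = Suc k" using k by linarith
      then show ?thesis
      proof cases
        case 1
        then obtain L' where "L = Suc L'" "k < L'" by (cases L) auto
        then show ?thesis using len by (simp add: merge_at_update nth_merge_at)
      next
        case 2
        then show ?thesis using len x tuples_nth[OF True]
          by (simp add: merge_at_update nth_merge_at m_assoc)
      qed
    qed
    then show ?thesis using True bs tuples_merge[OF True]
      by (simp add: delta_def pull_last_def)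
  qed (simp add: delta_def pull_last_def)
qed

text \<open>
  The trivial module is \<open>A/A\<^sub>+\<close>.  A bar cochain \<open>\<phi>\<close> becomes a cochain for the left ideal \<open>A\<^sub>+\<close> by
  adding an argument on which it depends through \<open>\<epsilon>\<close>, and it is recovered by setting that argument
  to 1.
\<close>

definition add_arg :: "nat \<Rightarrow> ('a list \<Rightarrow> rat) \<Rightarrow> 'a list \<Rightarrow> rat" where
  "add_arg L \<phi> as = (if as \<in> tuples (Suc L) then eps (as ! L) * \<phi> (butlast as) else 0)"

definition drop_arg :: "('a list \<Rightarrow> rat) \<Rightarrow> 'a list \<Rightarrow> rat" where
  "drop_arg \<psi> as = \<psi> (as @ [\<one>])"

lemma tuples_snoc: "as @ [x] \<in> tuples (Suc L) \<longleftrightarrow> as \<in> tuples L \<and> x \<in> carrier A"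
  by (auto simp: tuples_def)

lemma drop_add_arg:
  assumes "\<phi> \<in> cochains L I S"
  shows "drop_arg (add_arg L \<phi>) = \<phi>"
proof
  fix as show "drop_arg (add_arg L \<phi>) as = \<phi> as"
  proof (cases "as \<in> tuples L")
    case True
    then have "(as @ [\<one>]) ! L = \<one>" by (auto simp: tuples_def nth_append)
    with True show ?thesis by (simp add: drop_arg_def add_arg_def tuples_snoc aug_one)
  next
    case False
    then show ?thesis by (simp add: drop_arg_def add_arg_def tuples_snoc cochainsD(1)[OF assms])
  qed
qed

lemma drop_arg_cochains:
  assumes "\<psi> \<in> cochains (Suc L) I S" "0 < L"
  shows "drop_arg \<psi> \<in> cochains L {} S"
proof (rule cochainsI)
  fix as assume "as \<notin> tuples L"
  then show "drop_arg \<psi> as = 0" by (simp add: drop_arg_def cochainsD(1)[OF assms(1)] tuples_snoc)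
next
  fix as k x y assume as: "as \<in> tuples L" and k: "k < L" and xy: "x \<in> carrier A" "y \<in> carrier A"
  have len: "length as = L" using as by (simp add: tuples_def)
  show "drop_arg \<psi> (as[k := x \<oplus> y]) = drop_arg \<psi> (as[k := x]) + drop_arg \<psi> (as[k := y])"
    using cochainsD(2)[OF assms(1), of "as @ [\<one>]" k x y] as k xy len
    by (simp add: drop_arg_def tuples_snoc list_update_append)
next
  fix as k c x assume as: "as \<in> tuples L" and k: "k < L" and xy: "x \<in> carrier A"
  have len: "length as = L" using as by (simp add: tuples_def)
  show "drop_arg \<psi> (as[k := c \<odot>\<^bsub>A\<^esub> x]) = c * drop_arg \<psi> (as[k := x])"
    using cochainsD(3)[OF assms(1), of "as @ [\<one>]" k x] as k xy len
    by (simp add: drop_arg_def tuples_snoc list_update_append)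
next
  fix as b assume as: "as \<in> tuples L" and b: "b \<in> carrier A"
  have len: "length as = L" using as by (simp add: tuples_def)
  show "drop_arg \<psi> (as[0 := b \<otimes> as ! 0]) = eps b * drop_arg \<psi> as"
    using cochainsD(4)[OF assms(1), of "as @ [\<one>]" b] as b len assms(2)
    by (simp add: drop_arg_def tuples_snoc list_update_append nth_append)
next
  fix as ds assume as: "as \<in> tuples L" and ds: "length ds = L"
    and g: "\<And>k. k < L \<Longrightarrow> as ! k \<in> grade A (ds ! k)" and s: "sum_list ds \<notin> S"
  have len: "length as = L" using as by (simp add: tuples_def)
  have "\<psi> (as @ [\<one>]) = 0"
  proof (rule cochainsD(6)[OF assms(1), of _ "ds @ [0]"])
    show "(as @ [\<one>]) ! k \<in> grade A ((ds @ [0]) ! k)" if "k < Suc L" for k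
      using that g len ds one_grade by (cases "k = L") (simp_all add: nth_append)
  qed (use as ds s in \<open>simp_all add: tuples_snoc\<close>)
  then show "drop_arg \<psi> as = 0" by (simp add: drop_arg_def)
qed simp

lemma add_arg_cochains:
  assumes "\<phi> \<in> cochains L {} S" "0 < L" and I: "\<And>m. m \<in> I \<Longrightarrow> eps m = 0"
  shows "add_arg L \<phi> \<in> cochains (Suc L) I S"
proof -
  have split: "\<exists>bs z. as = bs @ [z] \<and> length bs = L \<and> bs \<in> tuples L \<and> z \<in> carrier A"
    if "as \<in> tuples (Suc L)" for as
  proof -
    have "as \<noteq> []" using that by (auto simp: tuples_def)
    then have "as = butlast as @ [last as]" by simp
    moreover have "butlast as \<in> tuples L" "last as \<in> carrier A"
      using that tuples_snoc[of "butlast as" "last as" L] \<open>as \<noteq> []\<close> by simp_all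
    ultimately show ?thesis using that by (auto simp: tuples_def intro!: exI[of _ "butlast as"])
  qed
  have val: "add_arg L \<phi> (bs @ [z]) = eps z * \<phi> bs" if "bs \<in> tuples L" "z \<in> carrier A" for bs z
  proof -
    have "length bs = L" using that by (simp add: tuples_def)
    then show ?thesis using that by (simp add: add_arg_def tuples_snoc nth_append)
  qed
  show ?thesis
  proof (rule cochainsI)
    fix as k x y assume as: "as \<in> tuples (Suc L)" and k: "k < Suc L"
      and xy: "x \<in> carrier A" "y \<in> carrier A"
    obtain bs z where b: "as = bs @ [z]" "length bs = L" "bs \<in> tuples L" "z \<in> carrier A"
      using split[OF as] by blast
    show "add_arg L \<phi> (as[k := x \<oplus> y]) = add_arg L \<phi> (as[k := x]) + add_arg L \<phi> (as[k := y])"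
    proof (cases "k = L")
      case True
      then show ?thesis using b xy by (simp add: list_update_append val aug_add algebra_simps)
    next
      case False
      then show ?thesis using b xy k
        by (simp add: list_update_append val tuples_update cochainsD(2)[OF assms(1)] algebra_simps)
    qed
  next
    fix as k c x assume as: "as \<in> tuples (Suc L)" and k: "k < Suc L" and xy: "x \<in> carrier A"
    obtain bs z where b: "as = bs @ [z]" "length bs = L" "bs \<in> tuples L" "z \<in> carrier A"
      using split[OF as] by blast
    show "add_arg L \<phi> (as[k := c \<odot>\<^bsub>A\<^esub> x]) = c * add_arg L \<phi> (as[k := x])"
    proof (cases "k = L")
      case True
      then show ?thesis using b xy by (simp add: list_update_append val aug_smult algebra_simps)
    next
      case False
      then show ?thesis using b xy k
        by (simp add: list_update_append val tuples_update cochainsD(3)[OF assms(1)] algebra_simps)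
    qed
  next
    fix as b' assume as: "as \<in> tuples (Suc L)" and b': "b' \<in> carrier A"
    obtain bs z where b: "as = bs @ [z]" "length bs = L" "bs \<in> tuples L" "z \<in> carrier A"
      using split[OF as] by blast
    have "bs[0 := b' \<otimes> bs ! 0] \<in> tuples L" 
      using b b' assms(2) by (intro tuples_update m_closed tuples_nth[of _ L]) auto
    then show "add_arg L \<phi> (as[0 := b' \<otimes> as ! 0]) = eps b' * add_arg L \<phi> as"
      using b b' assms(2) cochainsD(4)[OF assms(1) b(3) b']
      by (simp add: list_update_append val nth_append)
  next
    fix as assume "as \<in> tuples (Suc L)" "as ! (Suc L - 1) \<in> I"
    then show "add_arg L \<phi> as = 0" by (simp add: add_arg_def I)
  next
    fix as ds assume as: "as \<in> tuples (Suc L)" and ds: "length ds = Suc L"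
      and g: "\<And>k. k < Suc L \<Longrightarrow> as ! k \<in> grade A (ds ! k)" and s: "sum_list ds \<notin> S"
    obtain bs z where b: "as = bs @ [z]" "length bs = L" "bs \<in> tuples L" "z \<in> carrier A"
      using split[OF as] by blast
    have "ds \<noteq> []" using ds by auto
    then have "last ds = ds ! L" using ds by (simp add: last_conv_nth)
    then have dsq: "ds = butlast ds @ [ds ! L]"
      using append_butlast_last_id[OF \<open>ds \<noteq> []\<close>] by simp
    have gz: "z \<in> grade A (ds ! L)" using g[of L] b by (simp add: nth_append)
    show "add_arg L \<phi> as = 0"
    proof (cases "ds ! L")
      case 0
      have "\<phi> bs = 0"
      proof (rule cochainsD(6)[OF assms(1) b(3), of "butlast ds"])
        show "bs ! k \<in> grade A (butlast ds ! k)" if "k < L" for k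
          using g[of k] that b ds by (simp add: nth_append nth_butlast)
        show "sum_list (butlast ds) \<notin> S"
          using s 0 by (subst (asm) dsq) simp
      qed (use ds in simp)
      then show ?thesis using b by (simp add: val)
    next
      case (Suc d)
      then show ?thesis using gz b by (simp add: val aug_grade)
    qed
  qed (simp add: add_arg_def)
qed

lemma bar_coboundary_eq:
  assumes "\<phi> \<in> cochains (Suc n) {} S"
  shows "bar_coboundary A n \<phi> = drop_arg (delta (Suc (Suc n)) (add_arg (Suc n) \<phi>))"
proof
  fix as
  show "bar_coboundary A n \<phi> as = drop_arg (delta (Suc (Suc n)) (add_arg (Suc n) \<phi>)) as"
  proof (cases "as \<in> tuples (Suc (Suc n))")
    case True
    have len: "length as = Suc (Suc n)" using True by (simp add: tuples_def)
    let ?bs = "as @ [\<one>]"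
    have bs: "?bs \<in> tuples (Suc (Suc (Suc n)))" using True by (simp add: tuples_snoc)
    have t: "add_arg (Suc n) \<phi> (merge_at (\<otimes>) k ?bs) =
        \<phi> (take k as @ (as ! k \<otimes> as ! Suc k) # drop (Suc (Suc k)) as)" if k: "k < Suc n" for k
    proof -
      have "merge_at (\<otimes>) k ?bs = merge_at (\<otimes>) k as @ [\<one>]"
        using k len by (intro merge_at_append1) simp
      moreover have "merge_at (\<otimes>) k as \<in> tuples (Suc n)" using tuples_merge[OF True k] .
      ultimately show ?thesis
        using drop_add_arg[OF assms, THEN fun_cong, of "merge_at (\<otimes>) k as"]
        by (simp add: drop_arg_def merge_at_def)
    qed
    have l: "add_arg (Suc n) \<phi> (merge_at (\<otimes>) (Suc n) ?bs) = eps (last as) * \<phi> (butlast as)"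
    proof -
      have "merge_at (\<otimes>) (Suc n) ?bs = as[Suc n := as ! Suc n \<otimes> \<one>]"
        by (rule merge_at_append1_last) (simp add: len)
      also have "\<dots> = as" using tuples_nth[OF True, of "Suc n"] by simp
      finally have m: "merge_at (\<otimes>) (Suc n) ?bs = as" .
      have "as \<noteq> []" using len by auto
      then have "last as = as ! Suc n" using len by (simp add: last_conv_nth)
      with m True show ?thesis by (simp add: add_arg_def)
    qed
    have "delta (Suc (Suc n)) (add_arg (Suc n) \<phi>) ?bs =
        (\<Sum>k<Suc n. (-1) ^ k * add_arg (Suc n) \<phi> (merge_at (\<otimes>) k ?bs))
        + (-1) ^ Suc n * add_arg (Suc n) \<phi> (merge_at (\<otimes>) (Suc n) ?bs)"
      using bs by (simp only: delta_def if_True sum.lessThan_Suc[of _ "Suc n"])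
    also have "(\<Sum>k<Suc n. (-1) ^ k * add_arg (Suc n) \<phi> (merge_at (\<otimes>) k ?bs)) =
        (\<Sum>k<Suc n. (-1) ^ k * \<phi> (take k as @ (as ! k \<otimes> as ! Suc k) # drop (Suc (Suc k)) as))"
      by (intro sum.cong refl) (simp only: t lessThan_iff)
    finally show ?thesis using True
      by (simp only: bar_coboundary_def bar_tuples_eq drop_arg_def l if_True)
  next
    case False
    then show ?thesis
      by (simp add: bar_coboundary_def bar_tuples_eq drop_arg_def delta_def tuples_snoc)
  qed
qed

section \<open>Koszul filtrations\<close>

text \<open>\<open>L\<close> is the colon ideal \<open>J : x\<close>.  The map \<open>\<rho>\<close> induces a linear splitting of the inclusion
  \<open>A/L(-1) \<rightarrow> A/J\<close>, \<open>m \<mapsto> m x\<close>, and is what turns exactness into explicit cochains.  It also forces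
  \<open>L\<close> to contain \<open>J : x\<close>, because \<open>m x \<in> J\<close> implies \<open>\<rho> (m x) \<in> L\<close>.\<close>

definition koszul_step :: "'a set \<Rightarrow> 'a set \<Rightarrow> 'a set \<Rightarrow> bool" where
  "koszul_step J I L \<longleftrightarrow> (\<exists>x \<rho>. x \<in> grade A 1 \<and> linear_endo \<rho> \<and>
     J \<subseteq> I \<and> x \<in> I \<and> (\<forall>m\<in>I. \<exists>y\<in>J. \<exists>a\<in>carrier A. m = y \<oplus> a \<otimes> x) \<and> (\<forall>a\<in>L. a \<otimes> x \<in> J) \<and>
     (\<forall>m\<in>grade A 0. \<rho> m = \<zero>) \<and> (\<forall>d. \<forall>m\<in>grade A (Suc d). \<rho> m \<in> grade A d) \<and>
     (\<forall>m\<in>J. \<rho> m \<in> L) \<and> (\<forall>m\<in>carrier A. \<rho> (m \<otimes> x) \<ominus> m \<in> L))"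

definition koszul_filtration :: "'i set \<Rightarrow> ('i \<Rightarrow> nat) \<Rightarrow> ('i \<Rightarrow> 'a set) \<Rightarrow> bool" where
  "koszul_filtration D rk I \<longleftrightarrow> (\<forall>i\<in>D. left_ideal (I i)) \<and>
     (\<forall>i\<in>D. I i \<subseteq> {\<zero>} \<or> (\<exists>j\<in>D. \<exists>l\<in>D. rk j < rk i \<and> koszul_step (I j) (I i) (I l)))"

text \<open>\<open>Hom\<^sub>A(A/I, \<rat>)\<close> lives in degree 0, because a homomorphism is determined by its value at 1.\<close>

lemma cocycle0_zero:
  assumes phi: "\<phi> \<in> cochains 2 I S" and cyc: "delta 2 \<phi> = (\<lambda>as. 0)" and "0 \<notin> S"
  shows "\<phi> = (\<lambda>as. 0)"
proof
  fix as
  show "\<phi> as = 0"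
  proof (cases "as \<in> tuples 2")
    case True
    then obtain a m where as: "as = [a, m]" and am: "a \<in> carrier A" "m \<in> carrier A"
      by (auto simp: tuples_def length_Suc_conv numeral_2_eq_2)
    have "\<phi> [\<one>, \<one>] = 0"
    proof (rule cochainsD(6)[OF phi, of _ "[0, 0]"])
      show "[\<one>, \<one>] ! k \<in> grade A ([0, 0] ! k)" if "k < 2" for k
        using that one_grade by (auto simp: less_2_cases_iff)
    qed (use assms in \<open>simp_all add: tuples_def\<close>)
    then have "\<phi> [a \<otimes> m, \<one>] = 0"
      using cochainsD(4)[OF phi, of "[\<one>, \<one>]" "a \<otimes> m"] am by (simp add: tuples_def)
    moreover have "delta 2 \<phi> [a, m, \<one>] = \<phi> [a \<otimes> m, \<one>] - \<phi> [a, m]"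
      using am by (simp add: delta_def tuples_def numeral_2_eq_2 merge_at_def)
    ultimately show ?thesis using cyc as by simp
  qed (use cochainsD(1)[OF phi] in simp)
qed

text \<open>The contracting homotopy of the bar resolution of the free module \<open>A\<close>: insert 1 at the end.\<close>

lemma free_module_exact:
  assumes phi: "\<phi> \<in> cochains (Suc (Suc (Suc n))) I S" and cyc: "delta (Suc (Suc (Suc n))) \<phi> = (\<lambda>as. 0)"
    and I: "I \<subseteq> {\<zero>}"
  shows "\<exists>\<psi>\<in>cochains (Suc (Suc n)) I S. \<phi> = delta (Suc (Suc n)) \<psi>"
proof -
  let ?L = "Suc (Suc n)"
  have h: "drop_arg \<phi> \<in> cochains ?L I S"
    using cochains_mono[OF cochains_zero_ideal[OF drop_arg_cochains[OF phi]] I] by simp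
  have "(\<lambda>as. (-1) ^ Suc n * drop_arg \<phi> as) \<in> cochains ?L I S" by (rule cochains_scale[OF h])
  moreover have "\<phi> = delta ?L (\<lambda>as. (-1) ^ Suc n * drop_arg \<phi> as)"
  proof
    fix as
    show "\<phi> as = delta ?L (\<lambda>as. (-1) ^ Suc n * drop_arg \<phi> as) as"
    proof (cases "as \<in> tuples (Suc ?L)")
      case True
      have len: "length as = Suc ?L" using True by (simp add: tuples_def)
      let ?bs = "as @ [\<one>]"
      have bs: "?bs \<in> tuples (Suc (Suc ?L))" using True by (simp add: tuples_snoc)
      have "merge_at (\<otimes>) ?L ?bs = as[?L := as ! ?L \<otimes> \<one>]"
        by (rule merge_at_append1_last) (simp add: len)
      also have "\<dots> = as" using tuples_nth[OF True, of ?L] by simp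
      finally have l: "merge_at (\<otimes>) ?L ?bs = as" .
      have "0 = delta (Suc ?L) \<phi> ?bs" using cyc by simp
      also have "\<dots> = (\<Sum>k<?L. (-1) ^ k * \<phi> (merge_at (\<otimes>) k ?bs)) + (-1) ^ ?L * \<phi> as"
        using bs l by (simp only: delta_def if_True sum.lessThan_Suc[of _ ?L])
      also have "(\<Sum>k<?L. (-1) ^ k * \<phi> (merge_at (\<otimes>) k ?bs)) = delta ?L (drop_arg \<phi>) as"
        using True len by (simp only: delta_def if_True drop_arg_def)
          (intro sum.cong refl, simp add: merge_at_append1)
      finally have "delta ?L (drop_arg \<phi>) as = - ((-1) ^ ?L * \<phi> as)" by simp
      then show ?thesis unfolding delta_scale by (simp flip: power_add mult.assoc)
    next
      case False
      then show ?thesis using cochainsD(1)[OF phi] by (simp add: delta_def)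
    qed
  qed
  ultimately show ?thesis by blast
qed

text \<open>
  The connecting step: it is the diagram chase in the long exact sequence of
  \<open>0 \<rightarrow> A/L(-1) \<rightarrow> A/J \<rightarrow> A/I \<rightarrow> 0\<close>.  A cocycle of \<open>A/I\<close> is a coboundary \<open>d\<psi>\<close> over \<open>A/J\<close>;
  the obstruction to correcting \<open>\<psi>\<close> is its restriction to \<open>A/L(-1)\<close>, and \<open>\<rho>\<close> extends a bounding
  cochain of that restriction.
\<close>

lemma koszul_step_exact:
  assumes step: "koszul_step J I L" and li: "left_ideal J" "left_ideal L" "left_ideal I"
    and psi: "\<psi> \<in> cochains (Suc (Suc n)) J S"
    and cyc: "delta (Suc (Suc n)) \<psi> \<in> cochains (Suc (Suc (Suc n))) I S"
    and nS: "Suc n \<notin> S"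
    and exact: "\<And>S' \<phi>. \<lbrakk>n \<notin> S'; \<phi> \<in> cochains (Suc (Suc n)) L S'; delta (Suc (Suc n)) \<phi> = (\<lambda>as. 0)\<rbrakk> \<Longrightarrow>
        (if n = 0 then \<phi> = (\<lambda>as. 0) else \<exists>\<theta>\<in>cochains (Suc n) L S'. \<phi> = delta (Suc n) \<theta>)"
  shows "\<exists>\<psi>'\<in>cochains (Suc (Suc n)) I S. delta (Suc (Suc n)) \<psi> = delta (Suc (Suc n)) \<psi>'"
proof -
  obtain x \<rho> where st: "x \<in> grade A 1 \<and> linear_endo \<rho> \<and>
     J \<subseteq> I \<and> x \<in> I \<and> (\<forall>m\<in>I. \<exists>y\<in>J. \<exists>a\<in>carrier A. m = y \<oplus> a \<otimes> x) \<and> (\<forall>a\<in>L. a \<otimes> x \<in> J) \<and>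
     (\<forall>m\<in>grade A 0. \<rho> m = \<zero>) \<and> (\<forall>d. \<forall>m\<in>grade A (Suc d). \<rho> m \<in> grade A d) \<and>
     (\<forall>m\<in>J. \<rho> m \<in> L) \<and> (\<forall>m\<in>carrier A. \<rho> (m \<otimes> x) \<ominus> m \<in> L)"
    using step unfolding koszul_step_def by (elim exE)
  then have x: "x \<in> grade A 1" and rho: "linear_endo \<rho>" and JI: "J \<subseteq> I" and xI: "x \<in> I"
    and dec: "\<And>m. m \<in> I \<Longrightarrow> \<exists>y\<in>J. \<exists>a\<in>carrier A. m = y \<oplus> a \<otimes> x"
    and Lx: "\<And>a. a \<in> L \<Longrightarrow> a \<otimes> x \<in> J"
    and rho0: "\<And>m. m \<in> grade A 0 \<Longrightarrow> \<rho> m = \<zero>"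
    and rhoS: "\<And>m d. m \<in> grade A (Suc d) \<Longrightarrow> \<rho> m \<in> grade A d"
    and rhoJ: "\<And>m. m \<in> J \<Longrightarrow> \<rho> m \<in> L"
    and rhox: "\<And>m. m \<in> carrier A \<Longrightarrow> \<rho> (m \<otimes> x) \<ominus> m \<in> L"
    by blast+
  have xc: "x \<in> carrier A" using grade_carrier[OF x] .
  have Jc: "J \<subseteq> carrier A" and Lc: "L \<subseteq> carrier A" using li by (simp_all add: left_ideal_def)
  have xl: "a \<otimes> x \<in> I" if "a \<in> carrier A" for a using that xI li(3) by (simp add: left_ideal_def)
  let ?m = "\<lambda>m. m \<otimes> x" and ?L = "Suc (Suc n)"
  let ?S' = "{d. Suc d \<in> S}"
  let ?p = "pull_last ?L ?m \<psi>"
  have p: "?p \<in> cochains ?L L ?S'"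
  proof (rule pull_last_cochains[OF psi linear_endo_rmult[OF xc]])
    fix m d assume "m \<in> grade A d"
    then have "m \<otimes> x \<in> grade A (d + 1)" using x by (intro grade_mult)
    then show "m \<otimes> x = \<zero> \<or> (\<exists>d'. m \<otimes> x \<in> grade A d' \<and> (\<forall>s. s + d' \<in> S \<longrightarrow> s + d \<in> ?S'))"
      by (intro disjI2 exI[of _ "d + 1"]) simp
  qed (use Lx in simp_all)
  have "delta ?L ?p = pull_last (Suc ?L) ?m (delta ?L \<psi>)" by (rule delta_pull_last[OF xc]) simp
  also have "\<dots> = (\<lambda>as. 0)"
  proof
    fix as show "pull_last (Suc ?L) ?m (delta ?L \<psi>) as = 0"
    proof (cases "as \<in> tuples (Suc ?L)")
      case True
      have m: "as ! ?L \<in> carrier A" using True by (simp add: tuples_nth)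
      have len: "length as = Suc ?L" using True by (simp add: tuples_def)
      have "delta ?L \<psi> (as[?L := as ! ?L \<otimes> x]) = 0"
      proof (rule cochainsD(5)[OF cyc])
        show "as[?L := as ! ?L \<otimes> x] \<in> tuples (Suc ?L)" using True m xc by (simp add: tuples_update)
        show "as[?L := as ! ?L \<otimes> x] ! (Suc ?L - 1) \<in> I" using len xl[OF m] by simp
      qed
      then show ?thesis by (simp add: pull_last_def)
    qed (simp add: pull_last_def)
  qed
  finally have pc: "delta ?L ?p = (\<lambda>as. 0)" .
  \<comment> \<open>a cochain over \<open>A/J\<close> that restricts to 0 on \<open>A/L(-1)\<close> comes from \<open>A/I\<close>\<close>
  have extend: "\<omega> \<in> cochains ?L I S"
    if chi: "\<omega> \<in> cochains ?L J S" and pull: "pull_last ?L ?m \<omega> = (\<lambda>as. 0)" for \<omega>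
  proof -
    have "\<omega> as = 0" if as: "as \<in> tuples ?L" and mI: "as ! (?L - 1) \<in> I" for as
    proof -
      have len: "length as = ?L" using as by (simp add: tuples_def)
      obtain y a where ya: "y \<in> J" "a \<in> carrier A" "as ! Suc n = y \<oplus> a \<otimes> x"
        using dec[OF mI] by auto
      have yc: "y \<in> carrier A" using ya Jc by blast
      have "\<omega> as = \<omega> (as[Suc n := y \<oplus> a \<otimes> x])" using ya(3) list_update_id[of as "Suc n"] by simp
      also have "\<dots> = \<omega> (as[Suc n := y]) + \<omega> (as[Suc n := a \<otimes> x])"
        using cochainsD(2)[OF chi as, of "Suc n" y "a \<otimes> x"] yc ya(2) xc by simp
      also have "\<omega> (as[Suc n := y]) = 0"
        using as yc ya(1) len by (intro cochainsD(5)[OF chi]) (simp_all add: tuples_update)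
      also have "\<omega> (as[Suc n := a \<otimes> x]) = pull_last ?L ?m \<omega> (as[Suc n := a])"
        using as ya(2) len by (simp add: pull_last_def tuples_update)
      finally show ?thesis using pull by simp
    qed
    then show ?thesis using chi unfolding cochains_def by auto
  qed
  have "n \<notin> ?S'" using nS by simp
  from exact[OF this p pc] show ?thesis
  proof (cases "n = 0")
    case True
    with exact[OF \<open>n \<notin> ?S'\<close> p pc] have "?p = (\<lambda>as. 0)" by simp
    from extend[OF psi this] show ?thesis by blast
  next
    case False
    with exact[OF \<open>n \<notin> ?S'\<close> p pc] obtain \<theta> where th: "\<theta> \<in> cochains (Suc n) L ?S'"
      and pth: "?p = delta (Suc n) \<theta>" by auto
    \<comment> \<open>the bounding cochain of the obstruction, extended from \<open>A/L(-1)\<close> to \<open>A/J\<close> by \<open>\<rho>\<close>\<close>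
    let ?t = "pull_last (Suc n) \<rho> \<theta>"
    have t: "?t \<in> cochains (Suc n) J S"
    proof (rule pull_last_cochains[OF th rho])
      fix m d assume m: "m \<in> grade A d"
      show "\<rho> m = \<zero> \<or> (\<exists>d'. \<rho> m \<in> grade A d' \<and> (\<forall>s. s + d' \<in> ?S' \<longrightarrow> s + d \<in> S))"
        using m rho0 rhoS by (cases d) auto
    qed (use rhoJ False in simp_all)
    have pt: "pull_last (Suc n) ?m ?t = \<theta>"
    proof
      fix as show "pull_last (Suc n) ?m ?t as = \<theta> as"
      proof (cases "as \<in> tuples (Suc n)")
        case True
        let ?a = "as ! n"
        have len: "length as = Suc n" using True by (simp add: tuples_def)
        have a: "?a \<in> carrier A" using True by (simp add: tuples_nth)
        have r: "\<rho> (?a \<otimes> x) \<in> carrier A" using rho a xc by (simp add: linear_endo_def)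
        let ?d = "\<rho> (?a \<otimes> x) \<ominus> ?a"
        have d: "?d \<in> L" "?d \<in> carrier A" using rhox[OF a] Lc by auto
        have "\<rho> (?a \<otimes> x) = ?d \<oplus> ?a" using a r by algebra
        then have "pull_last (Suc n) ?m ?t as = \<theta> (as[n := ?d \<oplus> ?a])"
          using True a xc len by (simp add: pull_last_def tuples_update)
        also have "\<dots> = \<theta> (as[n := ?d]) + \<theta> (as[n := ?a])"
          using cochainsD(2)[OF th True, of n ?d ?a] d a by simp
        also have "\<theta> (as[n := ?d]) = 0"
          using True d len by (intro cochainsD(5)[OF th]) (simp_all add: tuples_update)
        finally show ?thesis by simp
      next
        case False
        then show ?thesis using cochainsD(1)[OF th] by (simp add: pull_last_def)
      qed
    qed
    let ?c = "\<lambda>as. \<psi> as - delta (Suc n) ?t as"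
    have "?c \<in> cochains ?L J S"
      using False by (intro cochains_diff psi delta_cochains[OF t li(1)]) simp
    moreover have "pull_last ?L ?m ?c = (\<lambda>as. 0)"
    proof
      fix as
      have "pull_last ?L ?m ?c as = ?p as - pull_last ?L ?m (delta (Suc n) ?t) as"
        by (simp add: pull_last_def)
      also have "pull_last ?L ?m (delta (Suc n) ?t) = delta (Suc n) (pull_last (Suc n) ?m ?t)"
        using delta_pull_last[OF xc, of "Suc n"] False by simp
      finally show "pull_last ?L ?m ?c as = 0" by (simp add: pt pth)
    qed
    ultimately have "?c \<in> cochains ?L I S" by (rule extend)
    moreover have "delta ?L ?c = delta ?L \<psi>" by (simp add: delta_diff delta_delta)
    ultimately show ?thesis by (intro bexI[of _ ?c]) simp_all
  qed
qed

text \<open>The outer induction is on the cohomological degree, which drops on passing to \<open>L\<close>, and the inner one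
  on the rank, which drops on passing to \<open>J\<close>; so \<open>L\<close> may be any member of the family.\<close>

lemma cocycle_exact:
  assumes filt: "koszul_filtration D rk I"
  shows "\<lbrakk>i \<in> D; n \<notin> S; \<phi> \<in> cochains (Suc (Suc n)) (I i) S; delta (Suc (Suc n)) \<phi> = (\<lambda>as. 0)\<rbrakk> \<Longrightarrow>
    (if n = 0 then \<phi> = (\<lambda>as. 0) else \<exists>\<psi>\<in>cochains (Suc n) (I i) S. \<phi> = delta (Suc n) \<psi>)"
proof (induction n arbitrary: i S \<phi>)
  case 0
  then show ?case using cocycle0_zero[of \<phi> "I i" S] by (simp add: numeral_2_eq_2)
next
  case (Suc n)
  note outer = Suc.IH
  from Suc.prems show ?case
  proof (induction "rk i" arbitrary: i \<phi> rule: less_induct)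
    case less
    have li: "left_ideal (I k)" if "k \<in> D" for k
      using filt that by (simp add: koszul_filtration_def)
    show ?case
    proof (cases "I i \<subseteq> {\<zero>}")
      case True
      then show ?thesis using free_module_exact[OF less.prems(3,4)] by simp
    next
      case False
      then obtain j l where j: "j \<in> D" and l: "l \<in> D" and jl: "rk j < rk i"
        and step: "koszul_step (I j) (I i) (I l)"
        using filt less.prems(1) unfolding koszul_filtration_def by blast
      have "I j \<subseteq> I i" using step by (auto simp: koszul_step_def)
      then have "\<phi> \<in> cochains (Suc (Suc (Suc n))) (I j) S" by (rule cochains_mono[OF less.prems(3)])
      from less.hyps[OF jl j less.prems(2) this less.prems(4)]
      obtain \<psi> where psi: "\<psi> \<in> cochains (Suc (Suc n)) (I j) S" "\<phi> = delta (Suc (Suc n)) \<psi>" by auto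
      have "\<exists>\<psi>'\<in>cochains (Suc (Suc n)) (I i) S. delta (Suc (Suc n)) \<psi> = delta (Suc (Suc n)) \<psi>'"
        using less.prems(3) psi(2) less.prems(2)
        by (intro koszul_step_exact[OF step li[OF j] li[OF l] li[OF less.prems(1)] psi(1)] outer[OF l])
          simp_all
      then show ?thesis using psi(2) by auto
    qed
  qed
qed

lemma bar_cochain_group: "group (bar_cochain_group A n j)"
proof (rule groupI)
  fix \<phi> assume "\<phi> \<in> carrier (bar_cochain_group A n j)"
  then show "\<exists>\<psi>\<in>carrier (bar_cochain_group A n j). \<psi> \<otimes>\<^bsub>bar_cochain_group A n j\<^esub> \<phi> = \<one>\<^bsub>bar_cochain_group A n j\<^esub>"
    using cochains_scale[of \<phi> "Suc n" "{}" "{j}" "-1"]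
    by (intro bexI[of _ "\<lambda>as. -1 * \<phi> as"]) (simp_all add: bar_cochain_group_def bar_cochains_eq)
qed (auto simp: bar_cochain_group_def bar_cochains_eq cochains_zero cochains_add add.assoc)

lemma trivial_quotient_group:
  assumes "group G" shows "trivial_group (G Mod carrier G)"
proof -
  interpret group G by fact
  have n: "carrier G \<lhd> G" by (simp add: normal_self)
  have "carrier (G Mod carrier G) = {carrier G}"
    unfolding FactGroup_def RCOSETS_def using coset_join2[OF _ subgroup_self] by auto
  then show ?thesis
    using normal.factorgroup_is_group[OF n] by (simp add: trivial_group_def FactGroup_def)
qed

text \<open>A cocycle of the bar complex of the trivial module becomes a cocycle for the ideal \<open>A\<^sub>+\<close> by adding an
  argument; it bounds there, and dropping the argument again gives the bounding bar cochain.\<close>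

theorem Koszul_if_filtration:
  assumes filt: "koszul_filtration D rk I" and i: "i \<in> D"
    and Ii: "I i = {x \<in> carrier A. eps x = 0}"
  shows "Koszul A"
  unfolding Koszul_def
proof (intro conjI allI impI)
  fix n j :: nat assume "j \<noteq> n"
  let ?G = "bar_cochain_group A n j"
  let ?Z = "kernel ?G (bar_cochain_group A (Suc n) j) (bar_coboundary A n)"
  let ?H = "?G\<lparr>carrier := ?Z\<rparr>"
  have Z: "\<phi> \<in> ?Z \<longleftrightarrow> \<phi> \<in> cochains (Suc n) {} {j} \<and> bar_coboundary A n \<phi> = (\<lambda>as. 0)" for \<phi>
    by (auto simp: kernel_def bar_cochain_group_def bar_cochains_eq)
  have li: "left_ideal (I i)" using filt i by (simp add: koszul_filtration_def)
  have add_arg: "add_arg L \<phi> \<in> cochains (Suc L) (I i) S" if "\<phi> \<in> cochains L {} S" "0 < L" for L \<phi> S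
    using that by (intro add_arg_cochains) (simp_all add: Ii)
  \<comment> \<open>a cochain that vanishes on \<open>A\<^sub>+\<close> depends on its last argument only through \<open>\<epsilon>\<close>\<close>
  have drop_inj: "\<psi> = add_arg L (drop_arg \<psi>)" if psi: "\<psi> \<in> cochains (Suc L) (I i) S" for \<psi> L S
  proof
    fix as show "\<psi> as = add_arg L (drop_arg \<psi>) as"
    proof (cases "as \<in> tuples (Suc L)")
      case True
      have len: "length as = Suc L" using True by (simp add: tuples_def)
      let ?z = "as ! L"
      have z: "?z \<in> carrier A" using True by (simp add: tuples_nth)
      have "as \<noteq> []" using len by auto
      then have as: "as = butlast as @ [?z]" using len append_butlast_last_id[of as]
        by (simp add: last_conv_nth)
      then have up: "as[L := w] = butlast as @ [w]" for w
        using len by (metis length_butlast diff_Suc_1 list_update_length)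
      let ?e = "eps ?z \<odot>\<^bsub>A\<^esub> \<one>"
      let ?d = "?z \<ominus> ?e"
      have e: "?e \<in> carrier A" by simp
      have de: "?d \<oplus> ?e = ?z" using z e by algebra
      have "eps (?d \<oplus> ?e) = eps ?d + eps ?z" using z e by (simp add: aug_add aug_smult aug_one)
      then have "?d \<in> I i" using z e unfolding de by (simp add: Ii)
      have "as = as[L := ?d \<oplus> ?e]"
        unfolding de by simp
      then have "\<psi> as = \<psi> (as[L := ?d]) + \<psi> (as[L := ?e])"
        using cochainsD(2)[OF psi True, of L ?d ?e] z e by simp
      also have "\<psi> (as[L := ?d]) = 0"
        using True \<open>?d \<in> I i\<close> z e len by (intro cochainsD(5)[OF psi]) (simp_all add: tuples_update)
      also have "\<psi> (as[L := ?e]) = eps ?z * \<psi> (as[L := \<one>])"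
        using cochainsD(3)[OF psi True, of L] by simp
      finally show ?thesis using True up by (simp add: add_arg_def drop_arg_def)
    next
      case False
      then show ?thesis using cochainsD(1)[OF psi] by (simp add: add_arg_def)
    qed
  qed
  have cob_zero: "bar_coboundary A m (bar_coboundary A m' \<phi>) = (\<lambda>as. 0)"
    if m: "m = Suc m'" and phi: "\<phi> \<in> cochains (Suc m') {} S" for m m' \<phi> S
  proof -
    have 1: "delta (Suc m) (add_arg m \<phi>) \<in> cochains (Suc (Suc m)) (I i) S"
      using add_arg[of \<phi> m S] phi m li by (intro delta_cochains) simp_all
    have 2: "bar_coboundary A m' \<phi> = drop_arg (delta (Suc m) (add_arg m \<phi>))"
      using bar_coboundary_eq[OF phi] m by simp
    have "bar_coboundary A m' \<phi> \<in> cochains (Suc m) {} S"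
      unfolding 2 by (rule drop_arg_cochains[OF 1]) simp
    from bar_coboundary_eq[OF this]
    have "bar_coboundary A m (bar_coboundary A m' \<phi>) =
        drop_arg (delta (Suc (Suc m)) (add_arg (Suc m) (drop_arg (delta (Suc m) (add_arg m \<phi>)))))"
      unfolding 2 .
    also have "\<dots> = drop_arg (\<lambda>as. 0)" unfolding drop_inj[OF 1, symmetric] delta_delta ..
    finally show ?thesis by (simp add: drop_arg_def[abs_def])
  qed
  have cob_add: "bar_coboundary A n (\<lambda>as. \<phi> as + \<psi> as) =
      (\<lambda>as. bar_coboundary A n \<phi> as + bar_coboundary A n \<psi> as)" for \<phi> \<psi>
    by (rule ext) (simp add: bar_coboundary_def distrib_left sum.distrib del: sum.lessThan_Suc)
  have cob_scale: "bar_coboundary A n (\<lambda>as. c * \<phi> as) = (\<lambda>as. c * bar_coboundary A n \<phi> as)" for \<phi> c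
    by (rule ext) (simp add: bar_coboundary_def right_diff_distrib sum_distrib_left mult.left_commute
        del: sum.lessThan_Suc)
  have sub: "subgroup ?Z ?G"
  proof (rule group.subgroupI[OF bar_cochain_group])
    show "?Z \<subseteq> carrier ?G" by (auto simp: kernel_def)
    have "(\<lambda>as. 0) \<in> ?Z" unfolding Z by (simp add: cochains_zero bar_coboundary_def fun_eq_iff)
    then show "?Z \<noteq> {}" by blast
  next
    fix \<phi> \<psi> assume "\<phi> \<in> ?Z" "\<psi> \<in> ?Z"
    then show "\<phi> \<otimes>\<^bsub>?G\<^esub> \<psi> \<in> ?Z"
      unfolding Z by (auto simp: bar_cochain_group_def cochains_add cob_add)
  next
    fix \<phi> assume phi: "\<phi> \<in> ?Z"
    let ?n = "\<lambda>as. -1 * \<phi> as"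
    have n: "?n \<in> cochains (Suc n) {} {j}" using phi by (intro cochains_scale) (simp add: Z)
    have "inv\<^bsub>?G\<^esub> \<phi> = ?n"
      using n phi unfolding Z
      by (intro group.inv_equality[OF bar_cochain_group]) (auto simp: bar_cochain_group_def bar_cochains_eq)
    moreover have "bar_coboundary A n ?n = (\<lambda>as. 0)"
      using phi unfolding Z cob_scale by simp
    ultimately show "inv\<^bsub>?G\<^esub> \<phi> \<in> ?Z" using n by (simp add: Z)
  qed
  have lift: "add_arg (Suc n) \<phi> \<in> cochains (Suc (Suc n)) (I i) {j} \<and>
      delta (Suc (Suc n)) (add_arg (Suc n) \<phi>) = (\<lambda>as. 0)" if "\<phi> \<in> ?Z" for \<phi>
  proof
    have phi: "\<phi> \<in> cochains (Suc n) {} {j}" "bar_coboundary A n \<phi> = (\<lambda>as. 0)"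
      using that by (simp_all add: Z)
    show 1: "add_arg (Suc n) \<phi> \<in> cochains (Suc (Suc n)) (I i) {j}"
      using phi(1) by (intro add_arg) simp_all
    have "delta (Suc (Suc n)) (add_arg (Suc n) \<phi>) \<in> cochains (Suc (Suc (Suc n))) (I i) {j}"
      by (rule delta_cochains[OF 1 li]) simp
    from drop_inj[OF this] have "delta (Suc (Suc n)) (add_arg (Suc n) \<phi>) = add_arg (Suc (Suc n)) (\<lambda>as. 0)"
      using bar_coboundary_eq[OF phi(1)] phi(2) by simp
    then show "delta (Suc (Suc n)) (add_arg (Suc n) \<phi>) = (\<lambda>as. 0)"
      by (simp add: add_arg_def[abs_def] fun_eq_iff)
  qed
  have exact: "if n = 0 then add_arg (Suc n) \<phi> = (\<lambda>as. 0)
      else \<exists>\<psi>\<in>cochains (Suc n) (I i) {j}. add_arg (Suc n) \<phi> = delta (Suc n) \<psi>" if "\<phi> \<in> ?Z" for \<phi>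
    by (rule cocycle_exact[OF filt i, of n "{j}"]) (use lift[OF that] \<open>j \<noteq> n\<close> in auto)
  have "bar_coboundaries A n j = ?Z"
  proof (cases n)
    case 0
    have "\<phi> = (\<lambda>as. 0)" if "\<phi> \<in> ?Z" for \<phi>
    proof -
      have "add_arg (Suc n) \<phi> = (\<lambda>as. 0)"
        using exact[OF that] unfolding if_P[OF 0] .
      moreover have "drop_arg (add_arg (Suc n) \<phi>) = \<phi>"
        using that unfolding Z by (blast intro: drop_add_arg)
      ultimately show ?thesis by (simp add: drop_arg_def fun_eq_iff)
    qed
    moreover have "(\<lambda>as. 0) \<in> ?Z" using subgroup.one_closed[OF sub] by (simp add: bar_cochain_group_def)
    ultimately have "{\<lambda>as. 0} = ?Z" by blast
    moreover have "bar_coboundaries A n j = {\<lambda>as. 0}"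
      by (simp only: 0 bar_coboundaries_def nat.case)
    ultimately show ?thesis by simp
  next
    case (Suc m)
    then have n0: "n \<noteq> 0" by simp
    have "\<phi> \<in> bar_coboundary A m ` bar_cochains A m j" if phiZ: "\<phi> \<in> ?Z" for \<phi>
    proof -
      have phi: "\<phi> \<in> cochains (Suc n) {} {j}" using phiZ by (simp add: Z)
      obtain \<psi> where psi: "\<psi> \<in> cochains (Suc n) (I i) {j}" "add_arg (Suc n) \<phi> = delta (Suc n) \<psi>"
        using exact[OF phiZ] unfolding if_not_P[OF n0] by blast
      have d: "drop_arg \<psi> \<in> cochains (Suc m) {} {j}"
        using psi(1) unfolding Suc by (intro drop_arg_cochains) simp_all
      have e: "add_arg (Suc m) (drop_arg \<psi>) = \<psi>"
        using psi(1) unfolding Suc by (rule drop_inj[symmetric])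
      have "\<phi> = drop_arg (delta (Suc n) \<psi>)" unfolding psi(2)[symmetric] drop_add_arg[OF phi] ..
      also have "\<dots> = bar_coboundary A m (drop_arg \<psi>)" unfolding bar_coboundary_eq[OF d] e Suc ..
      finally have "\<phi> = bar_coboundary A m (drop_arg \<psi>)" .
      moreover have "drop_arg \<psi> \<in> bar_cochains A m j" using d unfolding bar_cochains_eq .
      ultimately show ?thesis by (rule image_eqI)
    qed
    moreover have "bar_coboundary A m \<omega> \<in> ?Z" if "\<omega> \<in> bar_cochains A m j" for \<omega>
    proof -
      have chi: "\<omega> \<in> cochains (Suc m) {} {j}" using that by (simp add: bar_cochains_eq)
      have "delta (Suc (Suc m)) (add_arg (Suc m) \<omega>) \<in> cochains (Suc (Suc (Suc m))) (I i) {j}"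
        using chi by (intro delta_cochains add_arg li) simp_all
      then have "bar_coboundary A m \<omega> \<in> cochains (Suc n) {} {j}"
        unfolding bar_coboundary_eq[OF chi] Suc by (rule drop_arg_cochains) simp
      then show ?thesis using cob_zero[OF Suc chi] by (simp add: Z)
    qed
    ultimately have "bar_coboundary A m ` bar_cochains A m j = ?Z" by blast
    moreover have "bar_coboundaries A n j = bar_coboundary A m ` bar_cochains A m j"
      by (simp only: Suc bar_coboundaries_def nat.case)
    ultimately show ?thesis by simp
  qed
  moreover have "group ?H" by (rule subgroup.subgroup_is_group[OF sub bar_cochain_group])
  ultimately show "trivial_group (Ext_group A n j)"
    using trivial_quotient_group[of ?H] by (simp add: Ext_group_def)
qed (rule connected_graded)

end

section \<open>Quotients of the free algebra\<close>

abbreviation tensors :: "'x set \<Rightarrow> ('x list \<Rightarrow>\<^sub>0 rat) set" where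
  "tensors B \<equiv> {p. Poly_Mapping.keys p \<subseteq> lists B}"

abbreviation word :: "'x list \<Rightarrow> ('x list \<Rightarrow>\<^sub>0 rat)" where
  "word w \<equiv> Poly_Mapping.single w 1"

definition scale :: "rat \<Rightarrow> ('x list \<Rightarrow>\<^sub>0 rat) \<Rightarrow> ('x list \<Rightarrow>\<^sub>0 rat)" where
  "scale c p = Poly_Mapping.single 0 c * p"

lemma single_mult_single: "Poly_Mapping.single u c * Poly_Mapping.single v (d::rat) = Poly_Mapping.single (u @ v) (c * d)"
  by (simp add: mult_single plus_list_def)

lemma scale_single [simp]: "scale c (Poly_Mapping.single w d) = Poly_Mapping.single w (c * d)"
  by (simp add: scale_def mult_single)

lemma scale_add: "scale c (p + q) = scale c p + scale c q"
  by (simp add: scale_def distrib_left)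

lemma scale_zero [simp]: "scale c 0 = 0"
  by (simp add: scale_def)

lemma lookup_scale [simp]: "Poly_Mapping.lookup (scale c p) w = c * Poly_Mapping.lookup p w"
  unfolding scale_def mult_map_scale_conv_mult[symmetric]
  by (simp add: Poly_Mapping.map.rep_eq when_def)

lemma scale_mult_left: "scale c p * q = scale c (p * q)"
  by (simp add: scale_def mult.assoc)

lemma sum_singles:
  fixes p :: "'k \<Rightarrow>\<^sub>0 rat"
  assumes "finite W" "Poly_Mapping.keys p \<subseteq> W"
  shows "(\<Sum>w\<in>W. Poly_Mapping.single w (Poly_Mapping.lookup p w)) = p"
proof (rule poly_mapping_eqI)
  fix k
  have "Poly_Mapping.lookup (\<Sum>w\<in>W. Poly_Mapping.single w (Poly_Mapping.lookup p w)) k =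
      (\<Sum>w\<in>W. if w = k then Poly_Mapping.lookup p k else 0)"
    by (simp add: lookup_sum lookup_single when_def cong: if_cong sum.cong)
  also have "\<dots> = Poly_Mapping.lookup p k"
    using assms by (auto simp: in_keys_iff)
  finally show "Poly_Mapping.lookup (\<Sum>w\<in>W. Poly_Mapping.single w (Poly_Mapping.lookup p w)) k = Poly_Mapping.lookup p k" .
qed

lemma poly_span_induct [consumes 1, case_names zero single add]:
  fixes p :: "'k \<Rightarrow>\<^sub>0 rat"
  assumes "Poly_Mapping.keys p \<subseteq> W" "P 0"
    and "\<And>w c. w \<in> W \<Longrightarrow> P (Poly_Mapping.single w c)"
    and "\<And>p q. P p \<Longrightarrow> P q \<Longrightarrow> P (p + q)"
  shows "P p"
proof -
  have "P (\<Sum>w\<in>F. Poly_Mapping.single w (Poly_Mapping.lookup p w))" if "finite F" "F \<subseteq> W" for F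
    using that by (induction F rule: finite_induct) (auto intro: assms)
  from this[of "Poly_Mapping.keys p"] show ?thesis using assms(1) sum_singles[of "Poly_Mapping.keys p" p] by simp
qed

lemma scale_mult_right: "p * scale c q = scale c (p * q)"
proof -
  have "Poly_Mapping.keys p \<subseteq> UNIV" by simp
  then have "p * Poly_Mapping.single 0 c = Poly_Mapping.single 0 c * p"
    by (induction p rule: poly_span_induct) (simp_all add: mult_single distrib_left distrib_right mult.commute)
  then show ?thesis by (simp add: scale_def flip: mult.assoc)
qed

lemma keys_add_subset:
  fixes p q :: "'k \<Rightarrow>\<^sub>0 rat"
  shows "Poly_Mapping.keys p \<subseteq> W \<Longrightarrow> Poly_Mapping.keys q \<subseteq> W \<Longrightarrow> Poly_Mapping.keys (p + q) \<subseteq> W"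
  using keys_add[of p q] by blast

lemma keys_uminus_subset:
  fixes p :: "'k \<Rightarrow>\<^sub>0 rat"
  shows "Poly_Mapping.keys p \<subseteq> W \<Longrightarrow> Poly_Mapping.keys (- p) \<subseteq> W"
  by (auto simp: in_keys_iff)

lemma keys_diff_subset:
  fixes p q :: "'k \<Rightarrow>\<^sub>0 rat"
  shows "Poly_Mapping.keys p \<subseteq> W \<Longrightarrow> Poly_Mapping.keys q \<subseteq> W \<Longrightarrow> Poly_Mapping.keys (p - q) \<subseteq> W"
  using keys_add_subset[of p W "- q"] keys_uminus_subset[of q W] by simp

lemma keys_scale_subset: "Poly_Mapping.keys p \<subseteq> W \<Longrightarrow> Poly_Mapping.keys (scale c p) \<subseteq> W"
  by (auto simp: in_keys_iff)

lemma keys_sum_subset: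
  fixes p :: "'i \<Rightarrow> 'k \<Rightarrow>\<^sub>0 rat"
  shows "(\<And>i. i \<in> F \<Longrightarrow> Poly_Mapping.keys (p i) \<subseteq> W) \<Longrightarrow> Poly_Mapping.keys (sum p F) \<subseteq> W"
  by (induction F rule: infinite_finite_induct) (simp_all add: keys_add_subset)

lemma keys_mult_subset:
  fixes p q :: "'x list \<Rightarrow>\<^sub>0 rat"
  assumes "Poly_Mapping.keys p \<subseteq> U" "Poly_Mapping.keys q \<subseteq> W"
    and "\<And>u w. u \<in> U \<Longrightarrow> w \<in> W \<Longrightarrow> u @ w \<in> Z"
  shows "Poly_Mapping.keys (p * q) \<subseteq> Z"
  using keys_mult[of p q] assms by (fastforce simp: plus_list_def)

lemma keys_single_subset: "w \<in> W \<Longrightarrow> Poly_Mapping.keys (Poly_Mapping.single w (c::rat)) \<subseteq> W"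
  by simp

definition restrict_poly :: "'k set \<Rightarrow> ('k \<Rightarrow>\<^sub>0 rat) \<Rightarrow> ('k \<Rightarrow>\<^sub>0 rat)" where
  "restrict_poly W p = (\<Sum>w\<in>Poly_Mapping.keys p \<inter> W. Poly_Mapping.single w (Poly_Mapping.lookup p w))"

lemma lookup_restrict_poly:
  "Poly_Mapping.lookup (restrict_poly W p) k = (if k \<in> W then Poly_Mapping.lookup p k else 0)"
proof -
  have "Poly_Mapping.lookup (restrict_poly W p) k =
      (\<Sum>w\<in>Poly_Mapping.keys p \<inter> W. if w = k then Poly_Mapping.lookup p k else 0)"
    unfolding restrict_poly_def lookup_sum by (rule sum.cong) (auto simp: lookup_single)
  also have "\<dots> = (if k \<in> W then Poly_Mapping.lookup p k else 0)"
    by (auto simp: in_keys_iff)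
  finally show ?thesis .
qed

lemma restrict_poly_add: "restrict_poly W (p + q) = restrict_poly W p + restrict_poly W q"
  by (rule poly_mapping_eqI) (simp add: lookup_restrict_poly lookup_add)

lemma restrict_poly_diff: "restrict_poly W (p - q) = restrict_poly W p - restrict_poly W q"
  by (rule poly_mapping_eqI) (simp add: lookup_restrict_poly lookup_minus)

lemma restrict_poly_scale: "restrict_poly W (scale c p) = scale c (restrict_poly W p)"
  by (rule poly_mapping_eqI) (simp add: lookup_restrict_poly)

lemma restrict_poly_zero [simp]: "restrict_poly W 0 = 0"
  by (rule poly_mapping_eqI) (simp add: lookup_restrict_poly)

lemma restrict_poly_sum: "restrict_poly W (sum p F) = (\<Sum>i\<in>F. restrict_poly W (p i))"
  by (induction F rule: infinite_finite_induct) (simp_all add: restrict_poly_add)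

lemma restrict_poly_id: "Poly_Mapping.keys p \<subseteq> W \<Longrightarrow> restrict_poly W p = p"
  by (rule poly_mapping_eqI) (auto simp: lookup_restrict_poly in_keys_iff)

lemma restrict_poly_none: "Poly_Mapping.keys p \<inter> W = {} \<Longrightarrow> restrict_poly W p = 0"
  by (rule poly_mapping_eqI) (auto simp: lookup_restrict_poly in_keys_iff)

lemma keys_restrict_poly: "Poly_Mapping.keys (restrict_poly W p) = Poly_Mapping.keys p \<inter> W"
  by (auto simp: in_keys_iff lookup_restrict_poly split: if_splits)

abbreviation component :: "nat \<Rightarrow> ('x list \<Rightarrow>\<^sub>0 rat) \<Rightarrow> ('x list \<Rightarrow>\<^sub>0 rat)" where
  "component n \<equiv> restrict_poly {w. length w = n}"

lemma component_single:
  "component n (Poly_Mapping.single w c) = (if length w = n then Poly_Mapping.single w c else 0)"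
  by (rule poly_mapping_eqI) (auto simp: lookup_restrict_poly lookup_single when_def)

lemma component_0: "component 0 p = Poly_Mapping.single [] (Poly_Mapping.lookup p [])"
  by (rule poly_mapping_eqI) (auto simp: lookup_restrict_poly lookup_single when_def)

lemma sum_components:
  assumes "finite F" "length ` Poly_Mapping.keys p \<subseteq> F"
  shows "(\<Sum>n\<in>F. component n p) = p"
proof (rule poly_mapping_eqI)
  fix w
  have "Poly_Mapping.lookup (\<Sum>n\<in>F. component n p) w = (\<Sum>n\<in>F. if n = length w then Poly_Mapping.lookup p w else 0)"
    by (auto simp: lookup_sum lookup_restrict_poly intro!: sum.cong)
  also have "\<dots> = Poly_Mapping.lookup p w"
    using assms by (auto simp: in_keys_iff image_subset_iff)
  finally show "Poly_Mapping.lookup (\<Sum>n\<in>F. component n p) w = Poly_Mapping.lookup p w" .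
qed

lemma component_mult:
  "component n (p * q) = (\<Sum>k\<le>n. component k p * component (n - k) q)"
proof -
  have *: "component n (Poly_Mapping.single u c * Poly_Mapping.single v d) =
      (\<Sum>k\<le>n. component k (Poly_Mapping.single u c) * component (n - k) (Poly_Mapping.single v d))"
    for u v :: "'a list" and c d
  proof -
    have "(\<Sum>k\<le>n. component k (Poly_Mapping.single u c) * component (n - k) (Poly_Mapping.single v d)) =
        (\<Sum>k\<le>n. if k = length u then (if length v = n - length u then Poly_Mapping.single (u @ v) (c * d) else 0) else 0)"
      by (intro sum.cong refl) (auto simp: component_single single_mult_single)
    then show ?thesis by (auto simp: component_single single_mult_single)
  qed
  have 1: "Poly_Mapping.keys p \<subseteq> UNIV" "Poly_Mapping.keys q \<subseteq> UNIV" by simp_all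
  from 1(1) show ?thesis
  proof (induction p rule: poly_span_induct)
    case (single u c)
    from 1(2) show ?case
      by (induction q rule: poly_span_induct)
        (simp_all only: * distrib_left restrict_poly_add sum.distrib mult_zero_right restrict_poly_zero sum.neutral_const)
  qed (simp_all add: distrib_right restrict_poly_add sum.distrib)
qed

subsection \<open>The free algebra as a ring\<close>

lemma tensors_closed:
  "0 \<in> tensors B" "1 \<in> tensors B"
  "p \<in> tensors B \<Longrightarrow> q \<in> tensors B \<Longrightarrow> p + q \<in> tensors B"
  "p \<in> tensors B \<Longrightarrow> q \<in> tensors B \<Longrightarrow> p - q \<in> tensors B"
  "p \<in> tensors B \<Longrightarrow> - p \<in> tensors B"
  "p \<in> tensors B \<Longrightarrow> q \<in> tensors B \<Longrightarrow> p * q \<in> tensors B"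
  "p \<in> tensors B \<Longrightarrow> scale c p \<in> tensors B"
  "p \<in> tensors B \<Longrightarrow> restrict_poly W p \<in> tensors B"
  "w \<in> lists B \<Longrightarrow> Poly_Mapping.single w c \<in> tensors B"
  by (auto simp: keys_restrict_poly zero_list_def intro!: le_infI1 keys_add_subset keys_diff_subset keys_uminus_subset keys_scale_subset keys_single_subset
      del: subsetI elim!: keys_mult_subset)

lemma free_algebra_simps:
  "carrier (free_algebra B) = tensors B" "monoid.mult (free_algebra B) = (*)"
  "one (free_algebra B) = 1" "ring.zero (free_algebra B) = 0" "add (free_algebra B) = (+)"
  "smult (free_algebra B) = scale"
  "grade (free_algebra B) n = {p. Poly_Mapping.keys p \<subseteq> {w \<in> lists B. length w = n}}"
  by (simp_all add: free_algebra_def scale_def[abs_def])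

lemma free_algebra_ring: "ring (free_algebra B)"
proof (rule ringI)
  show "abelian_group (free_algebra B)"
  proof (rule abelian_groupI)
    fix x assume "x \<in> carrier (free_algebra B)"
    then show "\<exists>y\<in>carrier (free_algebra B). y \<oplus>\<^bsub>free_algebra B\<^esub> x = \<zero>\<^bsub>free_algebra B\<^esub>"
      by (intro bexI[of _ "- x"]) (simp_all add: free_algebra_simps)
  qed (use tensors_closed[where B = B] in \<open>auto simp: free_algebra_simps add.assoc add.commute\<close>)
  show "monoid (free_algebra B)"
    by (rule monoidI) (use tensors_closed[where B = B] in \<open>auto simp: free_algebra_simps mult.assoc\<close>)
qed (simp_all add: free_algebra_simps algebra_simps)

text \<open>Every algebra below is an iterated quotient of a free algebra, whose elements are sets of sets of
  polynomials.  A presentation \<open>\<pi>\<close> allows to calculate with representatives in the free algebra only.\<close>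

definition presents :: "'x set \<Rightarrow> ('a, 'm) graded_algebra_scheme \<Rightarrow> (('x list \<Rightarrow>\<^sub>0 rat) \<Rightarrow> 'a) \<Rightarrow> bool" where
  "presents B A \<pi> \<longleftrightarrow> ring A \<and> \<pi> \<in> ring_hom (free_algebra B) A \<and> carrier A = \<pi> ` tensors B \<and>
     (\<forall>c. \<forall>t\<in>tensors B. c \<odot>\<^bsub>A\<^esub> \<pi> t = \<pi> (scale c t)) \<and>
     (\<forall>n. grade A n = \<pi> ` grade (free_algebra B) n)"

lemma presents_free: "presents B (free_algebra B) (\<lambda>t. t)"
  by (simp add: presents_def free_algebra_ring free_algebra_simps ring_hom_def)

lemma presentsD:
  assumes "presents B A \<pi>"
  shows "ring A" "\<And>t. t \<in> tensors B \<Longrightarrow> \<pi> t \<in> carrier A"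
    "\<And>s t. s \<in> tensors B \<Longrightarrow> t \<in> tensors B \<Longrightarrow> \<pi> (s + t) = \<pi> s \<oplus>\<^bsub>A\<^esub> \<pi> t"
    "\<And>s t. s \<in> tensors B \<Longrightarrow> t \<in> tensors B \<Longrightarrow> \<pi> (s * t) = \<pi> s \<otimes>\<^bsub>A\<^esub> \<pi> t"
    "\<pi> 1 = \<one>\<^bsub>A\<^esub>" "\<pi> 0 = \<zero>\<^bsub>A\<^esub>"
    "\<And>t. t \<in> tensors B \<Longrightarrow> \<pi> (- t) = \<ominus>\<^bsub>A\<^esub> \<pi> t"
    "\<And>s t. s \<in> tensors B \<Longrightarrow> t \<in> tensors B \<Longrightarrow> \<pi> (s - t) = \<pi> s \<ominus>\<^bsub>A\<^esub> \<pi> t"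
    "\<And>s t. s \<in> tensors B \<Longrightarrow> t \<in> tensors B \<Longrightarrow> \<pi> s = \<pi> t \<longleftrightarrow> \<pi> (s - t) = \<zero>\<^bsub>A\<^esub>"
    "\<And>c t. t \<in> tensors B \<Longrightarrow> c \<odot>\<^bsub>A\<^esub> \<pi> t = \<pi> (scale c t)"
    "\<And>n. grade A n = \<pi> ` {p. Poly_Mapping.keys p \<subseteq> {w \<in> lists B. length w = n}}"
    "carrier A = \<pi> ` tensors B"
proof -
  show R: "ring A" and car: "carrier A = \<pi> ` tensors B" using assms by (simp_all add: presents_def)
  interpret ring A by fact
  have hom: "\<pi> \<in> ring_hom (free_algebra B) A" using assms by (simp add: presents_def)
  show in_A: "\<And>t. t \<in> tensors B \<Longrightarrow> \<pi> t \<in> carrier A"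
    using ring_hom_closed[OF hom] by (simp add: free_algebra_simps)
  show add: "\<And>s t. s \<in> tensors B \<Longrightarrow> t \<in> tensors B \<Longrightarrow> \<pi> (s + t) = \<pi> s \<oplus>\<^bsub>A\<^esub> \<pi> t"
    using ring_hom_add[OF hom] by (simp add: free_algebra_simps)
  show "\<And>s t. s \<in> tensors B \<Longrightarrow> t \<in> tensors B \<Longrightarrow> \<pi> (s * t) = \<pi> s \<otimes>\<^bsub>A\<^esub> \<pi> t"
    using ring_hom_mult[OF hom] by (simp add: free_algebra_simps)
  show "\<pi> 1 = \<one>\<^bsub>A\<^esub>" using ring_hom_one[OF hom] by (simp add: free_algebra_simps)
  show zero: "\<pi> 0 = \<zero>\<^bsub>A\<^esub>"
    using ring_hom_zero[OF hom free_algebra_ring R] by (simp add: free_algebra_simps)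
  show neg: "\<And>t. t \<in> tensors B \<Longrightarrow> \<pi> (- t) = \<ominus>\<^bsub>A\<^esub> \<pi> t"
  proof -
    fix t assume t: "t \<in> tensors B"
    have t': "- t \<in> tensors B" by (rule tensors_closed(5)[OF t])
    have "\<pi> (- t) \<oplus>\<^bsub>A\<^esub> \<pi> t = \<zero>\<^bsub>A\<^esub>" using add[OF t' t] zero by simp
    then show "\<pi> (- t) = \<ominus>\<^bsub>A\<^esub> \<pi> t" using in_A[OF t] in_A[OF t'] by (simp add: minus_equality)
  qed
  show diff: "\<And>s t. s \<in> tensors B \<Longrightarrow> t \<in> tensors B \<Longrightarrow> \<pi> (s - t) = \<pi> s \<ominus>\<^bsub>A\<^esub> \<pi> t"
    using add neg tensors_closed(5)[where B = B] unfolding a_minus_def diff_conv_add_uminus by metis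
  show "\<And>s t. s \<in> tensors B \<Longrightarrow> t \<in> tensors B \<Longrightarrow> \<pi> s = \<pi> t \<longleftrightarrow> \<pi> (s - t) = \<zero>\<^bsub>A\<^esub>"
    using diff in_A by (simp add: r_right_minus_eq)
  show "\<And>c t. t \<in> tensors B \<Longrightarrow> c \<odot>\<^bsub>A\<^esub> \<pi> t = \<pi> (scale c t)"
    "\<And>n. grade A n = \<pi> ` {p. Poly_Mapping.keys p \<subseteq> {w \<in> lists B. length w = n}}"
    using assms by (simp_all add: presents_def free_algebra_simps)
qed

lemma presents_quotient:
  fixes A :: "('a, 'm) graded_algebra_scheme" (structure)
  assumes pres: "presents B A \<pi>" and J: "ideal J A"
  shows "presents B (quotient_algebra A J) (\<lambda>t. J +>\<^bsub>A\<^esub> \<pi> t)"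
    and "t \<in> tensors B \<Longrightarrow> J +>\<^bsub>A\<^esub> \<pi> t = \<zero>\<^bsub>quotient_algebra A J\<^esub> \<longleftrightarrow> \<pi> t \<in> J"
proof -
  interpret ideal J A by fact
  note P = presentsD[OF pres]
  have Q: "ring (A Quot J)" by (rule quotient_is_ring)
  have eq: "carrier (quotient_algebra A J) = carrier (A Quot J)"
    "monoid.mult (quotient_algebra A J) = monoid.mult (A Quot J)"
    "one (quotient_algebra A J) = one (A Quot J)"
    "ring.zero (quotient_algebra A J) = ring.zero (A Quot J)"
    "add (quotient_algebra A J) = add (A Quot J)"
    by (simp_all add: quotient_algebra_def)
  have Qr: "ring (quotient_algebra A J)"
  proof -
    interpret Q: ring "A Quot J" by fact
    show ?thesis
    proof (rule ringI)
      show "abelian_group (quotient_algebra A J)"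
      proof (rule abelian_groupI)
        fix x assume "x \<in> carrier (quotient_algebra A J)"
        then show "\<exists>y\<in>carrier (quotient_algebra A J). y \<oplus>\<^bsub>quotient_algebra A J\<^esub> x = \<zero>\<^bsub>quotient_algebra A J\<^esub>"
          using Q.l_neg[of x] by (intro bexI[of _ "\<ominus>\<^bsub>A Quot J\<^esub> x"]) (simp_all add: eq)
      qed (simp_all add: eq Q.a_ac)
      show "monoid (quotient_algebra A J)"
        by (rule monoidI) (simp_all add: eq Q.m_assoc)
    qed (simp_all add: eq Q.l_distr Q.r_distr)
  qed
  have hom: "(+>) J \<in> ring_hom A (A Quot J)" by (rule rcos_ring_hom)
  show "presents B (quotient_algebra A J) (\<lambda>t. J +>\<^bsub>A\<^esub> \<pi> t)"
    unfolding presents_def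
  proof (intro conjI allI ballI)
    show "(\<lambda>t. J +> \<pi> t) \<in> ring_hom (free_algebra B) (quotient_algebra A J)"
      using ring_hom_closed[OF hom] ring_hom_mult[OF hom] ring_hom_add[OF hom] ring_hom_one[OF hom]
      by (intro ring_hom_memI) (simp_all add: eq P free_algebra_simps)
    show "carrier (quotient_algebra A J) = (\<lambda>t. J +> \<pi> t) ` tensors B"
      by (auto simp: eq FactRing_def A_RCOSETS_def' P(12) image_image)
    show "grade (quotient_algebra A J) n = (\<lambda>t. J +> \<pi> t) ` grade (free_algebra B) n" for n
      by (simp add: quotient_algebra_def P free_algebra_simps image_image)
    fix c t assume t: "t \<in> tensors B"
    have "J +> (c \<odot>\<^bsub>A\<^esub> x) = J +> \<pi> (scale c t)" if xJ: "x \<in> J +> \<pi> t" for x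
    proof -
      obtain j where j: "j \<in> J" "x = j \<oplus> \<pi> t" using xJ by (auto simp: a_r_coset_def')
      obtain s where s: "s \<in> tensors B" "j = \<pi> s" using j(1) a_subset P(12) by (metis (no_types, lifting) imageE subsetD)
      have "scale c s = scale c 1 * s" by (simp add: scale_mult_left)
      moreover have c1: "scale c 1 \<in> tensors B" by (rule tensors_closed(7)[OF tensors_closed(2)])
      ultimately have "\<pi> (scale c s) \<in> J"
        using s j(1) P(4)[OF c1 s(1)] P(2)[OF c1] by (simp add: I_l_closed)
      moreover have "c \<odot>\<^bsub>A\<^esub> x = \<pi> (scale c s) \<oplus> \<pi> (scale c t)"
        using P(3)[OF s(1) t] P(10)[OF tensors_closed(3)[OF s(1) t]] j(2) s
          P(3)[OF tensors_closed(7)[OF s(1)] tensors_closed(7)[OF t]] by (simp add: scale_add)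
      ultimately show ?thesis
        using P(2)[OF tensors_closed(7)[OF t]] P(2)[OF tensors_closed(7)[OF s(1)]]
          a_coset_add_assoc[OF a_subset, of "\<pi> (scale c s)" "\<pi> (scale c t)"]
        by (simp add: a_rcos_const)
    qed
    moreover have "\<pi> t \<in> J +> \<pi> t" using a_rcos_self P(2)[OF t] by simp
    ultimately show "c \<odot>\<^bsub>quotient_algebra A J\<^esub> (J +> \<pi> t) = J +> \<pi> (scale c t)"
      by (auto simp: quotient_algebra_def)
  qed (rule Qr)
  show "J +>\<^bsub>A\<^esub> \<pi> t = \<zero>\<^bsub>quotient_algebra A J\<^esub> \<longleftrightarrow> \<pi> t \<in> J" if "t \<in> tensors B"
    using P(2)[OF that] a_rcos_const[of "\<pi> t"] a_rcos_self[of "\<pi> t"]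
    by (auto simp: eq FactRing_def)
qed

definition two_sided_ideal :: "'x set \<Rightarrow> ('x list \<Rightarrow>\<^sub>0 rat) set \<Rightarrow> bool" where
  "two_sided_ideal B K \<longleftrightarrow> K \<subseteq> tensors B \<and> 0 \<in> K \<and> (\<forall>p\<in>K. \<forall>q\<in>K. p - q \<in> K) \<and>
     (\<forall>p\<in>K. \<forall>t\<in>tensors B. p * t \<in> K \<and> t * p \<in> K)"

lemma two_sided_idealD:
  assumes "two_sided_ideal B K"
  shows "K \<subseteq> tensors B" "0 \<in> K" "p \<in> K \<Longrightarrow> q \<in> K \<Longrightarrow> p - q \<in> K" "p \<in> K \<Longrightarrow> q \<in> K \<Longrightarrow> p + q \<in> K"
    "p \<in> K \<Longrightarrow> t \<in> tensors B \<Longrightarrow> p * t \<in> K" "p \<in> K \<Longrightarrow> t \<in> tensors B \<Longrightarrow> t * p \<in> K"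
    "p \<in> K \<Longrightarrow> - p \<in> K"
proof -
  have neg: "- p \<in> K" if "p \<in> K" for p
    using assms that unfolding two_sided_ideal_def by (metis diff_0)
  show "p \<in> K \<Longrightarrow> - p \<in> K" by (rule neg)
  show "p \<in> K \<Longrightarrow> q \<in> K \<Longrightarrow> p + q \<in> K"
    using assms neg[of q] unfolding two_sided_ideal_def by (metis diff_minus_eq_add)
qed (use assms in \<open>simp_all add: two_sided_ideal_def\<close>)

text \<open>The kernel of a quotient is the smallest ideal that contains the relations.\<close>

lemma quotient_kernel_minimal:
  fixes A :: "('a, 'm) graded_algebra_scheme" (structure)
  assumes pres: "presents B A \<pi>" and K: "two_sided_ideal B K"
    and ker: "\<And>t. t \<in> tensors B \<Longrightarrow> \<pi> t = \<zero>\<^bsub>A\<^esub> \<Longrightarrow> t \<in> K"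
    and S: "S \<subseteq> \<pi> ` K"
    and t: "t \<in> tensors B" "\<pi> t \<in> Idl\<^bsub>A\<^esub> S"
  shows "t \<in> K"
proof -
  note P = presentsD[OF pres] and K = two_sided_idealD[OF K]
  interpret ring A by (rule P(1))
  have "ideal (\<pi> ` K) A"
  proof (rule idealI[OF P(1)])
    show "subgroup (\<pi> ` K) (add_monoid A)"
    proof (rule add.subgroupI)
      show "\<pi> ` K \<subseteq> carrier A" using K(1) P(12) by blast
      show "\<pi> ` K \<noteq> {}" using K(2) by blast
      show "\<ominus> a \<in> \<pi> ` K" if "a \<in> \<pi> ` K" for a
        using that K(1,7) P(7) by (metis (no_types, lifting) imageE imageI subsetD)
      show "a \<oplus> b \<in> \<pi> ` K" if ab: "a \<in> \<pi> ` K" "b \<in> \<pi> ` K" for a b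
      proof -
        obtain p q where "p \<in> K" "q \<in> K" "a = \<pi> p" "b = \<pi> q" using ab by blast
        then show ?thesis using K(1,4) P(3)[of p q] by (metis imageI subsetD)
      qed
    qed
    fix a x assume "a \<in> \<pi> ` K" "x \<in> carrier A"
    then obtain p q where pq: "p \<in> K" "q \<in> tensors B" "a = \<pi> p" "x = \<pi> q" using P(12) by blast
    then have p: "p \<in> tensors B" using K(1) by blast
    show "x \<otimes> a \<in> \<pi> ` K" using P(4)[OF pq(2) p] K(6)[OF pq(1,2)] pq by (metis imageI)
    show "a \<otimes> x \<in> \<pi> ` K" using P(4)[OF p pq(2)] K(5)[OF pq(1,2)] pq by (metis imageI)
  qed
  then have "\<pi> t \<in> \<pi> ` K" using genideal_minimal[OF _ S] t(2) by blast
  then obtain k where k: "k \<in> K" "\<pi> t = \<pi> k" by blast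
  then have "k \<in> tensors B" using K(1) by blast
  then have "t - k \<in> K" using P(9)[OF t(1)] k ker tensors_closed(4)[OF t(1)] by blast
  from K(4)[OF this k(1)] show ?thesis by simp
qed

text \<open>Applied to the kernel of a presentation: if the relations are homogeneous, minimality of the kernel
  shows that it contains the components of its elements.\<close>

lemma two_sided_ideal_homogeneous_part:
  assumes K: "two_sided_ideal B K"
  shows "two_sided_ideal B {t \<in> tensors B. \<forall>n. component n t \<in> K}"
proof -
  note K = two_sided_idealD[OF K]
  have sum: "sum f F \<in> K" if "\<And>i. i \<in> F \<Longrightarrow> f i \<in> K" for f :: "nat \<Rightarrow> _" and F
    using that by (induction F rule: infinite_finite_induct) (auto intro: K)
  show ?thesis
    unfolding two_sided_ideal_def
  proof (intro conjI ballI)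
    fix p t assume p: "p \<in> {t \<in> tensors B. \<forall>n. component n t \<in> K}" and t: "t \<in> tensors B"
    have "component i p * component j t \<in> K \<and> component j t * component i p \<in> K" for i j
      using p K(5,6)[OF _ tensors_closed(8)[OF t]] by blast
    then have "component n (p * t) \<in> K" "component n (t * p) \<in> K" for n
      unfolding component_mult by (blast intro: sum)+
    then show "p * t \<in> {t \<in> tensors B. \<forall>n. component n t \<in> K}" "t * p \<in> {t \<in> tensors B. \<forall>n. component n t \<in> K}"
      using p t tensors_closed(6)[of p B t] tensors_closed(6)[of t B p] by auto
  next
    fix p q assume "p \<in> {t \<in> tensors B. \<forall>n. component n t \<in> K}" "q \<in> {t \<in> tensors B. \<forall>n. component n t \<in> K}"
    then show "p - q \<in> {t \<in> tensors B. \<forall>n. component n t \<in> K}"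
      using tensors_closed(4)[of p B q] K(3) by (simp add: restrict_poly_diff)
  next
    show "{t \<in> tensors B. \<forall>n. component n t \<in> K} \<subseteq> tensors B" by blast
  qed (use K(2) in simp)
qed

locale graded_presentation =
  fixes B :: "'x set" and A :: "('a, 'm) graded_algebra_scheme" (structure) and \<pi>
  assumes presents: "presents B A \<pi>"
    and kernel_graded: "\<And>t n. t \<in> tensors B \<Longrightarrow> \<pi> t = \<zero> \<Longrightarrow> \<pi> (component n t) = \<zero>"
    and nontrivial: "\<pi> 1 \<noteq> \<zero>"
begin

lemmas presented = presentsD[OF presents]

lemma \<pi>_sum:
  assumes "\<And>i. i \<in> F \<Longrightarrow> f i \<in> tensors B" "finite F"
  shows "finsum A (\<lambda>i. \<pi> (f i)) F = \<pi> (sum f F) \<and> sum f F \<in> tensors B"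
proof -
  interpret ring A by (rule presented(1))
  show ?thesis using assms(2,1)
  proof (induction F rule: finite_induct)
    case (insert x F)
    have s: "sum f F \<in> tensors B" "f x \<in> tensors B" using insert by auto
    have "finsum A (\<lambda>i. \<pi> (f i)) (insert x F) = \<pi> (f x) \<oplus> \<pi> (sum f F)"
      using insert presented(2) by (subst finsum_insert) auto
    also have "\<dots> = \<pi> (f x + sum f F)" by (rule presented(3)[OF s(2,1), symmetric])
    finally show ?case using insert(1,2) tensors_closed(3)[OF s(2,1)] by simp
  qed (simp add: presented(6))
qed

text \<open>Uniqueness is where the kernel has to be graded.\<close>

lemma homogeneous_decomposition_\<pi>:
  assumes t: "t \<in> tensors B"
  shows "homogeneous_decomposition A c (\<pi> t) \<longleftrightarrow> c = (\<lambda>n. \<pi> (component n t))"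
proof
  interpret ring A by (rule presented(1))
  assume c: "c = (\<lambda>n. \<pi> (component n t))"
  have tc: "component n t \<in> tensors B" for n by (rule tensors_closed(8)[OF t])
  let ?F = "length ` Poly_Mapping.keys t" and ?G = "{n. c n \<noteq> \<zero>}"
  have GF: "?G \<subseteq> ?F"
  proof (rule subsetI, rule ccontr)
    fix n assume n: "n \<in> ?G" "n \<notin> ?F"
    then have "component n t = 0" by (intro restrict_poly_none) auto
    then show False using n c presented(6) by simp
  qed
  have "finsum A c ?G = finsum A c ?F"
    using GF presented(2)[OF tc] by (intro add.finprod_mono_neutral_cong_left) (auto simp: c)
  also have "\<dots> = \<pi> (\<Sum>n\<in>?F. component n t)" unfolding c using \<pi>_sum[of ?F "\<lambda>n. component n t"] tc by simp
  also have "\<dots> = \<pi> t" by (simp add: sum_components)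
  finally have "\<pi> t = finsum A c ?G" by simp
  moreover have "c n \<in> grade A n" for n
    unfolding c presented(11) using t by (intro imageI) (auto simp: keys_restrict_poly)
  moreover have "finite ?G" using finite_subset[OF GF] by simp
  ultimately show "homogeneous_decomposition A c (\<pi> t)" by (simp add: homogeneous_decomposition_def)
next
  interpret ring A by (rule presented(1))
  assume "homogeneous_decomposition A c (\<pi> t)"
  then have c: "\<And>n. c n \<in> grade A n" and fin: "finite {n. c n \<noteq> \<zero>}"
    and eq: "\<pi> t = finsum A c {n. c n \<noteq> \<zero>}" by (simp_all add: homogeneous_decomposition_def)
  from c have "\<exists>p. Poly_Mapping.keys p \<subseteq> {w \<in> lists B. length w = n} \<and> c n = \<pi> p" for n
    unfolding presented(11) by blast
  then obtain p where p: "\<And>n. Poly_Mapping.keys (p n) \<subseteq> {w \<in> lists B. length w = n}" "\<And>n. c n = \<pi> (p n)"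
    by metis
  have pt: "p n \<in> tensors B" for n using p(1)[of n] by auto
  let ?G = "{n. c n \<noteq> \<zero>}"
  let ?s = "\<Sum>n\<in>?G. p n"
  have cp: "c = (\<lambda>n. \<pi> (p n))" using p(2) by blast
  have s: "\<pi> t = \<pi> ?s" "?s \<in> tensors B"
    using \<pi>_sum[of ?G p, folded cp] pt fin eq by (simp_all del: mem_Collect_eq)
  have comp: "component n (p k) = (if k = n then p k else 0)" for n k
    using p(1)[of k] by (auto intro!: restrict_poly_id restrict_poly_none)
  show "c = (\<lambda>n. \<pi> (component n t))"
  proof
    fix n
    have "\<pi> (component n (t - ?s)) = \<zero>"
      using presented(9)[OF t s(2)] s(1) tensors_closed(4)[OF t s(2)] by (intro kernel_graded) auto
    then have "\<pi> (component n t) = \<pi> (component n ?s)"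
      using presented(9)[OF tensors_closed(8)[OF t] tensors_closed(8)[OF s(2)]] by (simp add: restrict_poly_diff)
    also have "component n ?s = (if n \<in> ?G then p n else 0)"
      using fin by (simp add: restrict_poly_sum comp)
    finally show "c n = \<pi> (component n t)" using p(2)[of n] presented(6) by (auto split: if_splits)
  qed
qed

lemma connected_graded_presentation: "connected_graded_algebra A"
proof -
  interpret ring A by (rule presented(1))
  have ex: "\<exists>t\<in>tensors B. x = \<pi> t" if "x \<in> carrier A" for x using that presented(12) by blast
  have t: "0 \<in> tensors B" "1 \<in> tensors B" by (rule tensors_closed)+
  have mod: "module ring_of_type_algebra A"
  proof (rule moduleI)
    show "cring (ring_of_type_algebra :: rat ring)" by (rule cring_from_type_algebra)
  next
    fix a b :: rat and x assume x: "x \<in> carrier A"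
    obtain t where ts: "t \<in> tensors B" "x = \<pi> t" using ex x by blast
    note tc = tensors_closed(7)[OF ts(1)]
    have sc: "scale (a + b) t = scale a t + scale b t" "scale (a * b) t = scale a (scale b t)" "scale 1 t = t"
      by (rule poly_mapping_eqI; simp add: lookup_add distrib_right)+
    show "a \<odot>\<^bsub>A\<^esub> x \<in> carrier A" using presented(2)[OF tc] presented(10)[OF ts(1)] ts(2) by simp
    show "(a \<oplus>\<^bsub>ring_of_type_algebra\<^esub> b) \<odot>\<^bsub>A\<^esub> x = a \<odot>\<^bsub>A\<^esub> x \<oplus> b \<odot>\<^bsub>A\<^esub> x"
      using presented(10)[OF ts(1)] presented(3)[OF tc tc] ts(2) by (simp add: ring_of_type_algebra_def sc)
    show "(a \<otimes>\<^bsub>ring_of_type_algebra\<^esub> b) \<odot>\<^bsub>A\<^esub> x = a \<odot>\<^bsub>A\<^esub> (b \<odot>\<^bsub>A\<^esub> x)"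
      using presented(10)[OF ts(1)] presented(10)[OF tc] ts(2) by (simp add: ring_of_type_algebra_def sc)
    show "\<one>\<^bsub>ring_of_type_algebra\<^esub> \<odot>\<^bsub>A\<^esub> x = x"
      using presented(10)[OF ts(1)] ts(2) by (simp add: ring_of_type_algebra_def sc)
  next
    fix a :: rat and x y assume x: "x \<in> carrier A" and y: "y \<in> carrier A"
    obtain t s where ts: "t \<in> tensors B" "x = \<pi> t" "s \<in> tensors B" "y = \<pi> s" using ex x y by blast
    show "a \<odot>\<^bsub>A\<^esub> (x \<oplus> y) = a \<odot>\<^bsub>A\<^esub> x \<oplus> a \<odot>\<^bsub>A\<^esub> y"
      using presented(3)[OF ts(1,3)] presented(3)[OF tensors_closed(7)[OF ts(1)] tensors_closed(7)[OF ts(3)]]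
        presented(10)[OF tensors_closed(3)[OF ts(1,3)]] presented(10)[OF ts(1)] presented(10)[OF ts(3)] ts(2,4)
      by (simp add: scale_add)
  qed (rule is_abelian_group)
  have sm: "(c \<odot>\<^bsub>A\<^esub> x) \<otimes> y = c \<odot>\<^bsub>A\<^esub> (x \<otimes> y) \<and> x \<otimes> (c \<odot>\<^bsub>A\<^esub> y) = c \<odot>\<^bsub>A\<^esub> (x \<otimes> y)"
    if xy: "x \<in> carrier A" "y \<in> carrier A" for c x y
  proof -
    obtain t s where ts: "t \<in> tensors B" "x = \<pi> t" "s \<in> tensors B" "y = \<pi> s" using ex xy by blast
    show ?thesis
      using presented(4)[OF ts(1,3)] presented(4)[OF tensors_closed(7)[OF ts(1)] ts(3)] presented(4)[OF ts(1) tensors_closed(7)[OF ts(3)]]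
        presented(10)[OF tensors_closed(6)[OF ts(1,3)]] presented(10)[OF ts(1)] presented(10)[OF ts(3)] ts(2,4)
      by (simp add: scale_mult_left scale_mult_right)
  qed
  have grT: "{p. Poly_Mapping.keys p \<subseteq> {w \<in> lists B. length w = n}} \<subseteq> tensors B" for n by auto
  have sub: "submodule (grade A n) ring_of_type_algebra A" for n
  proof (rule module.submoduleI[OF mod])
    show "grade A n \<subseteq> carrier A" unfolding presented(11,12) by (rule image_mono[OF grT])
    have "0 \<in> {p :: 'x list \<Rightarrow>\<^sub>0 rat. Poly_Mapping.keys p \<subseteq> {w \<in> lists B. length w = n}}" by simp
    from imageI[OF this, of \<pi>] show "\<zero> \<in> grade A n" by (simp add: presented(6,11))
  next
    fix a assume "a \<in> grade A n"
    then obtain p where p: "Poly_Mapping.keys p \<subseteq> {w \<in> lists B. length w = n}" "a = \<pi> p" using presented(11) by blast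
    then have pt: "p \<in> tensors B" by auto
    show "\<ominus> a \<in> grade A n" unfolding presented(11) p(2) presented(7)[OF pt, symmetric]
      using keys_uminus_subset[OF p(1)] by blast
    show "c \<odot>\<^bsub>A\<^esub> a \<in> grade A n" for c unfolding presented(11) p(2) presented(10)[OF pt]
      using keys_scale_subset[OF p(1)] by blast
    fix b assume "b \<in> grade A n"
    then obtain q where q: "Poly_Mapping.keys q \<subseteq> {w \<in> lists B. length w = n}" "b = \<pi> q" using presented(11) by blast
    then have qt: "q \<in> tensors B" by auto
    show "a \<oplus> b \<in> grade A n" unfolding presented(11) p(2) q(2) presented(3)[OF pt qt, symmetric]
      using keys_add_subset[OF p(1) q(1)] by blast
  qed
  have mult: "x \<otimes> y \<in> grade A (m + n)" if "x \<in> grade A m" "y \<in> grade A n" for m n x y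
  proof -
    obtain p where p: "Poly_Mapping.keys p \<subseteq> {w \<in> lists B. length w = m}" "x = \<pi> p" using presented(11) \<open>x \<in> grade A m\<close> by blast
    obtain q where q: "Poly_Mapping.keys q \<subseteq> {w \<in> lists B. length w = n}" "y = \<pi> q" using presented(11) \<open>y \<in> grade A n\<close> by blast
    have t: "p \<in> tensors B" "q \<in> tensors B" using p(1) q(1) by auto
    have "Poly_Mapping.keys (p * q) \<subseteq> {w \<in> lists B. length w = m + n}"
      by (rule keys_mult_subset[OF p(1) q(1)]) auto
    then show ?thesis unfolding presented(11) p(2) q(2) presented(4)[OF t, symmetric] by blast
  qed
  have gr0: "grade A 0 = {c \<odot>\<^bsub>A\<^esub> \<one> | c. True}"
  proof -
    have "{p :: 'x list \<Rightarrow>\<^sub>0 rat. Poly_Mapping.keys p \<subseteq> {w \<in> lists B. length w = 0}} = {scale c 1 | c. True}"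
    proof (intro Set.set_eqI iffI)
      fix p :: "'x list \<Rightarrow>\<^sub>0 rat"
      assume "p \<in> {p. Poly_Mapping.keys p \<subseteq> {w \<in> lists B. length w = 0}}"
      then have "component 0 p = p" by (intro restrict_poly_id) auto
      then have "p = scale (Poly_Mapping.lookup p []) 1"
        unfolding component_0 by (simp add: zero_list_def flip: single_one)
      then show "p \<in> {scale c 1 | c. True}" by blast
    next
      fix p :: "'x list \<Rightarrow>\<^sub>0 rat" assume "p \<in> {scale c 1 | c. True}"
      then show "p \<in> {p. Poly_Mapping.keys p \<subseteq> {w \<in> lists B. length w = 0}}"
        by (auto simp: zero_list_def simp flip: single_one split: if_splits)
    qed
    then show ?thesis unfolding presented(11) using presented(10)[OF t(2)] presented(5) by auto
  qed
  have hd: "\<exists>!c. homogeneous_decomposition A c x" if x: "x \<in> carrier A" for x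
  proof -
    obtain t where t: "t \<in> tensors B" "x = \<pi> t" using ex[OF x] by blast
    show ?thesis unfolding t(2) homogeneous_decomposition_\<pi>[OF t(1)] by simp
  qed
  have "\<one> \<noteq> \<zero>" using nontrivial presented(5) by simp
  then show ?thesis
    unfolding connected_graded_algebra_def
    by (intro conjI allI ballI presented(1) mod sm[THEN conjunct1] sm[THEN conjunct2] sub hd mult gr0)
qed

lemma augmentation_\<pi>:
  assumes t: "t \<in> tensors B"
  shows "augmentation A (\<pi> t) = Poly_Mapping.lookup t []"
proof -
  have one: "1 \<in> tensors B" by (rule tensors_closed)
  have sc: "q \<odot>\<^bsub>A\<^esub> \<one> = \<pi> (scale q 1)" for q using presented(10)[OF one] presented(5) by simp
  have c0: "component 0 t = scale (Poly_Mapping.lookup t []) 1"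
    unfolding component_0 by (simp add: zero_list_def flip: single_one)
  have inj: "q = r" if "\<pi> (scale q 1) = \<pi> (scale r 1)" for q r
  proof (rule ccontr)
    assume "q \<noteq> r"
    have s: "scale q 1 - scale r 1 = scale (q - r) (1 :: 'x list \<Rightarrow>\<^sub>0 rat)"
      by (rule poly_mapping_eqI) (simp add: lookup_minus left_diff_distrib)
    have "\<pi> (scale (q - r) 1) = \<zero>"
      using that presented(9)[OF tensors_closed(7)[OF one] tensors_closed(7)[OF one]] by (simp add: s)
    then have "\<pi> (scale (1 / (q - r)) (scale (q - r) 1)) = (1 / (q - r)) \<odot>\<^bsub>A\<^esub> \<pi> 0"
      using presented(10)[OF tensors_closed(7)[OF one]] presented(6) by metis
    also have "\<dots> = \<zero>" using presented(10)[OF tensors_closed(1)] presented(6) by simp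
    also have "scale (1 / (q - r)) (scale (q - r) 1) = (1 :: 'x list \<Rightarrow>\<^sub>0 rat)"
      using \<open>q \<noteq> r\<close> by (intro poly_mapping_eqI) simp
    finally show False using nontrivial by simp
  qed
  have "(\<exists>c. c = (\<lambda>n. \<pi> (component n t)) \<and> c 0 = \<pi> (scale q 1)) \<longleftrightarrow> \<pi> (component 0 t) = \<pi> (scale q 1)" for q
    by blast
  moreover have "\<pi> (component 0 t) = \<pi> (scale q 1) \<longleftrightarrow> q = Poly_Mapping.lookup t []" for q
    unfolding c0 using inj by blast
  ultimately show ?thesis
    unfolding augmentation_def homogeneous_decomposition_\<pi>[OF t] sc by simp
qed

end

sublocale graded_presentation \<subseteq> augmented_algebra A
proof
  note tc = tensors_closed[where B = B]
  fix x y c assume "x \<in> carrier A" "y \<in> carrier A"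
  then obtain s t where st: "s \<in> tensors B" "t \<in> tensors B" "x = \<pi> s" "y = \<pi> t" using presented(12) by blast
  show "augmentation A (x \<oplus> y) = augmentation A x + augmentation A y"
    unfolding st presented(3)[OF st(1,2), symmetric] augmentation_\<pi>[OF tc(3)[OF st(1,2)]]
      augmentation_\<pi>[OF st(1)] augmentation_\<pi>[OF st(2)] by (simp add: lookup_add)
  have "component 0 (s * t) = component 0 s * component 0 t" using component_mult[of 0 s t] by simp
  from arg_cong[OF this, of "\<lambda>p. Poly_Mapping.lookup p []"]
  have "Poly_Mapping.lookup (s * t) [] = Poly_Mapping.lookup s [] * Poly_Mapping.lookup t []"
    unfolding component_0 single_mult_single by simp
  then show "augmentation A (x \<otimes> y) = augmentation A x * augmentation A y"
    unfolding st presented(4)[OF st(1,2), symmetric] augmentation_\<pi>[OF tc(6)[OF st(1,2)]]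
      augmentation_\<pi>[OF st(1)] augmentation_\<pi>[OF st(2)] .
next
  fix x c assume "x \<in> carrier A"
  then obtain s where st: "s \<in> tensors B" "x = \<pi> s" using presented(12) by blast
  show "augmentation A (c \<odot>\<^bsub>A\<^esub> x) = c * augmentation A x"
    unfolding st presented(10)[OF st(1)] augmentation_\<pi>[OF tensors_closed(7)[OF st(1)]] augmentation_\<pi>[OF st(1)] by simp
next
  show "augmentation A \<one> = 1"
    using augmentation_\<pi>[OF tensors_closed(2)] presented(5) by (simp add: lookup_one zero_list_def)
next
  fix x n assume "x \<in> grade A (Suc n)"
  then obtain p where p: "Poly_Mapping.keys p \<subseteq> {w \<in> lists B. length w = Suc n}" "x = \<pi> p" using presented(11) by blast
  then have "p \<in> tensors B" "Poly_Mapping.lookup p [] = 0" by (auto simp: in_keys_iff)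
  then show "augmentation A x = 0" using augmentation_\<pi> p(2) by simp
qed (rule connected_graded_presentation)

section \<open>A Koszulness criterion in terms of normal words\<close>

context graded_presentation
begin

definition ending_in :: "'x set \<Rightarrow> ('x list \<Rightarrow>\<^sub>0 rat) set" where
  "ending_in S = {p. Poly_Mapping.keys p \<subseteq> {w \<in> lists B. w \<noteq> [] \<and> last w \<in> S}}"

text \<open>With \<open>S\<close> an initial segment of the letters these are the members of the Koszul filtration.\<close>

definition last_letter_ideal :: "'x set \<Rightarrow> 'a set" where
  "last_letter_ideal S = \<pi> ` ending_in S"

lemma ending_in_tensors: "p \<in> ending_in S \<Longrightarrow> p \<in> tensors B"
  by (auto simp: ending_in_def)

lemma ending_in_closed:
  "0 \<in> ending_in S"
  "p \<in> ending_in S \<Longrightarrow> q \<in> ending_in S \<Longrightarrow> p + q \<in> ending_in S"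
  "p \<in> ending_in S \<Longrightarrow> - p \<in> ending_in S"
  "p \<in> ending_in S \<Longrightarrow> component n p \<in> ending_in S"
  "t \<in> tensors B \<Longrightarrow> p \<in> ending_in S \<Longrightarrow> t * p \<in> ending_in S"
proof -
  show "t \<in> tensors B \<Longrightarrow> p \<in> ending_in S \<Longrightarrow> t * p \<in> ending_in S"
    unfolding ending_in_def mem_Collect_eq by (erule keys_mult_subset, assumption) auto
  show "p \<in> ending_in S \<Longrightarrow> component n p \<in> ending_in S"
    unfolding ending_in_def mem_Collect_eq keys_restrict_poly by blast
qed (simp_all add: ending_in_def keys_add_subset keys_uminus_subset)

lemma ending_in_single:
  "w \<in> lists B \<Longrightarrow> c \<in> B \<Longrightarrow> c \<in> S \<Longrightarrow> Poly_Mapping.single (w @ [c]) r \<in> ending_in S"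
  by (simp add: ending_in_def)

lemma ending_in_mono: "S \<subseteq> S' \<Longrightarrow> ending_in S \<subseteq> ending_in S'"
  by (auto simp: ending_in_def)

lemma ending_in_induct [consumes 1, case_names zero single add]:
  assumes "p \<in> ending_in S" "P 0"
    and "\<And>u c r. u \<in> lists B \<Longrightarrow> c \<in> B \<Longrightarrow> c \<in> S \<Longrightarrow> P (Poly_Mapping.single (u @ [c]) r)"
    and "\<And>p q. P p \<Longrightarrow> P q \<Longrightarrow> P (p + q)"
  shows "P p"
  using assms(1) unfolding ending_in_def mem_Collect_eq
proof (induction p rule: poly_span_induct)
  case (single w c)
  then show ?case using assms(3) by (cases w rule: rev_cases) auto
qed (use assms in auto)

lemma \<pi>_diff_zeroI: "s \<in> tensors B \<Longrightarrow> t \<in> tensors B \<Longrightarrow> \<pi> s = \<pi> t \<Longrightarrow> \<pi> (s - t) = \<zero>"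
  using presented(9) by blast

text \<open>
  Moving a set of letters \<open>S''\<close> past the letter \<open>s\<close>: the colon ideal \<open>(S - {s}) : s\<close> contains \<open>S''\<close>.
\<close>

definition absorbs :: "'x set \<Rightarrow> 'x \<Rightarrow> 'x set \<Rightarrow> bool" where
  "absorbs S s S'' \<longleftrightarrow> (\<forall>c\<in>S''. \<exists>q\<in>ending_in (S - {s}). \<pi> (word [c, s]) = \<pi> q)"

lemma absorbs_right_mult:
  assumes "absorbs S s S''" "s \<in> B" "q \<in> ending_in S''"
  shows "\<exists>q'\<in>ending_in (S - {s}). \<pi> (q * word [s]) = \<pi> q'"
proof -
  have ws: "word [s] \<in> tensors B" using assms(2) by simp
  have "q \<in> tensors B \<and> (\<exists>q'\<in>ending_in (S - {s}). \<pi> (q * word [s]) = \<pi> q')"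
    using assms(3)
  proof (induction q rule: ending_in_induct)
    case zero
    then show ?case using ending_in_closed(1) by auto
  next
    case (single u c r)
    obtain q where q: "q \<in> ending_in (S - {s})" "\<pi> (word [c, s]) = \<pi> q"
      using assms(1) single(3) by (auto simp: absorbs_def)
    have t: "Poly_Mapping.single u r \<in> tensors B" "word [c, s] \<in> tensors B" "q \<in> tensors B"
      "Poly_Mapping.single (u @ [c]) r \<in> tensors B"
      using single assms(2) ending_in_tensors[OF q(1)] by auto
    have "Poly_Mapping.single (u @ [c]) r * word [s] = Poly_Mapping.single u r * word [c, s]"
      by (simp add: single_mult_single)
    then have "\<pi> (Poly_Mapping.single (u @ [c]) r * word [s]) = \<pi> (Poly_Mapping.single u r * q)"
      using presented(4)[OF t(1,2)] presented(4)[OF t(1,3)] q(2) by simp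
    then show ?case using ending_in_closed(5)[OF t(1) q(1)] t(4) by blast
  next
    case (add p q)
    then obtain p' q' where pq: "p' \<in> ending_in (S - {s})" "\<pi> (p * word [s]) = \<pi> p'"
      "q' \<in> ending_in (S - {s})" "\<pi> (q * word [s]) = \<pi> q'" by blast
    have t: "p \<in> tensors B" "q \<in> tensors B" "p' \<in> tensors B" "q' \<in> tensors B"
      "p * word [s] \<in> tensors B" "q * word [s] \<in> tensors B"
      using add pq ending_in_tensors tensors_closed(6)[OF _ ws] by blast+
    have "\<pi> ((p + q) * word [s]) = \<pi> (p' + q')"
      unfolding distrib_right using presented(3)[OF t(5,6)] presented(3)[OF t(3,4)] pq by simp
    then show ?case using ending_in_closed(2)[OF pq(1,3)] tensors_closed(3)[OF t(1,2)] by blast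
  qed
  then show ?thesis ..
qed

text \<open>
  The words in \<open>N S\<close> are the normal words that do not end in \<open>S\<close>.  That they span \<open>A\<close> modulo the
  ideal of \<open>S\<close> needs no rewriting procedure: remove one letter \<open>s\<close> from \<open>S\<close> and apply the claim for the
  larger set \<open>S''\<close> to the coefficient of \<open>s\<close>.
\<close>

lemma spanning_step:
  assumes ab: "absorbs S s S''" and s: "s \<in> S" "S \<subseteq> B"
    and N: "NS \<subseteq> N'" "\<And>w. w \<in> NS'' \<Longrightarrow> w @ [s] \<in> N'"
    and NS: "\<And>t. t \<in> tensors B \<Longrightarrow> \<exists>p q. Poly_Mapping.keys p \<subseteq> NS \<and> q \<in> ending_in S \<and> \<pi> t = \<pi> (p + q)"
    and NS'': "\<And>t. t \<in> tensors B \<Longrightarrow> \<exists>p q. Poly_Mapping.keys p \<subseteq> NS'' \<and> q \<in> ending_in S'' \<and> \<pi> t = \<pi> (p + q)"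
    and lists: "N' \<subseteq> lists B" "NS'' \<subseteq> lists B" and t: "t \<in> tensors B"
  shows "\<exists>p q. Poly_Mapping.keys p \<subseteq> N' \<and> q \<in> ending_in (S - {s}) \<and> \<pi> t = \<pi> (p + q)"
proof -
  have sB: "s \<in> B" using s by blast
  have ws: "word [s] \<in> tensors B" using sB by simp
  have sum: "\<exists>p q. Poly_Mapping.keys p \<subseteq> N' \<and> q \<in> ending_in (S - {s}) \<and> \<pi> (t + t') = \<pi> (p + q)"
    if tt: "t \<in> tensors B" "t' \<in> tensors B"
    and a: "\<exists>p q. Poly_Mapping.keys p \<subseteq> N' \<and> q \<in> ending_in (S - {s}) \<and> \<pi> t = \<pi> (p + q)"
    and b: "\<exists>p q. Poly_Mapping.keys p \<subseteq> N' \<and> q \<in> ending_in (S - {s}) \<and> \<pi> t' = \<pi> (p + q)" for t t'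
  proof -
    obtain p q where 1: "Poly_Mapping.keys p \<subseteq> N'" "q \<in> ending_in (S - {s})" "\<pi> t = \<pi> (p + q)" using a by blast
    obtain p' q' where 2: "Poly_Mapping.keys p' \<subseteq> N'" "q' \<in> ending_in (S - {s})" "\<pi> t' = \<pi> (p' + q')" using b by blast
    have c: "p + q \<in> tensors B" "p' + q' \<in> tensors B"
      using 1(1) 2(1) lists ending_in_tensors[OF 1(2)] ending_in_tensors[OF 2(2)] by (auto intro!: tensors_closed(3)[unfolded mem_Collect_eq] del: subsetI)
    have "\<pi> (t + t') = \<pi> ((p + q) + (p' + q'))"
      using presented(3)[OF tt] presented(3)[OF c] 1(3) 2(3) by simp
    also have "(p + q) + (p' + q') = (p + p') + (q + q')" by simp
    finally show ?thesis
      using keys_add_subset[OF 1(1) 2(1)] ending_in_closed(2)[OF 1(2) 2(2)] by blast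
  qed
  have last: "q \<in> tensors B \<and> (\<exists>p q'. Poly_Mapping.keys p \<subseteq> N' \<and> q' \<in> ending_in (S - {s}) \<and> \<pi> q = \<pi> (p + q'))"
    if "q \<in> ending_in S" for q
    using that
  proof (induction q rule: ending_in_induct)
    case zero
    then show ?case using ending_in_closed(1) by (auto intro!: exI[of _ 0])
  next
    case (single u c r)
    have cr: "Poly_Mapping.single (u @ [c]) r \<in> tensors B" "Poly_Mapping.single u r \<in> tensors B"
      using single by auto
    show ?case
    proof (cases "c = s")
      case False
      then have "Poly_Mapping.single (u @ [c]) r \<in> ending_in (S - {s})" using single by (intro ending_in_single) auto
      then show ?thesis using cr(1)
        by (intro conjI exI[of _ 0] exI[of _ "Poly_Mapping.single (u @ [c]) r"]) simp_all
    next
      case True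
      obtain p q where pq: "Poly_Mapping.keys p \<subseteq> NS''" "q \<in> ending_in S''" "\<pi> (Poly_Mapping.single u r) = \<pi> (p + q)"
        using NS''[OF cr(2)] by blast
      obtain q' where q': "q' \<in> ending_in (S - {s})" "\<pi> (q * word [s]) = \<pi> q'"
        using absorbs_right_mult[OF ab sB pq(2)] by blast
      have c: "p \<in> tensors B" "q \<in> tensors B" "q' \<in> tensors B"
        using pq(1) lists ending_in_tensors[OF pq(2)] ending_in_tensors[OF q'(1)] by auto
      have "Poly_Mapping.single (u @ [c]) r = Poly_Mapping.single u r * word [s]"
        using True by (simp add: single_mult_single)
      then have "\<pi> (Poly_Mapping.single (u @ [c]) r) = \<pi> ((p + q) * word [s])"
        using presented(4)[OF cr(2) ws] presented(4)[OF tensors_closed(3)[OF c(1,2)] ws] pq(3) by simp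
      also have "\<dots> = \<pi> (p * word [s] + q')"
        unfolding distrib_right using presented(3)[OF tensors_closed(6)[OF c(1) ws] tensors_closed(6)[OF c(2) ws]]
          presented(3)[OF tensors_closed(6)[OF c(1) ws] c(3)] q'(2) by simp
      finally have "\<pi> (Poly_Mapping.single (u @ [c]) r) = \<pi> (p * word [s] + q')" .
      moreover have "Poly_Mapping.keys (p * word [s]) \<subseteq> N'"
        by (rule keys_mult_subset[OF pq(1), of _ "{[s]}"]) (auto intro: N)
      ultimately show ?thesis using q'(1) cr(1) by blast
    qed
  next
    case (add p q)
    then show ?case using sum[of p q] tensors_closed(3)[of p B q] by blast
  qed
  obtain p q where pq: "Poly_Mapping.keys p \<subseteq> NS" "q \<in> ending_in S" "\<pi> t = \<pi> (p + q)" using NS[OF t] by blast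
  have "\<exists>p' q'. Poly_Mapping.keys p' \<subseteq> N' \<and> q' \<in> ending_in (S - {s}) \<and> \<pi> p = \<pi> (p' + q')"
    using pq(1) N(1) ending_in_closed(1) by (intro exI[of _ p] exI[of _ 0]) auto
  moreover have "p \<in> tensors B" using pq(1) N(1) lists by blast
  ultimately show ?thesis using sum[of p q] last[OF pq(2)] pq(3) by simp
qed

text \<open>The functionals prove that \<open>w \<mapsto> w s\<close> sends the words in \<open>W\<close> to linearly independent elements modulo
  the ideal of \<open>S\<close>: \<open>l w\<close> reads off the coefficient of \<open>w s\<close>.\<close>

definition dual_functionals :: "'x list set \<Rightarrow> 'x set \<Rightarrow> 'x \<Rightarrow> ('x list \<Rightarrow> ('x list \<Rightarrow>\<^sub>0 rat) \<Rightarrow> rat) \<Rightarrow> bool" where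
  "dual_functionals W S s l \<longleftrightarrow>
     (\<forall>w. \<forall>p\<in>tensors B. \<forall>q\<in>tensors B. l w (p + q) = l w p + l w q) \<and>
     (\<forall>w. \<forall>p\<in>tensors B. \<forall>c. l w (scale c p) = c * l w p) \<and>
     (\<forall>w\<in>W. \<forall>p\<in>tensors B. \<pi> p = \<zero> \<longrightarrow> l w p = 0) \<and>
     (\<forall>w\<in>W. \<forall>p\<in>ending_in S. l w p = 0) \<and>
     (\<forall>w\<in>W. \<forall>w'\<in>W. l w (word (w' @ [s])) = (if w = w' then 1 else 0))"

text \<open>The letter \<open>s\<close> is the last one of the segment \<open>S\<close>, and \<open>S''\<close> consists of the letters that cannot precede
  \<open>s\<close> in a normal word.\<close>

definition word_step :: "('x set \<Rightarrow> 'x list set) \<Rightarrow> 'x set \<Rightarrow> 'x \<Rightarrow> 'x set \<Rightarrow> bool" where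
  "word_step N S s S'' \<longleftrightarrow> s \<in> S \<and> S \<subseteq> S'' \<and> absorbs S s S'' \<and>
     N S \<subseteq> N (S - {s}) \<and> (\<forall>w\<in>N S''. w @ [s] \<in> N (S - {s})) \<and>
     (\<exists>l. dual_functionals (N S'') (S - {s}) s l)"

text \<open>The induction ends at the full set of letters, modulo which only the constants are left.\<close>

lemma spanning:
  assumes fin: "finite B" and B: "[] \<in> N B" "B \<in> \<F>" and lists: "\<And>S. S \<in> \<F> \<Longrightarrow> S \<subseteq> B \<and> N S \<subseteq> lists B"
    and step: "\<And>S. S \<in> \<F> \<Longrightarrow> S \<noteq> B \<Longrightarrow> \<exists>s S''. insert s S \<in> \<F> \<and> S'' \<in> \<F> \<and> s \<notin> S \<and> word_step N (insert s S) s S''"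
    and S: "S \<in> \<F>" and t: "t \<in> tensors B"
  shows "\<exists>p q. Poly_Mapping.keys p \<subseteq> N S \<and> q \<in> ending_in S \<and> \<pi> t = \<pi> (p + q)"
  using S t
proof (induction "card (B - S)" arbitrary: S t rule: less_induct)
  case less
  show ?case
  proof (cases "S = B")
    case True
    let ?p = "Poly_Mapping.single [] (Poly_Mapping.lookup t [])"
    let ?q = "restrict_poly (- {[]}) t"
    have "t = ?p + ?q"
      by (rule poly_mapping_eqI) (auto simp: lookup_add lookup_restrict_poly lookup_single when_def)
    moreover have "?q \<in> ending_in B"
      using less.prems(2) by (auto simp: ending_in_def keys_restrict_poly)
    moreover have "Poly_Mapping.keys ?p \<subseteq> N B" using B by simp
    ultimately show ?thesis using True by metis
  next
    case False
    obtain s S'' where s: "insert s S \<in> \<F>" "S'' \<in> \<F>" "s \<notin> S" and w: "word_step N (insert s S) s S''"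
      using step[OF less.prems(1) False] by blast
    have sub: "insert s S \<subseteq> B" "S'' \<subseteq> B" "insert s S \<subseteq> S''"
      using lists[OF s(1)] lists[OF s(2)] w by (auto simp: word_step_def)
    have c1: "card (B - insert s S) < card (B - S)" using sub s(3) fin by (intro psubset_card_mono) auto
    have c2: "card (B - S'') < card (B - S)" using sub s(3) fin by (intro psubset_card_mono) auto
    have d: "insert s S - {s} = S" using s(3) by blast
    have w': "absorbs (insert s S) s S''" "N (insert s S) \<subseteq> N S" "\<And>w. w \<in> N S'' \<Longrightarrow> w @ [s] \<in> N S"
      using w unfolding word_step_def d by blast+
    show ?thesis
      by (rule spanning_step[OF w'(1) _ sub(1) w'(2,3) less.hyps[OF c1 s(1)] less.hyps[OF c2 s(2)], unfolded d])
        (use lists[OF less.prems(1)] lists[OF s(2)] less.prems(2) in auto)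
  qed
qed

text \<open>The colon ideal of \<open>S - {s}\<close> by \<open>s\<close> is the ideal of \<open>S''\<close>: modulo the latter an element is a combination
  of normal words \<open>w\<close>, and the functionals recover the coefficients of \<open>w\<close> from the product with \<open>s\<close>.
  This recovery is the splitting \<open>\<rho>\<close>.\<close>

theorem Koszul_if_normal_words:
  assumes fin: "finite B" and B: "[] \<in> N B" "B \<in> \<F>"
    and lists: "\<And>S. S \<in> \<F> \<Longrightarrow> S \<subseteq> B \<and> N S \<subseteq> lists B \<and> finite (N S)"
    and up: "\<And>S. S \<in> \<F> \<Longrightarrow> S \<noteq> B \<Longrightarrow>
      \<exists>s S''. insert s S \<in> \<F> \<and> S'' \<in> \<F> \<and> s \<notin> S \<and> word_step N (insert s S) s S''"
    and down: "\<And>S. S \<in> \<F> \<Longrightarrow> S \<noteq> {} \<Longrightarrow>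
      \<exists>s S''. S - {s} \<in> \<F> \<and> S'' \<in> \<F> \<and> word_step N S s S''"
  shows "Koszul A"
proof -
  have li: "left_ideal (last_letter_ideal S)" for S
    unfolding left_ideal_def
  proof (intro conjI ballI)
    show "last_letter_ideal S \<subseteq> carrier A"
      unfolding last_letter_ideal_def presented(12) using ending_in_tensors by blast
    fix a x assume "a \<in> carrier A" "x \<in> last_letter_ideal S"
    then obtain t p where tp: "t \<in> tensors B" "a = \<pi> t" "p \<in> ending_in S" "x = \<pi> p"
      unfolding last_letter_ideal_def presented(12) by blast
    show "a \<otimes> x \<in> last_letter_ideal S"
      unfolding last_letter_ideal_def tp presented(4)[OF tp(1) ending_in_tensors[OF tp(3)], symmetric]
      by (rule imageI[OF ending_in_closed(5)[OF tp(1,3)]])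
  qed
  have step: "koszul_step (last_letter_ideal (S - {s})) (last_letter_ideal S) (last_letter_ideal S'')"
    if S: "S \<in> \<F>" and S'': "S'' \<in> \<F>" and w: "word_step N S s S''" for S s S''
  proof -
    have sS: "s \<in> S" and ab: "absorbs S s S''" using w by (simp_all add: word_step_def)
    have sB: "s \<in> B" using sS lists[OF S] by blast
    have ws: "word [s] \<in> tensors B" using sB by simp
    obtain l where "dual_functionals (N S'') (S - {s}) s l" using w unfolding word_step_def by blast
    then have l_add: "\<And>w p q. p \<in> tensors B \<Longrightarrow> q \<in> tensors B \<Longrightarrow> l w (p + q) = l w p + l w q"
      and l_scale: "\<And>w p c. p \<in> tensors B \<Longrightarrow> l w (scale c p) = c * l w p"
      and l_ker: "\<And>w p. w \<in> N S'' \<Longrightarrow> p \<in> tensors B \<Longrightarrow> \<pi> p = \<zero> \<Longrightarrow> l w p = 0"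
      and l_end: "\<And>w p. w \<in> N S'' \<Longrightarrow> p \<in> ending_in (S - {s}) \<Longrightarrow> l w p = 0"
      and l_dual: "\<And>w w'. w \<in> N S'' \<Longrightarrow> w' \<in> N S'' \<Longrightarrow> l w (word (w' @ [s])) = (if w = w' then 1 else 0)"
      unfolding dual_functionals_def by simp_all
    have NS: "N S'' \<subseteq> lists B" "finite (N S'')" using lists[OF S''] by simp_all
    \<comment> \<open>only the part of degree \<open>|w| + 1\<close> is fed to the functional of \<open>w\<close>, so that \<open>R\<close> lowers degrees by 1\<close>
    define R where "R t = (\<Sum>w\<in>N S''. Poly_Mapping.single w (l w (component (Suc (length w)) t)))" for t
    have l0: "l w 0 = 0" for w using l_scale[of 0 w 0] tensors_closed(1) by simp
    have R_keys: "Poly_Mapping.keys (R t) \<subseteq> N S''" for t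
      unfolding R_def by (intro keys_sum_subset keys_single_subset)
    have R_t: "R t \<in> tensors B" for t using R_keys NS by blast
    have R_add: "R (p + q) = R p + R q" if "p \<in> tensors B" "q \<in> tensors B" for p q
      using tensors_closed(8)[OF that(1)] tensors_closed(8)[OF that(2)]
      by (simp add: R_def restrict_poly_add l_add single_add sum.distrib)
    have R_scale: "R (scale c p) = scale c (R p)" if "p \<in> tensors B" for p c
    proof -
      have "scale c (sum f F) = (\<Sum>i\<in>F. scale c (f i))" for f :: "'x list \<Rightarrow> 'x list \<Rightarrow>\<^sub>0 rat" and F
        by (induction F rule: infinite_finite_induct) (simp_all add: scale_add)
      then show ?thesis using tensors_closed(8)[OF that] by (simp add: R_def restrict_poly_scale l_scale)
    qed
    have R_ker: "R p = 0" if "p \<in> tensors B" "\<pi> p = \<zero>" for p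
      unfolding R_def
      by (rule sum.neutral) (simp add: l_ker[OF _ tensors_closed(8)[OF that(1)] kernel_graded[OF that]])
    have R_end: "R p = 0" if "p \<in> ending_in (S - {s})" for p
      unfolding R_def by (rule sum.neutral) (simp add: l_end[OF _ ending_in_closed(4)[OF that]])
    have R_cong: "R p = R q" if "p \<in> tensors B" "q \<in> tensors B" "\<pi> p = \<pi> q" for p q
    proof -
      have "R ((p - q) + q) = R (p - q) + R q" by (rule R_add[OF tensors_closed(4)[OF that(1,2)] that(2)])
      then show ?thesis using R_ker[OF tensors_closed(4)[OF that(1,2)] \<pi>_diff_zeroI[OF that]] by simp
    qed
    have R_word: "R (p * word [s]) = p" if "Poly_Mapping.keys p \<subseteq> N S''" for p
    proof -
      have "p \<in> tensors B \<and> R (p * word [s]) = p"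
        using that
      proof (induction p rule: poly_span_induct)
        case zero
        then show ?case using R_ker[of 0] tensors_closed(1) presented(6) by simp
      next
        case (single w c)
        have ws': "word (w @ [s]) \<in> tensors B" using single NS sB by auto
        have "l w' (component (Suc (length w')) (word (w @ [s]))) = (if w' = w then 1 else 0)"
          if "w' \<in> N S''" for w'
          using l_dual[OF that single] by (auto simp: component_single l0)
        then have "R (word (w @ [s])) = (\<Sum>w'\<in>N S''. if w' = w then word w' else 0)"
          unfolding R_def by (intro sum.cong refl) simp
        then have "R (word (w @ [s])) = word w" using single NS by simp
        moreover have "Poly_Mapping.single w c * word [s] = scale c (word (w @ [s]))"
          by (simp add: single_mult_single)
        ultimately show ?case using R_scale[OF ws'] single NS by auto
      next
        case (add p q)
        then show ?case
          using R_add[OF tensors_closed(6)[OF _ ws] tensors_closed(6)[OF _ ws], of p q] tensors_closed(3)[of p B q]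
          by (simp add: distrib_right)
      qed
      then show ?thesis ..
    qed
    define rep where "rep x = (SOME t. t \<in> tensors B \<and> \<pi> t = x)" for x
    have rep: "rep (\<pi> t) \<in> tensors B \<and> \<pi> (rep (\<pi> t)) = \<pi> t" if "t \<in> tensors B" for t
      unfolding rep_def by (rule someI[of _ t]) (simp add: that[unfolded mem_Collect_eq])
    define \<rho> where "\<rho> x = \<pi> (R (rep x))" for x
    have rho: "\<rho> (\<pi> t) = \<pi> (R t)" if "t \<in> tensors B" for t
      using R_cong[of "rep (\<pi> t)" t] rep[OF that] that by (simp add: \<rho>_def)
    have car: "\<exists>t\<in>tensors B. x = \<pi> t" if "x \<in> carrier A" for x using that presented(12) by blast
    show ?thesis
      unfolding koszul_step_def
    proof (rule exI[of _ "\<pi> (word [s])"], rule exI[of _ \<rho>], intro conjI ballI allI)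
      show "\<pi> (word [s]) \<in> grade A 1" unfolding presented(11) using sB by (intro imageI) simp
      show "linear_endo \<rho>"
        unfolding linear_endo_def
      proof (intro conjI ballI allI)
        fix x y c assume x: "x \<in> carrier A" and y: "y \<in> carrier A"
        obtain t u where tu: "t \<in> tensors B" "x = \<pi> t" "u \<in> tensors B" "y = \<pi> u" using car x y by blast
        show "\<rho> (x \<oplus> y) = \<rho> x \<oplus> \<rho> y"
          unfolding tu presented(3)[OF tu(1,3), symmetric] rho[OF tu(1)] rho[OF tu(3)]
            rho[OF tensors_closed(3)[OF tu(1,3)]] R_add[OF tu(1,3)] presented(3)[OF R_t R_t] ..
      next
        fix x c assume x: "x \<in> carrier A"
        obtain t where tu: "t \<in> tensors B" "x = \<pi> t" using car x by blast
        show "\<rho> x \<in> carrier A" unfolding tu rho[OF tu(1)] by (rule presented(2)[OF R_t])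
        show "\<rho> (c \<odot>\<^bsub>A\<^esub> x) = c \<odot>\<^bsub>A\<^esub> \<rho> x"
          unfolding tu presented(10)[OF tu(1)] rho[OF tu(1)] rho[OF tensors_closed(7)[OF tu(1)]] R_scale[OF tu(1)]
            presented(10)[OF R_t] ..
      qed
      show "last_letter_ideal (S - {s}) \<subseteq> last_letter_ideal S"
        unfolding last_letter_ideal_def by (intro image_mono ending_in_mono) blast
      show "\<pi> (word [s]) \<in> last_letter_ideal S"
        unfolding last_letter_ideal_def using ending_in_single[of "[]" s S 1] sB sS by auto
    next
      fix m assume "m \<in> last_letter_ideal S"
      then obtain t where t: "t \<in> ending_in S" "m = \<pi> t" by (auto simp: last_letter_ideal_def)
      have "\<exists>t1\<in>ending_in (S - {s}). \<exists>t2\<in>tensors B. t = t1 + t2 * word [s]"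
        using t(1)
      proof (induction t rule: ending_in_induct)
        case zero
        then show ?case using ending_in_closed(1) tensors_closed(1)
          by (intro bexI[of _ 0]) auto
      next
        case (single u c r)
        show ?case
        proof (cases "c = s")
          case True
          then show ?thesis using single ending_in_closed(1)[of "S - {s}"]
            by (intro bexI[of _ 0] bexI[of _ "Poly_Mapping.single u r"]) (auto simp: single_mult_single)
        next
          case False
          then show ?thesis using single ending_in_single[of u c "S - {s}" r] tensors_closed(1)
            by (intro bexI[of _ "Poly_Mapping.single (u @ [c]) r"] bexI[of _ 0]) auto
        qed
      next
        case (add p q)
        then obtain p1 p2 q1 q2 where pq: "p1 \<in> ending_in (S - {s})" "p2 \<in> tensors B" "p = p1 + p2 * word [s]"
          "q1 \<in> ending_in (S - {s})" "q2 \<in> tensors B" "q = q1 + q2 * word [s]" by blast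
        have "p + q = (p1 + q1) + (p2 + q2) * word [s]" by (simp add: pq distrib_right)
        then show ?case using ending_in_closed(2)[OF pq(1,4)] tensors_closed(3)[OF pq(2,5)] by blast
      qed
      then obtain t1 t2 where tt: "t1 \<in> ending_in (S - {s})" "t2 \<in> tensors B" "t = t1 + t2 * word [s]" by blast
      have "m = \<pi> t1 \<oplus> \<pi> t2 \<otimes> \<pi> (word [s])"
        unfolding t(2) tt(3) presented(3)[OF ending_in_tensors[OF tt(1)] tensors_closed(6)[OF tt(2) ws]] presented(4)[OF tt(2) ws] ..
      moreover have "\<pi> t1 \<in> last_letter_ideal (S - {s})" using tt(1) by (simp add: last_letter_ideal_def)
      ultimately show "\<exists>y\<in>last_letter_ideal (S - {s}). \<exists>a\<in>carrier A. m = y \<oplus> a \<otimes> \<pi> (word [s])"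
        using presented(2)[OF tt(2)] by blast
    next
      fix a assume "a \<in> last_letter_ideal S''"
      then obtain q where q: "q \<in> ending_in S''" "a = \<pi> q" by (auto simp: last_letter_ideal_def)
      show "a \<otimes> \<pi> (word [s]) \<in> last_letter_ideal (S - {s})"
        unfolding q(2) presented(4)[OF ending_in_tensors[OF q(1)] ws, symmetric] last_letter_ideal_def
        using absorbs_right_mult[OF ab sB q(1)] by auto
    next
      fix m assume "m \<in> grade A 0"
      then obtain p where p: "Poly_Mapping.keys p \<subseteq> {w \<in> lists B. length w = 0}" "m = \<pi> p" using presented(11) by blast
      then have pt: "p \<in> tensors B" by auto
      have "component (Suc n) p = 0" for n using p(1) by (intro restrict_poly_none) auto
      then have "R p = 0" by (simp add: R_def l0)
      then show "\<rho> m = \<zero>" unfolding p(2) rho[OF pt] using presented(6) by simp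
    next
      fix d m assume "m \<in> grade A (Suc d)"
      then obtain p where p: "Poly_Mapping.keys p \<subseteq> {w \<in> lists B. length w = Suc d}" "m = \<pi> p" using presented(11) by blast
      then have pt: "p \<in> tensors B" by auto
      have "component n p = 0" if "n \<noteq> Suc d" for n using p(1) that by (intro restrict_poly_none) auto
      then have "Poly_Mapping.keys (Poly_Mapping.single w (l w (component (Suc (length w)) p))) \<subseteq> {w \<in> lists B. length w = d}"
        if "w \<in> N S''" for w
        using that NS by (cases "length w = d") (auto simp: l0)
      then have "Poly_Mapping.keys (R p) \<subseteq> {w \<in> lists B. length w = d}"
        unfolding R_def by (rule keys_sum_subset)
      then show "\<rho> m \<in> grade A d" unfolding p(2) rho[OF pt] presented(11) by blast
    next
      fix m assume "m \<in> last_letter_ideal (S - {s})"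
      then obtain q where q: "q \<in> ending_in (S - {s})" "m = \<pi> q" by (auto simp: last_letter_ideal_def)
      show "\<rho> m \<in> last_letter_ideal S''"
        unfolding q(2) rho[OF ending_in_tensors[OF q(1)]] R_end[OF q(1)] last_letter_ideal_def
        by (rule imageI[OF ending_in_closed(1)])
    next
      fix m assume "m \<in> carrier A"
      then obtain t where t: "t \<in> tensors B" "m = \<pi> t" using car by blast
      obtain p q where pq: "Poly_Mapping.keys p \<subseteq> N S''" "q \<in> ending_in S''" "\<pi> t = \<pi> (p + q)"
        using spanning[of N \<F> S'' t, OF fin B] lists up S'' t(1) by blast
      obtain q' where q': "q' \<in> ending_in (S - {s})" "\<pi> (q * word [s]) = \<pi> q'"
        using absorbs_right_mult[OF ab sB pq(2)] by blast
      have pt: "p \<in> tensors B" using pq(1) NS by blast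
      note qt = ending_in_tensors[OF pq(2)] and qt' = ending_in_tensors[OF q'(1)]
      note c = tensors_closed(6)[OF pt ws] tensors_closed(6)[OF qt ws]
      have "m \<otimes> \<pi> (word [s]) = \<pi> ((p + q) * word [s])"
        unfolding t(2) pq(3) presented(4)[OF tensors_closed(3)[OF pt qt] ws] ..
      also have "\<dots> = \<pi> (p * word [s] + q')"
        unfolding distrib_right presented(3)[OF c] presented(3)[OF c(1) qt'] q'(2) ..
      finally have "\<rho> (m \<otimes> \<pi> (word [s])) = \<pi> p"
        using rho[OF tensors_closed(3)[OF c(1) qt']] R_add[OF c(1) qt'] R_word[OF pq(1)] R_end[OF q'(1)] by simp
      then have "\<rho> (m \<otimes> \<pi> (word [s])) \<ominus> m = \<pi> (p - (p + q))"
        unfolding t(2) pq(3) presented(8)[OF pt tensors_closed(3)[OF pt qt]] by simp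
      also have "p - (p + q) = - q" by simp
      finally show "\<rho> (m \<otimes> \<pi> (word [s])) \<ominus> m \<in> last_letter_ideal S''"
        unfolding last_letter_ideal_def using ending_in_closed(3)[OF pq(2)] by simp
    qed
  qed
  have filt: "koszul_filtration \<F> card last_letter_ideal"
    unfolding koszul_filtration_def
  proof (intro conjI ballI)
    fix S assume S: "S \<in> \<F>"
    show "last_letter_ideal S \<subseteq> {\<zero>} \<or>
      (\<exists>j\<in>\<F>. \<exists>k\<in>\<F>. card j < card S \<and> koszul_step (last_letter_ideal j) (last_letter_ideal S) (last_letter_ideal k))"
    proof (cases "S = {}")
      case True
      have "ending_in {} = {0}" by (auto simp: ending_in_def)
      then show ?thesis using True presented(6) by (simp add: last_letter_ideal_def)
    next
      case False
      obtain s S'' where s: "S - {s} \<in> \<F>" "S'' \<in> \<F>" "word_step N S s S''" using down[OF S False] by blast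
      have "finite S" "s \<in> S" using lists[OF S] fin s(3) finite_subset by (auto simp: word_step_def)
      then have "card (S - {s}) < card S" by (rule card_Diff1_less)
      then show ?thesis using step[OF S s(2,3)] s(1,2) by blast
    qed
  qed (rule li)
  have "last_letter_ideal B = {x \<in> carrier A. augmentation A x = 0}"
  proof (intro Set.set_eqI iffI)
    fix x assume "x \<in> last_letter_ideal B"
    then obtain q where q: "q \<in> ending_in B" "x = \<pi> q" by (auto simp: last_letter_ideal_def)
    have "Poly_Mapping.lookup q [] = 0" using q(1) by (auto simp: ending_in_def in_keys_iff)
    then show "x \<in> {x \<in> carrier A. augmentation A x = 0}"
      using ending_in_tensors[OF q(1)] augmentation_\<pi> presented(2) q(2) by simp
  next
    fix x assume x: "x \<in> {x \<in> carrier A. augmentation A x = 0}"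
    then obtain t where t: "t \<in> tensors B" "x = \<pi> t" using presented(12) by blast
    then have "Poly_Mapping.lookup t [] = 0" using x augmentation_\<pi>[OF t(1)] by simp
    then have "w \<noteq> []" if "w \<in> Poly_Mapping.keys t" for w using that by (auto simp: in_keys_iff)
    then have "t \<in> ending_in B" using t(1) by (auto simp: ending_in_def)
    then show "x \<in> last_letter_ideal B" using t(2) by (simp add: last_letter_ideal_def)
  qed
  from Koszul_if_filtration[OF filt B(2) this] show "Koszul A" .
qed

end

section \<open>A Fock space representation\<close>

subsection \<open>Actions of the free algebra on functions\<close>

text \<open>A right action of the free algebra.  Acting on functions of states rather than on combinations of
  states makes the composition of a functional with an operator again a function, and no finiteness
  has to be checked.\<close>

locale linear_action =
  fixes act :: "'x \<Rightarrow> ('s \<Rightarrow> rat) \<Rightarrow> 's \<Rightarrow> rat"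
  assumes act_linear: "act c (\<lambda>\<sigma>. a * f \<sigma> + f' \<sigma>) = (\<lambda>\<sigma>. a * act c f \<sigma> + act c f' \<sigma>)"
begin

definition word_act :: "'x list \<Rightarrow> ('s \<Rightarrow> rat) \<Rightarrow> 's \<Rightarrow> rat" where
  "word_act w f = foldl (\<lambda>f c. act c f) f w"

definition poly_act :: "('x list \<Rightarrow>\<^sub>0 rat) \<Rightarrow> ('s \<Rightarrow> rat) \<Rightarrow> 's \<Rightarrow> rat" where
  "poly_act t f \<sigma> = (\<Sum>w\<in>Poly_Mapping.keys t. Poly_Mapping.lookup t w * word_act w f \<sigma>)"

lemma word_act_simps [simp]:
  "word_act [] f = f" "word_act (c # w) f = word_act w (act c f)" "word_act (u @ w) f = word_act w (word_act u f)"
  by (simp_all add: word_act_def)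

lemma word_act_linear: "word_act w (\<lambda>\<sigma>. a * f \<sigma> + f' \<sigma>) = (\<lambda>\<sigma>. a * word_act w f \<sigma> + word_act w f' \<sigma>)"
  by (induction w arbitrary: f f') (simp_all add: act_linear)

lemma word_act_scale: "word_act w (\<lambda>\<sigma>. a * f \<sigma>) = (\<lambda>\<sigma>. a * word_act w f \<sigma>)"
proof -
  have z: "word_act w (\<lambda>\<sigma>. 0) = (\<lambda>\<sigma>. 0)"
    using word_act_linear[of w "-1" "\<lambda>\<sigma>. 0" "\<lambda>\<sigma>. 0"] by (simp add: fun_eq_iff)
  show ?thesis using word_act_linear[of w a f "\<lambda>\<sigma>. 0"] unfolding z by simp
qed

lemma poly_act_superset:
  assumes "finite W" "Poly_Mapping.keys t \<subseteq> W"
  shows "poly_act t f \<sigma> = (\<Sum>w\<in>W. Poly_Mapping.lookup t w * word_act w f \<sigma>)"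
  unfolding poly_act_def using assms by (intro sum.mono_neutral_left) (auto simp: in_keys_iff)

lemma poly_act_add: "poly_act (p + q) f = (\<lambda>\<sigma>. poly_act p f \<sigma> + poly_act q f \<sigma>)"
proof
  fix \<sigma>
  let ?W = "Poly_Mapping.keys p \<union> Poly_Mapping.keys q"
  show "poly_act (p + q) f \<sigma> = poly_act p f \<sigma> + poly_act q f \<sigma>"
    using poly_act_superset[of ?W p] poly_act_superset[of ?W q] poly_act_superset[of ?W "p + q"] keys_add[of p q]
    by (simp add: lookup_add distrib_right sum.distrib)
qed

lemma poly_act_single: "poly_act (Poly_Mapping.single w r) f = (\<lambda>\<sigma>. r * word_act w f \<sigma>)"
  by (rule ext) (simp add: poly_act_superset[of "{w}"])

lemma poly_act_zero: "poly_act 0 f = (\<lambda>\<sigma>. 0)"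
  by (rule ext) (simp add: poly_act_def)

lemma poly_act_one: "poly_act 1 f = f"
  using poly_act_single[of "[]" 1 f] by (simp add: zero_list_def flip: single_one)

lemma poly_act_scale: "poly_act (scale c p) f = (\<lambda>\<sigma>. c * poly_act p f \<sigma>)"
proof
  fix \<sigma>
  have "Poly_Mapping.keys (scale c p) \<subseteq> Poly_Mapping.keys p" by (rule keys_scale_subset) simp
  then show "poly_act (scale c p) f \<sigma> = c * poly_act p f \<sigma>"
    by (simp add: poly_act_superset[of "Poly_Mapping.keys p"] sum_distrib_left mult.assoc)
qed

lemma poly_act_diff: "poly_act (p - q) f = (\<lambda>\<sigma>. poly_act p f \<sigma> - poly_act q f \<sigma>)"
proof -
  have e: "p - q = p + scale (-1) q" by (rule poly_mapping_eqI) (simp add: lookup_minus lookup_add)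
  show ?thesis unfolding e poly_act_add poly_act_scale by simp
qed

lemma poly_act_linear: "poly_act t (\<lambda>\<sigma>. a * f \<sigma> + f' \<sigma>) = (\<lambda>\<sigma>. a * poly_act t f \<sigma> + poly_act t f' \<sigma>)"
  by (rule ext) (simp add: poly_act_def word_act_linear distrib_left sum.distrib sum_distrib_left mult.left_commute)

lemma poly_act_mult: "poly_act (p * q) f = poly_act q (poly_act p f)"
proof -
  have U: "Poly_Mapping.keys p \<subseteq> UNIV" "Poly_Mapping.keys q \<subseteq> UNIV" by simp_all
  have add: "poly_act q (\<lambda>\<sigma>. f \<sigma> + f' \<sigma>) = (\<lambda>\<sigma>. poly_act q f \<sigma> + poly_act q f' \<sigma>)" for q f f'
    using poly_act_linear[of q 1 f f'] by simp
  have zero: "poly_act q (\<lambda>\<sigma>. 0) = (\<lambda>\<sigma>. 0)" for q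
    using poly_act_linear[of q "-1" "\<lambda>\<sigma>. 0" "\<lambda>\<sigma>. 0"] by (simp add: fun_eq_iff)
  from U(1) show ?thesis
  proof (induction p rule: poly_span_induct)
    case (single u r)
    from U(2) show ?case
    proof (induction q rule: poly_span_induct)
      case (single w s)
      then show ?case by (simp add: single_mult_single poly_act_single word_act_scale mult_ac)
    qed (simp_all add: poly_act_zero distrib_left poly_act_add)
  qed (simp_all add: poly_act_zero zero distrib_right poly_act_add add)
qed

lemma annihilator_ideal: "two_sided_ideal B {t \<in> tensors B. \<forall>f. poly_act t f = (\<lambda>\<sigma>. 0)}"
proof -
  have zero: "poly_act q (\<lambda>\<sigma>. 0) = (\<lambda>\<sigma>. 0)" for q
    using poly_act_linear[of q "-1" "\<lambda>\<sigma>. 0" "\<lambda>\<sigma>. 0"] by (simp add: fun_eq_iff)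
  show ?thesis
    unfolding two_sided_ideal_def
  proof (intro conjI)
    show "{t \<in> tensors B. \<forall>f. poly_act t f = (\<lambda>\<sigma>. 0)} \<subseteq> tensors B" by blast
  qed (use tensors_closed(4,6)[where B = B] zero in
      \<open>auto simp: poly_act_zero poly_act_diff poly_act_mult del: subsetI\<close>)
qed

lemma act_scale: "act c (\<lambda>\<sigma>. a * f \<sigma>) = (\<lambda>\<sigma>. a * act c f \<sigma>)"
  using word_act_scale[of "[c]" a f] by simp

lemma move_letter:
  assumes anti: "\<And>c d f. c \<in> S \<Longrightarrow> d \<in> S \<Longrightarrow> act c (act d f) = (\<lambda>\<sigma>. - act d (act c f) \<sigma>)"
    and "c \<in> S" "set m \<subseteq> S"
  shows "word_act (c # m) f = (\<lambda>\<sigma>. (-1) ^ length m * act c (word_act m f) \<sigma>)"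
  using assms(3)
proof (induction m arbitrary: f)
  case (Cons d m)
  have "word_act (c # d # m) f = word_act m (\<lambda>\<sigma>. -1 * act c (act d f) \<sigma>)"
    using anti[of d c f] Cons.prems assms(2) by simp
  also have "\<dots> = (\<lambda>\<sigma>. -1 * word_act (c # m) (act d f) \<sigma>)" unfolding word_act_scale by simp
  also have "\<dots> = (\<lambda>\<sigma>. (-1) ^ length (d # m) * act c (word_act (d # m) f) \<sigma>)"
    using Cons.prems by (subst Cons.IH) simp_all
  finally show ?case .
qed simp

lemma split_at_two:
  assumes "i < k" "k < length ws"
  shows "take k ws = take i ws @ ws ! i # take (k - Suc i) (drop (Suc i) ws)"
    and "drop (Suc i) ws = take (k - Suc i) (drop (Suc i) ws) @ ws ! k # drop (Suc k) ws"
proof -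
  have "take k ws = take i (take k ws) @ (take k ws) ! i # drop (Suc i) (take k ws)"
    using assms by (intro id_take_nth_drop) simp
  then show "take k ws = take i ws @ ws ! i # take (k - Suc i) (drop (Suc i) ws)"
    using assms by (simp add: drop_take min_def)
  have "drop (Suc i) ws = take (k - Suc i) (drop (Suc i) ws) @ (drop (Suc i) ws) ! (k - Suc i) # drop (Suc (k - Suc i)) (drop (Suc i) ws)"
    using assms by (intro id_take_nth_drop) simp
  then show "drop (Suc i) ws = take (k - Suc i) (drop (Suc i) ws) @ ws ! k # drop (Suc k) ws"
    using assms by simp
qed

lemma repeated_letter_zero:
  assumes anti: "\<And>c d f. c \<in> set ws \<Longrightarrow> d \<in> set ws \<Longrightarrow> act c (act d f) = (\<lambda>\<sigma>. - act d (act c f) \<sigma>)"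
    and ik: "i < k" "k < length ws" and eq: "act (ws ! i) = act (ws ! k)"
  shows "word_act ws f = (\<lambda>\<sigma>. 0)"
proof -
  let ?m = "take (k - Suc i) (drop (Suc i) ws)" and ?c = "ws ! i" and ?w = "drop (Suc k) ws"
  let ?h = "word_act (take i ws) f"
  have "ws = take k ws @ ws ! k # ?w" using ik by (intro id_take_nth_drop)
  then have ws: "ws = take i ws @ ?c # ?m @ ws ! k # ?w" using split_at_two(1)[OF ik] by simp
  have c: "?c \<in> set ws" using ik by simp
  have m: "set ?m \<subseteq> set ws" by (auto dest: in_set_takeD in_set_dropD)
  have mv: "word_act (?c # ?m) h = (\<lambda>\<sigma>. (-1) ^ length ?m * act ?c (word_act ?m h) \<sigma>)" for h
    by (rule move_letter[OF _ c m]) (rule anti)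
  have sq: "act ?c (act ?c h) = (\<lambda>\<sigma>. 0)" for h using anti[OF c c, of h] by (simp add: fun_eq_iff)
  have "word_act ws f = word_act ?w (act (ws ! k) (word_act (?c # ?m) ?h))"
    by (subst ws) simp
  also have "act (ws ! k) (word_act (?c # ?m) ?h) = (\<lambda>\<sigma>. (-1) ^ length ?m * act ?c (act ?c (word_act ?m ?h)) \<sigma>)"
    unfolding mv eq[symmetric] act_scale by simp
  also have "\<dots> = (\<lambda>\<sigma>. 0)" unfolding sq by simp
  also have "word_act ?w (\<lambda>\<sigma>. 0) = (\<lambda>\<sigma>. 0)" using word_act_scale[of ?w 0 "\<lambda>\<sigma>. 0"] by simp
  finally show ?thesis .
qed

text \<open>All terms of the boundary that keep both equal letters vanish, and the other two cancel.\<close>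

lemma boundary_zero:
  assumes anti: "\<And>c d f. c \<in> set ws \<Longrightarrow> d \<in> set ws \<Longrightarrow> act c (act d f) = (\<lambda>\<sigma>. - act d (act c f) \<sigma>)"
    and ik: "i < k" "k < length ws" and eq: "act (ws ! i) = act (ws ! k)"
  shows "(\<Sum>j<length ws. (-1) ^ Suc j * word_act (take j ws @ drop (Suc j) ws) f \<sigma>) = 0"
proof -
  let ?m = "take (k - Suc i) (drop (Suc i) ws)" and ?c = "ws ! i" and ?w = "drop (Suc k) ws"
  let ?h = "word_act (take i ws) f"
  let ?t = "\<lambda>j. (-1) ^ Suc j * word_act (take j ws @ drop (Suc j) ws) f \<sigma>"
  have c: "?c \<in> set ws" using ik by simp
  have m: "set ?m \<subseteq> set ws" by (auto dest: in_set_takeD in_set_dropD)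
  have mv: "word_act (?c # ?m) h = (\<lambda>\<sigma>. (-1) ^ length ?m * act ?c (word_act ?m h) \<sigma>)" for h
    by (rule move_letter[OF _ c m]) (rule anti)
  have zero: "?t j = 0" if "j < length ws" "j \<noteq> i" "j \<noteq> k" for j
  proof -
    let ?u = "take j ws @ drop (Suc j) ws"
    let ?i = "if i < j then i else i - 1" and ?k = "if k < j then k else k - 1"
    have nth: "?u ! a = (if a < j then ws ! a else ws ! Suc a)" if "Suc a < length ws" for a
      using that \<open>j < length ws\<close> by (auto simp: nth_append min_def)
    have "word_act ?u f = (\<lambda>\<sigma>. 0)"
    proof (rule repeated_letter_zero)
      show "act c (act d f) = (\<lambda>\<sigma>. - act d (act c f) \<sigma>)" if "c \<in> set ?u" "d \<in> set ?u" for c d f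
        using that by (intro anti) (auto dest: in_set_takeD in_set_dropD)
      show "?i < ?k" "?k < length ?u" using that ik by auto
      show "act (?u ! ?i) = act (?u ! ?k)" using that ik eq by (subst (1 2) nth) auto
    qed
    then show ?thesis by simp
  qed
  have "sum ?t {..<length ws} = sum ?t {i, k}"
    using ik zero by (intro sum.mono_neutral_right) auto
  also have "\<dots> = ?t i + ?t k" using ik by simp
  also have "word_act (take k ws @ ?w) f = word_act ?w (word_act (?c # ?m) ?h)"
    unfolding split_at_two(1)[OF ik] by simp
  also have "\<dots> = (\<lambda>\<sigma>. (-1) ^ length ?m * word_act ?w (act ?c (word_act ?m ?h)) \<sigma>)"
    unfolding mv word_act_scale by simp
  also have "word_act ?w (act ?c (word_act ?m ?h)) = word_act (take i ws @ drop (Suc i) ws) f"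
    by (subst split_at_two(2)[OF ik]) (simp add: eq)
  also have "length ?m = k - Suc i" using ik by simp
  also have "(-1) ^ Suc k * ((-1) ^ (k - Suc i) * x) = - ((-1) ^ Suc i * x)" for x :: rat
  proof -
    obtain d where "k = Suc (i + d)" using ik(1) less_imp_Suc_add by blast
    then show ?thesis by (cases "even i"; cases "even d") simp_all
  qed
  finally show ?thesis by simp
qed

end

subsection \<open>Fermionic operators\<close>

text \<open>
  The state of one vertex is a basis element of the fibre algebra: 1, \<open>x\<^sup>i\<close>, \<open>y\<^sup>i\<close>, the top class
  \<open>y\<^sup>1x\<^sup>1\<close>, or an edge to the vertex with the given number.  A state of the Fock space records one
  of these for each vertex.
\<close>

datatype fibre = Unit | FX nat | FY nat | FTop | FEdge nat

type_synonym state = "nat \<Rightarrow> fibre"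

fun fibre_degree :: "fibre \<Rightarrow> nat" where
  "fibre_degree Unit = 0" | "fibre_degree FTop = 2" | "fibre_degree _ = 1"

fun fibre_coeff :: "fibre \<Rightarrow> fibre \<Rightarrow> rat" where
  "fibre_coeff k Unit = 1"
| "fibre_coeff (FX i) (FY j) = (if i = j then -1 else 0)"
| "fibre_coeff (FY i) (FX j) = (if i = j then 1 else 0)"
| "fibre_coeff _ _ = 0"

fun fibre_next :: "fibre \<Rightarrow> fibre \<Rightarrow> fibre" where
  "fibre_next k Unit = k" | "fibre_next k _ = FTop"

text \<open>The Jordan--Wigner sign counts the degrees at the larger vertices, so operators at different
  vertices anticommute.  The operators are transposed: they act on functions of states.\<close>

definition jw_sign :: "nat \<Rightarrow> nat \<Rightarrow> state \<Rightarrow> rat" where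
  "jw_sign N z \<sigma> = (-1) ^ (\<Sum>u\<in>{z<..<N}. fibre_degree (\<sigma> u))"

definition fock_op :: "nat \<Rightarrow> fibre \<Rightarrow> nat \<Rightarrow> (state \<Rightarrow> rat) \<Rightarrow> state \<Rightarrow> rat" where
  "fock_op N k z f \<sigma> = jw_sign N z \<sigma> * fibre_coeff k (\<sigma> z) * f (\<sigma>(z := fibre_next k (\<sigma> z)))"

definition one_particle :: "fibre \<Rightarrow> bool" where
  "one_particle k \<longleftrightarrow> fibre_degree k = 1"

lemma fibre_degree_next:
  assumes "one_particle k" "fibre_coeff k l \<noteq> 0"
  shows "fibre_degree (fibre_next k l) = Suc (fibre_degree l)"
  using assms by (cases k; cases l) (auto simp: one_particle_def)

lemma jw_sign_update_le: "u \<le> z \<Longrightarrow> jw_sign N z (\<sigma>(u := l)) = jw_sign N z \<sigma>"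
  unfolding jw_sign_def by (intro arg_cong[of _ _ "(^) (-1)"] sum.cong) auto

lemma jw_sign_update_gt:
  assumes "z < u" "u < N" "fibre_degree l = Suc (fibre_degree (\<sigma> u))"
  shows "jw_sign N z (\<sigma>(u := l)) = - jw_sign N z \<sigma>"
proof -
  have s: "{z<..<N} = insert u ({z<..<N} - {u})" using assms by auto
  have "(\<Sum>v\<in>{z<..<N} - {u}. fibre_degree ((\<sigma>(u := l)) v)) = (\<Sum>v\<in>{z<..<N} - {u}. fibre_degree (\<sigma> v))"
    by (intro sum.cong) auto
  then have "(\<Sum>v\<in>{z<..<N}. fibre_degree ((\<sigma>(u := l)) v)) = Suc (\<Sum>v\<in>{z<..<N}. fibre_degree (\<sigma> v))"
    using assms(3) by (subst s, subst (2) s) (simp add: sum.insert_remove)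
  then show ?thesis by (simp add: jw_sign_def)
qed

lemma jw_sign_square: "jw_sign N z \<sigma> * jw_sign N z \<sigma> = 1"
  by (simp add: jw_sign_def flip: power_add mult_2)

lemma fock_op_same_vertex:
  "fock_op N k z (fock_op N k' z f) \<sigma> =
     fibre_coeff k (\<sigma> z) * fibre_coeff k' (fibre_next k (\<sigma> z)) * f (\<sigma>(z := fibre_next k' (fibre_next k (\<sigma> z))))"
proof -
  have "fock_op N k z (fock_op N k' z f) \<sigma> = (jw_sign N z \<sigma> * jw_sign N z \<sigma>) *
     (fibre_coeff k (\<sigma> z) * fibre_coeff k' (fibre_next k (\<sigma> z)) * f (\<sigma>(z := fibre_next k' (fibre_next k (\<sigma> z)))))"
    by (simp add: fock_op_def jw_sign_update_le)
  then show ?thesis unfolding jw_sign_square by simp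
qed

lemma fibre_coeff_anti:
  assumes "one_particle k" "one_particle k'"
  shows "fibre_coeff k l * fibre_coeff k' (fibre_next k l) = - (fibre_coeff k' l * fibre_coeff k (fibre_next k' l))"
    and "fibre_coeff k l * fibre_coeff k' (fibre_next k l) \<noteq> 0 \<Longrightarrow>
      fibre_next k' (fibre_next k l) = fibre_next k (fibre_next k' l)"
  using assms by (cases k; cases k'; cases l; auto simp: one_particle_def)+

lemma fock_op_anticommute_lt:
  assumes "one_particle k" "one_particle k'" "z < z'" "z' < N"
  shows "fock_op N k z (fock_op N k' z' f) \<sigma> = - fock_op N k' z' (fock_op N k z f) \<sigma>"
proof (cases "fibre_coeff k' (\<sigma> z') = 0")
  case False
  then have "jw_sign N z (\<sigma>(z' := fibre_next k' (\<sigma> z'))) = - jw_sign N z \<sigma>"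
    using assms by (intro jw_sign_update_gt fibre_degree_next) auto
  moreover have "jw_sign N z' (\<sigma>(z := fibre_next k (\<sigma> z))) = jw_sign N z' \<sigma>"
    using assms by (intro jw_sign_update_le) simp
  moreover have "\<sigma>(z := a, z' := b) = \<sigma>(z' := b, z := a)" for a b using assms(3) by auto
  ultimately show ?thesis using assms(3) by (simp add: fock_op_def)
qed (use assms in \<open>simp add: fock_op_def\<close>)

lemma fock_op_anticommute:
  assumes "one_particle k" "one_particle k'" "z < N" "z' < N"
  shows "fock_op N k z (fock_op N k' z' f) \<sigma> = - fock_op N k' z' (fock_op N k z f) \<sigma>"
proof (cases z z' rule: linorder_cases)
  case less
  then show ?thesis using assms by (intro fock_op_anticommute_lt)
next
  case greater
  then show ?thesis using fock_op_anticommute_lt[OF assms(2,1) greater assms(3), of f \<sigma>] by simp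
next
  case equal
  show ?thesis
  proof (cases "fibre_coeff k (\<sigma> z') * fibre_coeff k' (fibre_next k (\<sigma> z')) = 0")
    case True
    then have T: "fibre_coeff k' (\<sigma> z') * fibre_coeff k (fibre_next k' (\<sigma> z')) = 0"
      using fibre_coeff_anti(1)[OF assms(1,2), of "\<sigma> z'"] by simp
    show ?thesis unfolding equal fock_op_same_vertex True T by simp
  next
    case False
    then show ?thesis unfolding equal fock_op_same_vertex
      using fibre_coeff_anti[OF assms(1,2), of "\<sigma> z'"] by simp
  qed
qed

subsection \<open>Forests\<close>

text \<open>A forest is given by a parent function \<open>p\<close>; a vertex with \<open>p v \<ge> v\<close> is a root.
  \<open>climb p \<tau> v\<close> goes up from \<open>v\<close>, but never leaves a vertex below the threshold \<open>\<tau>\<close>.\<close>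

function climb :: "(nat \<Rightarrow> nat) \<Rightarrow> nat \<Rightarrow> nat \<Rightarrow> nat" where
  "climb p \<tau> v = (if \<tau> \<le> v \<and> p v < v then climb p \<tau> (p v) else v)"
  by auto
termination by (relation "Wellfounded.measure (\<lambda>(p, \<tau>, v). v)") auto

declare climb.simps [simp del]

text \<open>Two vertices climb, always the larger one; the label is the vertex whose move makes them meet.\<close>

function meet_label :: "(nat \<Rightarrow> nat) \<Rightarrow> nat \<Rightarrow> nat \<Rightarrow> nat option" where
  "meet_label p u v = (if u = v then None
     else if u < v then (if p v < v then (if p v = u then Some v else meet_label p u (p v)) else None)
     else (if p u < u then (if p u = v then Some u else meet_label p (p u) v) else None))"
  by auto
termination by (relation "Wellfounded.measure (\<lambda>(p, u, v). u + v)") auto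

declare meet_label.simps [simp del]

lemma climb_le: "climb p \<tau> v \<le> v"
proof (induction v rule: less_induct)
  case (less v)
  have "climb p \<tau> (p v) \<le> v" if "p v < v" using less[OF that] that by simp
  then show ?case by (subst climb.simps) simp
qed

lemma meet_label_le: "meet_label p u v = Some z \<Longrightarrow> z \<le> max u v"
proof (induction p u v rule: meet_label.induct)
  case (1 p u v)
  show ?case using 1(3) by (subst (asm) meet_label.simps)
    (use 1(1,2) in \<open>fastforce split: if_splits simp: max_def\<close>)
qed

text \<open>For each threshold \<open>\<tau>\<close>, having the same image under \<open>climb p \<tau>\<close> is an equivalence relation; this is the
  ultrametric property of the labels.\<close>

lemma climb_eq_iff:
  "u \<noteq> v \<Longrightarrow> climb p \<tau> u = climb p \<tau> v \<longleftrightarrow> (\<exists>z. meet_label p u v = Some z \<and> \<tau> \<le> z)"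
proof (induction p u v rule: meet_label.induct)
  case (1 p u v)
  have *: "climb p \<tau> u = climb p \<tau> v \<longleftrightarrow> (\<exists>z. m = Some z \<and> \<tau> \<le> z)"
    if "u < v" and m: "m = (if p v < v then if p v = u then Some v else l else None)"
      and l: "p v < v \<Longrightarrow> p v \<noteq> u \<Longrightarrow> climb p \<tau> u = climb p \<tau> (p v) \<longleftrightarrow> (\<exists>z. l = Some z \<and> \<tau> \<le> z)"
      and lt: "\<And>z. p v < v \<Longrightarrow> l = Some z \<Longrightarrow> z < v"
    for u v l m
  proof (cases "\<tau> \<le> v \<and> p v < v")
    case True
    then have "climb p \<tau> v = climb p \<tau> (p v)" by (subst climb.simps) simp
    then show ?thesis using True m l by auto
  next
    case False
    then have "climb p \<tau> v = v" by (subst climb.simps) auto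
    then have "climb p \<tau> u \<noteq> climb p \<tau> v" using climb_le[of p \<tau> u] that(1) by simp
    moreover have "\<not> \<tau> \<le> z" if "m = Some z" for z
      using False m lt[of z] that by (auto split: if_splits)
    ultimately show ?thesis by blast
  qed
  show ?case
  proof (cases u v rule: linorder_cases)
    case less
    show ?thesis
    proof (rule *[OF less, of _ "meet_label p u (p v)"])
      show "meet_label p u v = (if p v < v then if p v = u then Some v else meet_label p u (p v) else None)"
        using less by (subst meet_label.simps) simp
      show "z < v" if "p v < v" "meet_label p u (p v) = Some z" for z
        using meet_label_le[OF that(2)] that(1) less by simp
    qed (use 1(1) less in auto)
  next
    case greater
    have "climb p \<tau> v = climb p \<tau> u \<longleftrightarrow> (\<exists>z. meet_label p u v = Some z \<and> \<tau> \<le> z)"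
    proof (rule *[OF greater, of _ "meet_label p (p u) v"])
      show "meet_label p u v = (if p u < u then if p u = v then Some u else meet_label p (p u) v else None)"
        using greater by (subst meet_label.simps) simp
      show "z < u" if "p u < u" "meet_label p (p u) v = Some z" for z
        using meet_label_le[OF that(2)] that(1) greater by simp
      show "climb p \<tau> v = climb p \<tau> (p u) \<longleftrightarrow> (\<exists>z. meet_label p (p u) v = Some z \<and> \<tau> \<le> z)"
        if "p u < u" "p u \<noteq> v" using 1(2) greater that by auto
    qed
    then show ?thesis by auto
  qed (use 1 in simp)
qed

text \<open>On a cycle the smallest label is attained by two edges: otherwise climbing to just above it would
  identify the ends of all edges but one.\<close>

lemma cyclic_shift_eq:
  fixes f :: "nat \<Rightarrow> 'b"
  assumes "i < n" "\<And>k. k < n \<Longrightarrow> k \<noteq> i \<Longrightarrow> f k = f (Suc k mod n)"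
  shows "f i = f (Suc i mod n)"
proof -
  have "f ((Suc i + t) mod n) = f (Suc i mod n)" if "t < n" for t
    using that
  proof (induction t)
    case (Suc t)
    have "(Suc i + t) mod n \<noteq> i"
    proof
      assume "(Suc i + t) mod n = i"
      then have "(i + Suc t) mod n = i mod n" using assms(1) by simp
      then have "n dvd Suc t" by (simp add: mod_eq_dvd_iff_nat)
      then show False using Suc.prems by (auto dest: dvd_imp_le)
    qed
    then have "f ((Suc i + t) mod n) = f (Suc ((Suc i + t) mod n) mod n)"
      using assms(1) by (intro assms(2)) auto
    also have "Suc ((Suc i + t) mod n) mod n = (Suc i + Suc t) mod n" by (simp add: mod_Suc_eq)
    finally show ?case using Suc by simp
  qed simp
  from this[of "n - 1"] show ?thesis using assms(1) by simp
qed

lemma cycle_labels_coincide: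
  assumes "length vs \<ge> 3" "distinct vs"
  shows "\<exists>i<length vs. \<exists>k<length vs. i \<noteq> k \<and>
    meet_label p (vs ! i) (vs ! (Suc i mod length vs)) = meet_label p (vs ! k) (vs ! (Suc k mod length vs))"
proof (rule ccontr)
  let ?n = "length vs"
  let ?l = "\<lambda>i. meet_label p (vs ! i) (vs ! (Suc i mod ?n))"
  let ?h = "\<lambda>i. case ?l i of None \<Rightarrow> 0 | Some z \<Rightarrow> Suc z"
  assume "\<not> ?thesis"
  then have ne: "?l i \<noteq> ?l k" if "i < ?n" "k < ?n" "i \<noteq> k" for i k using that by blast
  have adj: "vs ! k \<noteq> vs ! (Suc k mod ?n)" if "k < ?n" for k
  proof -
    have "Suc k mod ?n \<noteq> k" using that assms(1) by (simp add: mod_Suc)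
    moreover have "Suc k mod ?n < ?n" using assms(1) by (intro mod_less_divisor) linarith
    ultimately show ?thesis using that assms(2) by (simp add: nth_eq_iff_index_eq)
  qed
  obtain i where i: "i < ?n" "\<And>k. k < ?n \<Longrightarrow> ?h i \<le> ?h k"
  proof -
    have "0 < ?n" using assms(1) by linarith
    from ex_has_least_nat[of "\<lambda>i. i < ?n", OF this, of ?h] show ?thesis using that by blast
  qed
  let ?t = "?h i"
  have "climb p ?t (vs ! k) = climb p ?t (vs ! (Suc k mod ?n))" if k: "k < ?n" "k \<noteq> i" for k
  proof -
    have "?h i \<le> ?h k" "?l i \<noteq> ?l k" using i k ne[of i k] by auto
    then obtain z where "?l k = Some z" "?t \<le> z"
      by (cases "?l k"; cases "?l i") auto
    then show ?thesis using climb_eq_iff[OF adj[OF k(1)], of p ?t] by simp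
  qed
  then have "climb p ?t (vs ! i) = climb p ?t (vs ! (Suc i mod ?n))"
    by (intro cyclic_shift_eq[of i ?n "\<lambda>k. climb p ?t (vs ! k)"] i(1))
  then show False using climb_eq_iff[OF adj[OF i(1)], of p ?t] by (auto split: option.splits)
qed

section \<open>Quotients of exterior algebras\<close>

text \<open>The exterior algebra is itself a quotient of the free algebra, so the kernel of the composite map
  is identified by applying minimality twice.\<close>

definition exterior_quotient :: "'x set \<Rightarrow> ('x list \<Rightarrow>\<^sub>0 rat) set \<Rightarrow> ('x list \<Rightarrow>\<^sub>0 rat) set set graded_algebra" where
  "exterior_quotient B R = quotient_algebra (exterior_algebra B)
     (Idl\<^bsub>exterior_algebra B\<^esub> ((\<lambda>p. exterior_ideal B +>\<^bsub>free_algebra B\<^esub> p) ` R))"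

definition exterior_quotient_map :: "'x set \<Rightarrow> ('x list \<Rightarrow>\<^sub>0 rat) set \<Rightarrow> ('x list \<Rightarrow>\<^sub>0 rat) \<Rightarrow> ('x list \<Rightarrow>\<^sub>0 rat) set set" where
  "exterior_quotient_map B R t =
     (Idl\<^bsub>exterior_algebra B\<^esub> ((\<lambda>p. exterior_ideal B +>\<^bsub>free_algebra B\<^esub> p) ` R))
       +>\<^bsub>exterior_algebra B\<^esub> (exterior_ideal B +>\<^bsub>free_algebra B\<^esub> t)"

abbreviation linear_forms :: "'x set \<Rightarrow> ('x list \<Rightarrow>\<^sub>0 rat) set" where
  "linear_forms B \<equiv> {p. Poly_Mapping.keys p \<subseteq> {w \<in> lists B. length w = 1}}"

lemma linear_forms_tensors: "v \<in> linear_forms B \<Longrightarrow> v \<in> tensors B"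
  by auto

context
  fixes B :: "'x set" and R :: "('x list \<Rightarrow>\<^sub>0 rat) set"
  assumes R: "R \<subseteq> tensors B"
begin

lemma exterior_presentation:
  shows "presents B (exterior_algebra B) (\<lambda>t. exterior_ideal B +>\<^bsub>free_algebra B\<^esub> t)"
    and "t \<in> tensors B \<Longrightarrow> exterior_ideal B +>\<^bsub>free_algebra B\<^esub> t = \<zero>\<^bsub>exterior_algebra B\<^esub> \<longleftrightarrow> t \<in> exterior_ideal B"
    and "v \<in> linear_forms B \<Longrightarrow> v * v \<in> exterior_ideal B"
    and "ideal (exterior_ideal B) (free_algebra B)"
proof -
  have sq: "{v * v | v. v \<in> grade (free_algebra B) 1} \<subseteq> carrier (free_algebra B)"
    unfolding free_algebra_simps using linear_forms_tensors tensors_closed(6) by blast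
  show id: "ideal (exterior_ideal B) (free_algebra B)"
    unfolding exterior_ideal_def by (rule ring.genideal_ideal[OF free_algebra_ring sq])
  show "presents B (exterior_algebra B) (\<lambda>t. exterior_ideal B +>\<^bsub>free_algebra B\<^esub> t)"
    and "t \<in> tensors B \<Longrightarrow> exterior_ideal B +>\<^bsub>free_algebra B\<^esub> t = \<zero>\<^bsub>exterior_algebra B\<^esub> \<longleftrightarrow> t \<in> exterior_ideal B"
    unfolding exterior_algebra_def using presents_quotient[OF presents_free id] by blast+
  show "v * v \<in> exterior_ideal B" if "v \<in> linear_forms B"
    using ring.genideal_self[OF free_algebra_ring sq] that
    unfolding exterior_ideal_def free_algebra_simps by blast
qed

lemma exterior_quotient_presentation:
  shows "presents B (exterior_quotient B R) (exterior_quotient_map B R)"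
    and "t \<in> R \<Longrightarrow> exterior_quotient_map B R t = \<zero>\<^bsub>exterior_quotient B R\<^esub>"
    and "v \<in> linear_forms B \<Longrightarrow> exterior_quotient_map B R (v * v) = \<zero>\<^bsub>exterior_quotient B R\<^esub>"
    and "\<lbrakk>two_sided_ideal B K; R \<subseteq> K; \<And>v. v \<in> linear_forms B \<Longrightarrow> v * v \<in> K; t \<in> tensors B;
      exterior_quotient_map B R t = \<zero>\<^bsub>exterior_quotient B R\<^esub>\<rbrakk> \<Longrightarrow> t \<in> K"
proof -
  let ?L = "exterior_algebra B" and ?c = "\<lambda>t. exterior_ideal B +>\<^bsub>free_algebra B\<^esub> t"
  note pres = exterior_presentation(1)
  note P = presentsD[OF pres]
  interpret L: ring ?L by (rule P(1))
  have Rc: "?c ` R \<subseteq> carrier ?L" unfolding P(12) using R by blast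
  have id: "ideal (Idl\<^bsub>?L\<^esub> (?c ` R)) ?L" by (rule L.genideal_ideal[OF Rc])
  interpret J: ideal "Idl\<^bsub>?L\<^esub> (?c ` R)" ?L by (rule id)
  note Q = presents_quotient[OF pres id]
  show "presents B (exterior_quotient B R) (exterior_quotient_map B R)"
    using Q(1) by (simp add: exterior_quotient_def exterior_quotient_map_def[abs_def])
  have zero: "exterior_quotient_map B R t = \<zero>\<^bsub>exterior_quotient B R\<^esub> \<longleftrightarrow> ?c t \<in> Idl\<^bsub>?L\<^esub> (?c ` R)"
    if "t \<in> tensors B" for t
    using Q(2)[OF that] by (simp add: exterior_quotient_def exterior_quotient_map_def)
  show "exterior_quotient_map B R t = \<zero>\<^bsub>exterior_quotient B R\<^esub>" if "t \<in> R"
    using zero[of t] that R L.genideal_self[OF Rc] by blast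
  show "exterior_quotient_map B R (v * v) = \<zero>\<^bsub>exterior_quotient B R\<^esub>" if v: "v \<in> linear_forms B"
  proof -
    have vv: "v * v \<in> tensors B" using linear_forms_tensors[OF v] by (intro tensors_closed(6))
    then have "?c (v * v) = \<zero>\<^bsub>?L\<^esub>" using exterior_presentation(2,3) v by blast
    then show ?thesis using zero[OF vv] by (simp add: J.zero_closed)
  qed
  show "t \<in> K" if K: "two_sided_ideal B K" and RK: "R \<subseteq> K" and sq: "\<And>v. v \<in> linear_forms B \<Longrightarrow> v * v \<in> K"
    and t: "t \<in> tensors B" and tz: "exterior_quotient_map B R t = \<zero>\<^bsub>exterior_quotient B R\<^esub>"
  proof (rule quotient_kernel_minimal[OF pres K _ _ t, of "?c ` R"])
    show "?c ` R \<subseteq> ?c ` K" using RK by blast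
    show "?c t \<in> Idl\<^bsub>?L\<^esub> (?c ` R)" using zero[OF t] tz by simp
    fix s assume s: "s \<in> tensors B" "?c s = \<zero>\<^bsub>?L\<^esub>"
    then have s': "s \<in> exterior_ideal B" using exterior_presentation(2) by blast
    show "s \<in> K"
    proof (rule quotient_kernel_minimal[OF presents_free K _ _ s(1), of "{v * v | v. v \<in> linear_forms B}"])
      show "s \<in> Idl\<^bsub>free_algebra B\<^esub> {v * v | v. v \<in> linear_forms B}"
        using s' by (simp add: exterior_ideal_def free_algebra_simps)
      show "{v * v | v. v \<in> linear_forms B} \<subseteq> (\<lambda>t. t) ` K" using sq by auto
      show "u \<in> K" if "u = \<zero>\<^bsub>free_algebra B\<^esub>" for u
        using that two_sided_idealD(2)[OF K] by (simp add: free_algebra_simps)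
    qed
  qed
qed

text \<open>The components of the elements of the kernel are in the kernel by minimality, since the squares of
  linear forms and the relations are homogeneous.\<close>

lemma exterior_quotient_graded:
  assumes hom: "\<And>t. t \<in> R \<Longrightarrow> \<exists>d. Poly_Mapping.keys t \<subseteq> {w. length w = d}"
    and nontriv: "exterior_quotient_map B R 1 \<noteq> \<zero>\<^bsub>exterior_quotient B R\<^esub>"
  shows "graded_presentation B (exterior_quotient B R) (exterior_quotient_map B R)"
proof
  let ?A = "exterior_quotient B R" and ?\<pi> = "exterior_quotient_map B R"
  note pres = exterior_quotient_presentation(1)
  note P = presentsD[OF pres]
  interpret A: ring ?A by (rule P(1))
  define K where "K = {t \<in> tensors B. ?\<pi> t = \<zero>\<^bsub>?A\<^esub>}"
  have K: "two_sided_ideal B K"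
    unfolding two_sided_ideal_def
  proof (intro conjI ballI)
    show "K \<subseteq> tensors B" unfolding K_def by blast
    show "0 \<in> K" unfolding K_def using P(6) by simp
    fix p q assume "p \<in> K" "q \<in> K"
    then have pq: "p \<in> tensors B" "q \<in> tensors B" "?\<pi> p = \<zero>\<^bsub>?A\<^esub>" "?\<pi> q = \<zero>\<^bsub>?A\<^esub>" unfolding K_def by blast+
    show "p - q \<in> K" using P(8)[OF pq(1,2)] pq(3,4) tensors_closed(4)[OF pq(1,2)] unfolding K_def by simp
  next
    fix p t assume "p \<in> K" and t: "t \<in> tensors B"
    then have p: "p \<in> tensors B" "?\<pi> p = \<zero>\<^bsub>?A\<^esub>" unfolding K_def by blast+
    show "p * t \<in> K" using P(4)[OF p(1) t] p(2) P(2)[OF t] tensors_closed(6)[OF p(1) t] unfolding K_def by simp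
    show "t * p \<in> K" using P(4)[OF t p(1)] p(2) P(2)[OF t] tensors_closed(6)[OF t p(1)] unfolding K_def by simp
  qed
  have homK: "t \<in> {t \<in> tensors B. \<forall>n. component n t \<in> K}" if "t \<in> K" "Poly_Mapping.keys t \<subseteq> {w. length w = d}" for t d
  proof -
    have "component n t = (if n = d then t else 0)" for n
      using that(2) by (auto intro!: restrict_poly_id restrict_poly_none)
    then show ?thesis using that(1) two_sided_idealD(1,2)[OF K] by auto
  qed
  show "presents B ?A ?\<pi>" by (rule pres)
  show "?\<pi> 1 \<noteq> \<zero>\<^bsub>?A\<^esub>" by (rule nontriv)
  show "?\<pi> (component n t) = \<zero>\<^bsub>?A\<^esub>" if t: "t \<in> tensors B" "?\<pi> t = \<zero>\<^bsub>?A\<^esub>" for t n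
  proof -
    have "t \<in> {t \<in> tensors B. \<forall>n. component n t \<in> K}"
    proof (rule exterior_quotient_presentation(4)[OF two_sided_ideal_homogeneous_part[OF K] _ _ t])
      show "R \<subseteq> {t \<in> tensors B. \<forall>n. component n t \<in> K}"
      proof
        fix t assume t: "t \<in> R"
        obtain d where "Poly_Mapping.keys t \<subseteq> {w. length w = d}" using hom[OF t] by blast
        moreover have "t \<in> K" unfolding K_def using t R exterior_quotient_presentation(2) by blast
        ultimately show "t \<in> {t \<in> tensors B. \<forall>n. component n t \<in> K}" using homK by blast
      qed
      fix v assume v: "v \<in> linear_forms B"
      have "v * v \<in> tensors B" using linear_forms_tensors[OF v] by (intro tensors_closed(6))
      then have "v * v \<in> K" unfolding K_def using exterior_quotient_presentation(3)[OF v] by blast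
      moreover have "Poly_Mapping.keys (v * v) \<subseteq> {w. length w = 2}"
        using v by (intro keys_mult_subset[of v "{w \<in> lists B. length w = 1}" v "{w \<in> lists B. length w = 1}"]) auto
      ultimately show "v * v \<in> {t \<in> tensors B. \<forall>n. component n t \<in> K}" by (rule homK)
    qed
    then show ?thesis unfolding K_def by blast
  qed
qed

end

section \<open>The arrangement algebra acts on Fock space\<close>

text \<open>The vertices are numbered in the elimination order, so that heads, tails and levels become natural
  numbers.\<close>

locale ordered_graph =
  fixes g :: nat and V :: "'v set" and E :: "'v set set" and r :: "'v rel"
    and N :: nat and vtx :: "nat \<Rightarrow> 'v"
  assumes g_pos: "0 < g"
    and bij: "bij_betw vtx {..<N} V"
    and ord: "\<And>i j. i < N \<Longrightarrow> j < N \<Longrightarrow> (vtx i, vtx j) \<in> r \<longleftrightarrow> i \<le> j"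
    and edges: "\<And>e. e \<in> E \<Longrightarrow> e \<subseteq> V \<and> card e = 2"
    and elimination: "\<And>i j k. \<lbrakk>i < j; j < k; k < N; {vtx i, vtx k} \<in> E; {vtx j, vtx k} \<in> E\<rbrakk> \<Longrightarrow> {vtx i, vtx j} \<in> E"
begin

definition idx :: "'v \<Rightarrow> nat" where "idx v = inv_into {..<N} vtx v"

definition adj :: "nat \<Rightarrow> nat \<Rightarrow> bool" where
  "adj i j \<longleftrightarrow> i < j \<and> j < N \<and> {vtx i, vtx j} \<in> E"

abbreviation gx where "gx a i \<equiv> GenX a (vtx i)"
abbreviation gy where "gy a i \<equiv> GenY a (vtx i)"
abbreviation ge where "ge i j \<equiv> GenE {vtx i, vtx j}"

abbreviation letters :: "'v arr_gen set" where "letters \<equiv> arr_gens g V E"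

abbreviation relations :: "('v arr_gen list \<Rightarrow>\<^sub>0 rat) set" where
  "relations \<equiv> cycle_relations E r \<union> edge_relations g E r \<union> vertex_relations g V"

lemma vtx_inj: "i < N \<Longrightarrow> j < N \<Longrightarrow> vtx i = vtx j \<longleftrightarrow> i = j"
  using bij by (auto simp: bij_betw_def inj_on_def)

lemma idx_vtx [simp]: "i < N \<Longrightarrow> idx (vtx i) = i"
  using bij by (simp add: idx_def bij_betw_def)

lemma vertex_cases: "v \<in> V \<longleftrightarrow> (\<exists>i<N. v = vtx i)"
  using bij by (auto simp: bij_betw_def)

lemma edge_cases: "e \<in> E \<longleftrightarrow> (\<exists>i j. adj i j \<and> e = {vtx i, vtx j})"
proof
  assume e: "e \<in> E"
  then obtain u v where uv: "e = {u, v}" "u \<noteq> v" using edges[OF e] by (auto simp: card_2_iff)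
  then obtain i j where ij: "i < N" "j < N" "u = vtx i" "v = vtx j"
    using edges[OF e] vertex_cases by (metis insert_subset)
  then consider "i < j" | "j < i" using uv(2) by (metis linorder_neqE_nat)
  then show "\<exists>i j. adj i j \<and> e = {vtx i, vtx j}"
  proof cases
    case 1
    then show ?thesis using e uv(1) ij by (auto simp: adj_def)
  next
    case 2
    then show ?thesis using e uv(1) ij by (intro exI[of _ j] exI[of _ i]) (auto simp: adj_def insert_commute)
  qed
qed (auto simp: adj_def)

lemma head_tail:
  assumes "i < j" "j < N"
  shows "edge_head r {vtx i, vtx j} = vtx j" "edge_tail r {vtx i, vtx j} = vtx i"
proof -
  have i: "i < N" using assms by simp
  note o = ord[OF i i] ord[OF i assms(2)] ord[OF assms(2) i] ord[OF assms(2) assms(2)]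
  show "edge_head r {vtx i, vtx j} = vtx j"
    unfolding edge_head_def using o assms by (intro the_equality) auto
  show "edge_tail r {vtx i, vtx j} = vtx i"
    unfolding edge_tail_def using o assms by (intro the_equality) auto
qed

lemma letter_cases:
  "c \<in> letters \<longleftrightarrow> (\<exists>a i. a \<in> {1..g} \<and> i < N \<and> c = gx a i) \<or> (\<exists>a i. a \<in> {1..g} \<and> i < N \<and> c = gy a i) \<or>
     (\<exists>i j. adj i j \<and> c = ge i j)"
proof -
  have e: "c \<in> GenE ` E \<longleftrightarrow> (\<exists>i j. adj i j \<and> c = ge i j)"
    unfolding image_iff Bex_def edge_cases by blast
  show ?thesis unfolding arr_gens_def Un_iff e mem_Collect_eq vertex_cases by blast
qed

text \<open>The image of a generator under the homomorphism that belongs to the forest \<open>p\<close>: an operator at one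
  vertex, or 0 (\<open>None\<close>).  The state of a vertex \<open>z\<close> with parent \<open>p z\<close> that is excited by an edge remembers
  the parent, so the forest can be read off from the state.\<close>

fun fock_image :: "(nat \<Rightarrow> nat) \<Rightarrow> 'v arr_gen \<Rightarrow> (fibre \<times> nat) option" where
  "fock_image p (GenX a v) = Some (FX a, climb p 0 (idx v))"
| "fock_image p (GenY a v) = Some (FY a, climb p 0 (idx v))"
| "fock_image p (GenE e) =
     map_option (\<lambda>z. (FEdge (p z), z)) (meet_label p (idx (edge_tail r e)) (idx (edge_head r e)))"

definition letter_op :: "(nat \<Rightarrow> nat) \<Rightarrow> 'v arr_gen \<Rightarrow> (state \<Rightarrow> rat) \<Rightarrow> state \<Rightarrow> rat" where
  "letter_op p c f = (case fock_image p c of None \<Rightarrow> (\<lambda>\<sigma>. 0) | Some (k, z) \<Rightarrow> fock_op N k z f)"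

end

sublocale ordered_graph \<subseteq> fock: linear_action "letter_op p" for p
  by standard (auto simp: letter_op_def fock_op_def fun_eq_iff algebra_simps split: option.splits prod.splits)

context ordered_graph
begin

lemma fock_image_range:
  assumes "c \<in> letters" "fock_image p c = Some (k, z)"
  shows "one_particle k \<and> z < N"
proof -
  have "climb p 0 i < N" if "i < N" for i using climb_le[of p 0 i] that by simp
  moreover have "z < N" if "meet_label p i j = Some z" "adj i j" for i j z
    using meet_label_le[OF that(1)] that(2) by (simp add: adj_def)
  ultimately show ?thesis
    using assms by (auto simp: letter_cases one_particle_def adj_def head_tail)
qed

lemma letter_op_anticommute:
  assumes "c \<in> letters" "d \<in> letters"
  shows "letter_op p c (letter_op p d f) = (\<lambda>\<sigma>. - letter_op p d (letter_op p c f) \<sigma>)"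
proof (cases "fock_image p c = None \<or> fock_image p d = None")
  case True
  then show ?thesis by (auto simp: letter_op_def fock_op_def fun_eq_iff split: option.splits)
next
  case False
  then obtain k z k' z' where "fock_image p c = Some (k, z)" "fock_image p d = Some (k', z')" by auto
  then show ?thesis
    using fock_image_range[OF assms(1)] fock_image_range[OF assms(2)]
    by (auto simp: letter_op_def fun_eq_iff intro!: fock_op_anticommute)
qed

lemma linear_form_induct [consumes 1, case_names zero single add]:
  assumes "v \<in> linear_forms letters" "Q 0" "\<And>c a. c \<in> letters \<Longrightarrow> Q (Poly_Mapping.single [c] a)"
    "\<And>p q. Q p \<Longrightarrow> Q q \<Longrightarrow> Q (p + q)"
  shows "Q v"
  using assms(1) unfolding mem_Collect_eq
  by (induction v rule: poly_span_induct) (use assms(2-4) in \<open>auto simp: length_Suc_conv\<close>)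

text \<open>By bilinearity the images of any two linear forms anticommute, as those of the letters do.\<close>

lemma square_acts_zero:
  assumes "v \<in> linear_forms letters"
  shows "fock.poly_act p (v * v) f = (\<lambda>\<sigma>. 0)"
proof -
  let ?P = "fock.poly_act p"
  have "?P (u * v) f \<sigma> = - ?P (v * u) f \<sigma>" if "u \<in> linear_forms letters" "v \<in> linear_forms letters" for u v \<sigma>
    using that(1)
  proof (induction u rule: linear_form_induct)
    case (single c a)
    show ?case using that(2)
    proof (induction v rule: linear_form_induct)
      case (single d b)
      then show ?case using letter_op_anticommute[OF single \<open>c \<in> letters\<close>, of p f]
        by (simp add: single_mult_single fock.poly_act_single fun_eq_iff)
    qed (simp_all add: fock.poly_act_zero distrib_left distrib_right fock.poly_act_add)
  qed (simp_all add: fock.poly_act_zero distrib_left distrib_right fock.poly_act_add)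
  from this[OF assms assms] show ?thesis by (auto simp: fun_eq_iff)
qed

lemma prod_list_eg: "prod_list (map eg es) = word (map GenE es)"
proof (induction es)
  case Nil
  then show ?case by (simp add: zero_list_def flip: single_one)
qed (simp add: eg_def single_mult_single)

text \<open>Two edges of the cycle have the same image, and the boundary of a product of anticommuting
  operators with a repeated factor vanishes.\<close>

lemma cycle_relation_acts_zero:
  assumes "t \<in> cycle_relations E r"
  shows "fock.poly_act p t f = (\<lambda>\<sigma>. 0)"
proof
  fix \<sigma>
  obtain es vs where t: "t = (\<Sum>j<length es. (-1) ^ Suc j * prod_list (map eg (take j es @ drop (Suc j) es)))"
    and cyc: "graph_cycle E vs" and set: "set es = cycle_edges vs"
    using assms unfolding cycle_relations_def by blast
  let ?n = "length vs"
  have vs: "?n \<ge> 3" "distinct vs" "cycle_edges vs \<subseteq> E" using cyc by (simp_all add: graph_cycle_def)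
  have next_lt: "Suc i mod ?n < ?n" if "i < ?n" for i using that by (intro mod_less_divisor) linarith
  have edge: "{vs ! i, vs ! (Suc i mod ?n)} \<in> set es" if "i < ?n" for i
    using that set by (auto simp: cycle_edges_def)
  have vsV: "vs ! i \<in> V" if "i < ?n" for i
    using edge[OF that] set vs(3) edges by blast
  define ns where "ns = map idx vs"
  have ns: "vs ! i = vtx (ns ! i)" "ns ! i < N" if "i < ?n" for i
    using vsV[OF that] that by (auto simp: ns_def vertex_cases)
  have "distinct ns"
    using vs(2) ns unfolding distinct_conv_nth by (metis length_map ns_def)
  then obtain i k where ik: "i < ?n" "k < ?n" "i \<noteq> k"
    and lab: "meet_label p (ns ! i) (ns ! (Suc i mod ?n)) = meet_label p (ns ! k) (ns ! (Suc k mod ?n))"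
    using cycle_labels_coincide[of ns p] vs(1) by (auto simp: ns_def)
  \<comment> \<open>the edges with these indices are different, because the cycle has at least three vertices\<close>
  have neq: "{vs ! i, vs ! (Suc i mod ?n)} \<noteq> {vs ! k, vs ! (Suc k mod ?n)}"
  proof
    assume "{vs ! i, vs ! (Suc i mod ?n)} = {vs ! k, vs ! (Suc k mod ?n)}"
    then have e: "i = Suc k mod ?n" "k = Suc i mod ?n"
      using ik next_lt vs(2) by (auto simp: doubleton_eq_iff nth_eq_iff_index_eq)
    have m: "Suc a mod ?n = (if Suc a = ?n then 0 else Suc a)" if "a < ?n" for a
      by (simp only: mod_Suc mod_less[OF that])
    have arith: False if "a = (if Suc b = n then 0 else Suc b)" "b = (if Suc a = n then 0 else Suc a)" "3 \<le> n" "a \<noteq> b"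
      for a b n :: nat
    proof -
      have "Suc b = n \<and> a = 0 \<or> a = Suc b" using that(1) by (simp split: if_splits)
      moreover have "Suc a = n \<and> b = 0 \<or> b = Suc a" using that(2) by (simp split: if_splits)
      ultimately show False using that(3,4) by linarith
    qed
    show False by (rule arith[OF e(1)[unfolded m[OF ik(2)]] e(2)[unfolded m[OF ik(1)]] vs(1) ik(3)])
  qed
  have op: "letter_op p (GenE {vtx a, vtx b}) = (case meet_label p a b of None \<Rightarrow> (\<lambda>f \<sigma>. 0) | Some z \<Rightarrow> fock_op N (FEdge (p z)) z)"
    if ab: "a < N" "b < N" "a \<noteq> b" for a b
  proof -
    have sym: "meet_label p b a = meet_label p a b"
    proof -
      have "climb p \<tau> a = climb p \<tau> b \<longleftrightarrow> climb p \<tau> b = climb p \<tau> a" for \<tau> by auto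
      then have e: "(\<exists>z. meet_label p a b = Some z \<and> \<tau> \<le> z) \<longleftrightarrow> (\<exists>z. meet_label p b a = Some z \<and> \<tau> \<le> z)" for \<tau>
        using climb_eq_iff[of a b p \<tau>] climb_eq_iff[of b a p \<tau>] ab(3) by metis
      show ?thesis
      proof (cases "meet_label p a b")
        case None
        then show ?thesis using e[of 0] by (cases "meet_label p b a") auto
      next
        case (Some z)
        then obtain z' where "meet_label p b a = Some z'" using e[of 0] by auto
        then show ?thesis using Some e[of z] e[of z'] by auto
      qed
    qed
    consider "a < b" | "b < a" using ab(3) by linarith
    then show ?thesis
      by cases (use ab sym head_tail[of a b] head_tail[of b a] in
          \<open>auto simp: letter_op_def fun_eq_iff insert_commute split: option.splits\<close>)
  qed
  have lab_op: "letter_op p (GenE {vs ! i, vs ! (Suc i mod ?n)}) = letter_op p (GenE {vs ! k, vs ! (Suc k mod ?n)})"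
  proof -
    have ne: "ns ! j \<noteq> ns ! (Suc j mod ?n)" if "j < ?n" for j
    proof -
      have "card {vs ! j, vs ! (Suc j mod ?n)} = 2" using edges edge[OF that] set vs(3) by blast
      then show ?thesis using ns(1)[OF that] ns(1)[OF next_lt[OF that]] by auto
    qed
    show ?thesis
      unfolding ns(1)[OF ik(1)] ns(1)[OF ik(2)] ns(1)[OF next_lt[OF ik(1)]] ns(1)[OF next_lt[OF ik(2)]]
        op[OF ns(2)[OF ik(1)] ns(2)[OF next_lt[OF ik(1)]] ne[OF ik(1)]]
        op[OF ns(2)[OF ik(2)] ns(2)[OF next_lt[OF ik(2)]] ne[OF ik(2)]] lab ..
  qed
  obtain a where a: "a < length es" "es ! a = {vs ! i, vs ! (Suc i mod ?n)}"
    using edge[OF ik(1)] by (auto simp: in_set_conv_nth)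
  obtain b where b: "b < length es" "es ! b = {vs ! k, vs ! (Suc k mod ?n)}"
    using edge[OF ik(2)] by (auto simp: in_set_conv_nth)
  have ab: "a \<noteq> b" using a b neq by auto
  let ?ws = "map GenE es"
  have ws: "set ?ws \<subseteq> letters" using set vs(3) by (auto simp: arr_gens_def)
  have "(\<Sum>j<length ?ws. (-1) ^ Suc j * fock.word_act p (take j ?ws @ drop (Suc j) ?ws) f \<sigma>) = 0"
  proof (rule fock.boundary_zero[of ?ws p "min a b" "max a b"])
    show "letter_op p (?ws ! min a b) = letter_op p (?ws ! max a b)"
      using a b lab_op by (simp add: min_def max_def)
    show "letter_op p c (letter_op p d f) = (\<lambda>\<sigma>. - letter_op p d (letter_op p c f) \<sigma>)"
      if "c \<in> set ?ws" "d \<in> set ?ws" for c d f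
      using that ws by (intro letter_op_anticommute) auto
  qed (use a b ab in auto)
  moreover have "fock.poly_act p t f \<sigma> =
      (\<Sum>j<length es. (-1) ^ Suc j * fock.word_act p (map GenE (take j es @ drop (Suc j) es)) f \<sigma>)"
  proof -
    have s: "fock.poly_act p (\<Sum>j<n. h j) f \<sigma> = (\<Sum>j<n. fock.poly_act p (h j) f \<sigma>)" for n and h :: "nat \<Rightarrow> _"
      by (induction n) (simp_all add: fock.poly_act_zero fock.poly_act_add)
    have u: "(-1) ^ j * (q :: 'v arr_gen list \<Rightarrow>\<^sub>0 rat) = scale ((-1) ^ j) q" for j q
    proof -
      have "(-1 :: 'v arr_gen list \<Rightarrow>\<^sub>0 rat) ^ j = Poly_Mapping.single 0 ((-1) ^ j)"
        by (induction j) (simp_all add: mult_single flip: single_uminus single_one)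
      then show ?thesis by (simp add: scale_def)
    qed
    show ?thesis unfolding t s prod_list_eg u fock.poly_act_scale fock.poly_act_single by simp
  qed
  ultimately show "fock.poly_act p t f \<sigma> = 0" by (simp add: take_map drop_map)
qed

lemma letter_op_simps:
  "letter_op p (GenX a v) = fock_op N (FX a) (climb p 0 (idx v))"
  "letter_op p (GenY a v) = fock_op N (FY a) (climb p 0 (idx v))"
  by (simp_all add: letter_op_def fun_eq_iff)

lemma poly_act_word2: "fock.poly_act p (word [c, d]) f = letter_op p d (letter_op p c f)"
  by (simp add: fock.poly_act_single)

lemma gen_products:
  "xg i v * yg j w = word [GenX i v, GenY j w]" "xg i v * xg j w = word [GenX i v, GenX j w]"
  "yg i v * yg j w = word [GenY i v, GenY j w]"
  "xg i v * eg e = word [GenX i v, GenE e]" "yg i v * eg e = word [GenY i v, GenE e]"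
  by (simp_all add: xg_def yg_def eg_def single_mult_single)

lemma vertex_relation_acts_zero:
  assumes "t \<in> vertex_relations g V"
  shows "fock.poly_act p t f = (\<lambda>\<sigma>. 0)"
proof -
  let ?P = "fock.poly_act p"
  have 1: "?P (word [GenX i v, GenY j v]) f \<sigma> = 0" if "i \<noteq> j" for i j v \<sigma>
    using that unfolding poly_act_word2 letter_op_simps fock_op_same_vertex
    by (cases "\<sigma> (climb p 0 (idx v))") auto
  have 2: "?P (word [GenX i v, GenX j v]) f \<sigma> = 0" "?P (word [GenY i v, GenY j v]) f \<sigma> = 0" for i j v \<sigma>
    unfolding poly_act_word2 letter_op_simps fock_op_same_vertex
    by (cases "\<sigma> (climb p 0 (idx v))"; simp)+
  have 3: "?P (word [GenX i v, GenY i v]) f \<sigma> = ?P (word [GenX j v, GenY j v]) f \<sigma>" for i j v \<sigma>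
    unfolding poly_act_word2 letter_op_simps fock_op_same_vertex
    by (cases "\<sigma> (climb p 0 (idx v))") auto
  have 4: "?P (word [GenX i v, GenY i v] - word [GenX j v, GenY j v]) f \<sigma> = 0" for i j v \<sigma>
    unfolding fock.poly_act_diff using 3[of i v \<sigma> j] by simp
  show ?thesis
    using assms unfolding vertex_relations_def gen_products by (auto simp: 1 2 4)
qed

text \<open>If the edge acts nontrivially, its ends meet when climbing, so they have the same root.\<close>

lemma edge_relation_acts_zero:
  assumes "t \<in> edge_relations g E r"
  shows "fock.poly_act p t f = (\<lambda>\<sigma>. 0)"
proof -
  have z: "letter_op p c (\<lambda>\<sigma>. 0) = (\<lambda>\<sigma>. 0)" for c using fock.act_scale[of p c 0 "\<lambda>\<sigma>. 0"] by simp
  have "fock.poly_act p ((word [c] - word [d]) * word [GenE e]) f = (\<lambda>\<sigma>. 0)"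
    if e: "e \<in> E" and cd: "climb p 0 (idx (edge_head r e)) = climb p 0 (idx (edge_tail r e)) \<Longrightarrow> letter_op p c = letter_op p d" for c d e
  proof -
    obtain i j where ij: "adj i j" "e = {vtx i, vtx j}" using e edge_cases by blast
    then have ht: "idx (edge_head r e) = j" "idx (edge_tail r e) = i" "i \<noteq> j"
      using head_tail[of i j] by (auto simp: adj_def)
    have "fock.poly_act p ((word [c] - word [d]) * word [GenE e]) f =
        letter_op p (GenE e) (\<lambda>\<sigma>. letter_op p c f \<sigma> - letter_op p d f \<sigma>)"
      by (simp add: fock.poly_act_mult fock.poly_act_diff fock.poly_act_single)
    also have "\<dots> = (\<lambda>\<sigma>. 0)"
    proof (cases "meet_label p i j")
      case None
      then show ?thesis by (simp add: letter_op_def ht)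
    next
      case (Some l)
      then have "climb p 0 j = climb p 0 i" using climb_eq_iff[OF ht(3), of p 0] by simp
      then have "letter_op p c = letter_op p d" using cd ht by simp
      then show ?thesis by (simp add: z)
    qed
    finally show ?thesis .
  qed
  then show ?thesis
    using assms unfolding edge_relations_def xg_def yg_def eg_def
    by (auto simp: letter_op_simps)
qed

lemma edge_head_tail_V: "e \<in> E \<Longrightarrow> edge_head r e \<in> V \<and> edge_tail r e \<in> V"
proof -
  have V: "vtx i \<in> V" if "i < N" for i using that vertex_cases by blast
  show "e \<in> E \<Longrightarrow> edge_head r e \<in> V \<and> edge_tail r e \<in> V"
    using edge_cases[of e] head_tail by (auto simp: adj_def intro!: V)
qed

lemma relations_homogeneous:
  assumes "t \<in> relations"
  shows "\<exists>d. Poly_Mapping.keys t \<subseteq> {w \<in> lists letters. length w = d}"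
proof -
  consider "t \<in> cycle_relations E r" | "t \<in> edge_relations g E r" | "t \<in> vertex_relations g V"
    using assms by blast
  then show ?thesis
  proof cases
    case 1
    then obtain es vs where t: "t = (\<Sum>j<length es. (-1) ^ Suc j * prod_list (map eg (take j es @ drop (Suc j) es)))"
      and cyc: "graph_cycle E vs" and set: "set es = cycle_edges vs"
      unfolding cycle_relations_def by blast
    have es: "set es \<subseteq> E" using cyc set by (simp add: graph_cycle_def)
    have u: "Poly_Mapping.keys ((-1) ^ j * q) \<subseteq> Poly_Mapping.keys q" for j and q :: "'v arr_gen list \<Rightarrow>\<^sub>0 rat"
    proof (induction j)
      case (Suc j)
      then show ?case using keys_uminus_subset[OF Suc] by simp
    qed simp
    have "Poly_Mapping.keys t \<subseteq> {w \<in> lists letters. length w = length es - 1}"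
      unfolding t
    proof (rule keys_sum_subset)
      fix j assume j: "j \<in> {..<length es}"
      let ?es = "take j es @ drop (Suc j) es"
      have "set ?es \<subseteq> E" using es by (auto dest: in_set_takeD in_set_dropD)
      then have "GenE ` set ?es \<subseteq> letters" unfolding arr_gens_def by blast
      then have "map GenE ?es \<in> {w \<in> lists letters. length w = length es - 1}" using j
        by (simp only: mem_Collect_eq lists_eq_set set_map) simp
      then show "Poly_Mapping.keys ((-1) ^ Suc j * prod_list (map eg ?es)) \<subseteq> {w \<in> lists letters. length w = length es - 1}"
        unfolding prod_list_eg by (intro order_trans[OF u] keys_single_subset)
    qed
    then show ?thesis ..
  next
    case 2
    then show ?thesis
      unfolding edge_relations_def left_diff_distrib gen_products
      by (intro exI[of _ 2], elim UnE CollectE exE conjE; hypsubst)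
        (rule keys_diff_subset; rule keys_single_subset; simp add: arr_gens_def edge_head_tail_V)+
  next
    case 3
    then show ?thesis
      unfolding vertex_relations_def gen_products
      by (intro exI[of _ 2], elim UnE CollectE exE conjE; hypsubst)
        ((intro keys_diff_subset)?; rule keys_single_subset; simp add: arr_gens_def)+
  qed
qed

lemma relations_tensors: "relations \<subseteq> tensors letters"
  using relations_homogeneous by blast

text \<open>The elements of the free algebra that act as zero form an ideal, which contains all relations.\<close>

lemma kernel_acts_zero:
  assumes "t \<in> tensors letters"
    and "exterior_quotient_map letters relations t = \<zero>\<^bsub>exterior_quotient letters relations\<^esub>"
  shows "fock.poly_act p t f = (\<lambda>\<sigma>. 0)"
proof -
  have "t \<in> {t \<in> tensors letters. \<forall>f. fock.poly_act p t f = (\<lambda>\<sigma>. 0)}"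
  proof (rule exterior_quotient_presentation(4)[OF relations_tensors fock.annihilator_ideal _ _ assms])
    show "relations \<subseteq> {t \<in> tensors letters. \<forall>f. fock.poly_act p t f = (\<lambda>\<sigma>. 0)}"
      using relations_tensors cycle_relation_acts_zero edge_relation_acts_zero vertex_relation_acts_zero by blast
    show "v * v \<in> {t \<in> tensors letters. \<forall>f. fock.poly_act p t f = (\<lambda>\<sigma>. 0)}" if "v \<in> linear_forms letters" for v
      using square_acts_zero[OF that] tensors_closed(6)[OF linear_forms_tensors[OF that] linear_forms_tensors[OF that]] by blast
  qed
  then show ?thesis by blast
qed

abbreviation pres_map where "pres_map \<equiv> exterior_quotient_map letters relations"

lemma graded_presentation_arrangement:
  "graded_presentation letters (exterior_quotient letters relations) pres_map"
proof (rule exterior_quotient_graded[OF relations_tensors])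
  show "\<exists>d. Poly_Mapping.keys t \<subseteq> {w. length w = d}" if "t \<in> relations" for t
    using relations_homogeneous[OF that] by blast
  show "pres_map 1 \<noteq> \<zero>\<^bsub>exterior_quotient letters relations\<^esub>"
  proof
    assume "pres_map 1 = \<zero>\<^bsub>exterior_quotient letters relations\<^esub>"
    then have "fock.poly_act (\<lambda>v. v) 1 (\<lambda>\<sigma>. 1) = (\<lambda>\<sigma>. 0)"
      by (intro kernel_acts_zero tensors_closed(2))
    then show False by (simp add: fock.poly_act_one fun_eq_iff)
  qed
qed

end

sublocale ordered_graph \<subseteq> pres: graded_presentation letters "exterior_quotient letters relations" pres_map
  by (rule graded_presentation_arrangement)

context ordered_graph
begin

definition ker :: "('v arr_gen list \<Rightarrow>\<^sub>0 rat) set" where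
  "ker = {t \<in> tensors letters. pres_map t = \<zero>\<^bsub>exterior_quotient letters relations\<^esub>}"

lemma ker_diff: "p \<in> ker \<Longrightarrow> q \<in> ker \<Longrightarrow> p - q \<in> ker"
  and ker_add: "p \<in> ker \<Longrightarrow> q \<in> ker \<Longrightarrow> p + q \<in> ker"
proof -
  have z: "0 \<in> ker" using pres.presented(6) tensors_closed(1) by (simp add: ker_def)
  show d: "p - q \<in> ker" if "p \<in> ker" "q \<in> ker" for p q
  proof -
    have t: "p \<in> tensors letters" "q \<in> tensors letters" using that by (simp_all add: ker_def)
    show ?thesis using that pres.presented(9)[OF t] tensors_closed(4)[OF t] by (simp add: ker_def)
  qed
  show "p \<in> ker \<Longrightarrow> q \<in> ker \<Longrightarrow> p + q \<in> ker" using d[of p "0 - q"] d[OF z, of q] by simp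
qed

lemma ker_congruent: "s \<in> tensors letters \<Longrightarrow> t \<in> tensors letters \<Longrightarrow> s - t \<in> ker \<Longrightarrow> pres_map s = pres_map t"
  using pres.presented(9) by (simp add: ker_def)

lemma relation_ker: "t \<in> relations \<Longrightarrow> t \<in> ker"
  unfolding ker_def using exterior_quotient_presentation(2)[OF relations_tensors] relations_tensors by blast

lemma square_ker:
  assumes "v \<in> linear_forms letters" shows "v * v \<in> ker"
  using exterior_quotient_presentation(3)[OF relations_tensors assms] linear_forms_tensors[OF assms]
    tensors_closed(6)[of v letters v] by (simp add: ker_def)

lemma letter_square_ker: "c \<in> letters \<Longrightarrow> word [c, c] \<in> ker"
  using square_ker[of "word [c]"] by (simp add: single_mult_single)

lemma letters_anticommute_ker:
  assumes "c \<in> letters" "d \<in> letters" shows "word [c, d] + word [d, c] \<in> ker"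
proof -
  have "word [c] + word [d] \<in> linear_forms letters"
    using assms unfolding mem_Collect_eq by (intro keys_add_subset keys_single_subset) auto
  from ker_diff[OF ker_diff[OF square_ker[OF this] letter_square_ker[OF assms(1)]] letter_square_ker[OF assms(2)]]
  show ?thesis by (simp add: distrib_left distrib_right single_mult_single add.commute)
qed

lemma vertex_ker:
  assumes "a \<in> {1..g}" "b \<in> {1..g}" "i < N"
  shows "a \<noteq> b \<Longrightarrow> word [gx a i, gy b i] \<in> ker" "a \<noteq> b \<Longrightarrow> word [gx a i, gx b i] \<in> ker"
    "a \<noteq> b \<Longrightarrow> word [gy a i, gy b i] \<in> ker" "word [gx a i, gy a i] - word [gx b i, gy b i] \<in> ker"
proof -
  have i: "vtx i \<in> V" using assms(3) vertex_cases by blast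
  have "t \<in> vertex_relations g V \<Longrightarrow> t \<in> ker" for t using relation_ker by blast
  note * = this[unfolded vertex_relations_def gen_products]
  show "a \<noteq> b \<Longrightarrow> word [gx a i, gy b i] \<in> ker" "a \<noteq> b \<Longrightarrow> word [gx a i, gx b i] \<in> ker"
    "a \<noteq> b \<Longrightarrow> word [gy a i, gy b i] \<in> ker" "word [gx a i, gy a i] - word [gx b i, gy b i] \<in> ker"
    using assms(1,2) i by (intro *; blast)+
qed

lemma edge_ker:
  assumes "a \<in> {1..g}" "adj i j"
  shows "word [gx a j, ge i j] - word [gx a i, ge i j] \<in> ker"
    "word [gy a j, ge i j] - word [gy a i, ge i j] \<in> ker"
proof -
  have e: "{vtx i, vtx j} \<in> E" and h: "edge_head r {vtx i, vtx j} = vtx j" "edge_tail r {vtx i, vtx j} = vtx i"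
    using assms(2) head_tail[of i j] by (auto simp: adj_def)
  have "t \<in> edge_relations g E r \<Longrightarrow> t \<in> ker" for t using relation_ker by blast
  note * = this[unfolded edge_relations_def left_diff_distrib gen_products]
  show "word [gx a j, ge i j] - word [gx a i, ge i j] \<in> ker"
    by (rule *, rule UnI1) (use assms(1) e h in \<open>force\<close>)
  show "word [gy a j, ge i j] - word [gy a i, ge i j] \<in> ker"
    by (rule *, rule UnI2) (use assms(1) e h in \<open>force\<close>)
qed

text \<open>The three edges are sorted by head, then by tail, which determines the signs.\<close>

lemma triangle_ker:
  assumes ik: "adj i k" and jk: "adj j k" and ij: "i < j"
  shows "adj i j" "word [ge i k, ge j k] - (word [ge i j, ge j k] - word [ge i j, ge i k]) \<in> ker"
proof -
  have n: "j < k" "k < N" "i < N" "j < N" "i < k" using ik jk ij by (simp_all add: adj_def)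
  show a: "adj i j" using elimination[OF ij n(1,2)] ik jk ij n by (simp add: adj_def)
  let ?es = "[{vtx i, vtx j}, {vtx i, vtx k}, {vtx j, vtx k}]"
  have cyc: "cycle_edges [vtx i, vtx j, vtx k] = set ?es"
  proof -
    have im: "cycle_edges vs = (\<lambda>m. {vs ! m, vs ! (Suc m mod length vs)}) ` {..<length vs}" for vs :: "'v list"
      unfolding cycle_edges_def by auto
    have "cycle_edges [vtx i, vtx j, vtx k] = {{vtx i, vtx j}, {vtx j, vtx k}, {vtx k, vtx i}}"
      unfolding im by (simp add: lessThan_Suc insert_commute)
    then show ?thesis by (auto simp: insert_commute)
  qed
  have "graph_cycle E [vtx i, vtx j, vtx k]"
    unfolding graph_cycle_def cyc using n ij a ik jk vtx_inj by (auto simp: adj_def)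
  moreover have "sorted_wrt (edge_less r) ?es"
    using n ij head_tail[OF ij n(4)] head_tail[OF n(5,2)] head_tail[OF n(1,2)] ord vtx_inj
    by (auto simp: edge_less_def)
  ultimately have "(\<Sum>m<length ?es. (-1) ^ Suc m * prod_list (map eg (take m ?es @ drop (Suc m) ?es))) \<in> cycle_relations E r"
    unfolding cycle_relations_def using cyc[symmetric] by blast
  then have "(\<Sum>m<length ?es. (-1) ^ Suc m * prod_list (map eg (take m ?es @ drop (Suc m) ?es))) \<in> ker"
    using relation_ker by blast
  then have "- word [ge i k, ge j k] + word [ge i j, ge j k] - word [ge i j, ge i k] \<in> ker"
    unfolding prod_list_eg by (simp add: numeral_3_eq_3)
  from ker_diff[OF ker_diff[OF this this] this] 
  show "word [ge i k, ge j k] - (word [ge i j, ge j k] - word [ge i j, ge i k]) \<in> ker"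
    by (simp add: algebra_simps)
qed

section \<open>The filtration by last letters\<close>

fun level :: "'v arr_gen \<Rightarrow> nat" where
  "level (GenX a v) = idx v" | "level (GenY a v) = idx v" | "level (GenE e) = idx (edge_head r e)"

definition Low :: "nat \<Rightarrow> 'v arr_gen set" where "Low v = {c \<in> letters. level c < v}"
definition Lev :: "nat \<Rightarrow> 'v arr_gen set" where "Lev v = {c \<in> letters. level c = v}"

lemma level_simps [simp]: "i < N \<Longrightarrow> level (gx a i) = i" "i < N \<Longrightarrow> level (gy a i) = i" "adj i j \<Longrightarrow> level (ge i j) = j"
  by (auto simp: adj_def head_tail)

lemma letters_intro [simp]:
  "a \<in> {1..g} \<Longrightarrow> i < N \<Longrightarrow> gx a i \<in> letters" "a \<in> {1..g} \<Longrightarrow> i < N \<Longrightarrow> gy a i \<in> letters" "adj i j \<Longrightarrow> ge i j \<in> letters"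
  unfolding letter_cases by blast+

lemma Lev_cases:
  assumes "c \<in> Lev v"
  shows "v < N \<and> ((\<exists>a\<in>{1..g}. c = gx a v) \<or> (\<exists>a\<in>{1..g}. c = gy a v) \<or> (\<exists>u. adj u v \<and> c = ge u v))"
proof -
  have c: "c \<in> letters" "level c = v" using assms by (simp_all add: Lev_def)
  from c(1) consider a i where "a \<in> {1..g}" "i < N" "c = gx a i" | a i where "a \<in> {1..g}" "i < N" "c = gy a i"
    | i j where "adj i j" "c = ge i j" unfolding letter_cases by blast
  then show ?thesis
  proof cases
    case 1 then show ?thesis using c(2) by auto
  next
    case 2 then show ?thesis using c(2) by auto
  next
    case 3
    then have "j = v" using c(2) level_simps(3) by metis
    then show ?thesis using 3 by (auto simp: adj_def)
  qed
qed

lemma Low_Suc: "Low (Suc v) = Low v \<union> Lev v"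
  by (auto simp: Low_def Lev_def)

text \<open>The product \<open>c s\<close> lies in the left ideal of the letters in \<open>S\<close>.\<close>

definition reduces :: "'v arr_gen set \<Rightarrow> 'v arr_gen \<Rightarrow> 'v arr_gen \<Rightarrow> bool" where
  "reduces S c s \<longleftrightarrow> (\<exists>q\<in>pres.ending_in S. word [c, s] - q \<in> ker)"

lemma word2_ending: "d \<in> letters \<Longrightarrow> c \<in> letters \<Longrightarrow> c \<in> S \<Longrightarrow> word [d, c] \<in> pres.ending_in S"
  using pres.ending_in_single[of "[d]" c S 1] by simp

lemma reduces_zero: "word [c, s] \<in> ker \<Longrightarrow> reduces S c s"
  unfolding reduces_def using pres.ending_in_closed(1) by (intro bexI[of _ 0]) simp_all

lemma reduces_neg: "\<lbrakk>word [c, s] + word [d, e] \<in> ker; d \<in> letters; e \<in> letters; e \<in> S\<rbrakk> \<Longrightarrow> reduces S c s"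
  unfolding reduces_def using word2_ending[of d e S] pres.ending_in_closed(3)
  by (intro bexI[of _ "- word [d, e]"]) simp_all

lemma reduces_pos: "\<lbrakk>word [c, s] - word [d, e] \<in> ker; d \<in> letters; e \<in> letters; e \<in> S\<rbrakk> \<Longrightarrow> reduces S c s"
  unfolding reduces_def using word2_ending[of d e S] by blast

lemma reduces_absorbs:
  assumes "\<And>c. c \<in> S'' \<Longrightarrow> reduces (S - {s}) c s" "s \<in> letters" "S'' \<subseteq> letters"
  shows "pres.absorbs S s S''"
  unfolding pres.absorbs_def
proof
  fix c assume c: "c \<in> S''"
  then obtain q where q: "q \<in> pres.ending_in (S - {s})" "word [c, s] - q \<in> ker"
    using assms(1) unfolding reduces_def by blast
  have "word [c, s] \<in> tensors letters" using c assms by auto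
  then show "\<exists>q\<in>pres.ending_in (S - {s}). pres_map (word [c, s]) = pres_map q"
    using ker_congruent[OF _ pres.ending_in_tensors[OF q(1)] q(2)] q(1) by blast
qed

text \<open>Letters of smaller level anticommute past \<open>s\<close> to the end.\<close>

lemma reduces_lower:
  assumes "c \<in> Low v" "s \<in> Lev v" "Low v \<subseteq> S"
  shows "reduces S c s"
  using assms letters_anticommute_ker[of c s] by (intro reduces_neg[of c s s c]) (auto simp: Low_def Lev_def)

text \<open>All products \<open>x\<^sup>i y\<^sup>i\<close> agree with \<open>x\<^sup>1 y\<^sup>1 = - y\<^sup>1 x\<^sup>1\<close>, which ends in \<open>x\<^sup>1\<close>.\<close>

lemma reduces_xy:
  assumes ab: "a \<in> {1..g}" "b \<in> {1..g}" and v: "v < N" and S: "a = b \<Longrightarrow> gx 1 v \<in> S"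
  shows "reduces S (gx a v) (gy b v)" "reduces S (gy b v) (gx a v)"
proof -
  note L = letters_intro(1)[OF ab(1) v] letters_intro(2)[OF ab(2) v]
  note anti = letters_anticommute_ker[OF L]
  have one: "1 \<in> {1..g}" using g_pos by simp
  note O = letters_intro(1)[OF one v] letters_intro(2)[OF one v]
  show "reduces S (gx a v) (gy b v)"
  proof (cases "a = b")
    case True
    have "(word [gx a v, gy a v] - word [gx 1 v, gy 1 v]) + (word [gx 1 v, gy 1 v] + word [gy 1 v, gx 1 v]) \<in> ker"
      by (rule ker_add[OF vertex_ker(4)[OF ab(1) one v] letters_anticommute_ker[OF O]])
    then show ?thesis using True O S by (intro reduces_neg[of _ _ "gy 1 v" "gx 1 v"]) simp_all
  qed (use vertex_ker(1)[OF ab v] in \<open>intro reduces_zero\<close>)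
  show "reduces S (gy b v) (gx a v)"
  proof (cases "a = b")
    case True
    have "(word [gx a v, gy a v] + word [gy a v, gx a v]) - (word [gx a v, gy a v] - word [gx 1 v, gy 1 v]) -
        (word [gx 1 v, gy 1 v] + word [gy 1 v, gx 1 v]) \<in> ker"
      using anti True by (intro ker_diff vertex_ker(4)[OF ab(1) one v] letters_anticommute_ker[OF O]) simp
    then show ?thesis using True O S by (intro reduces_pos[of _ _ "gy 1 v" "gx 1 v"]) simp_all
  next
    case False
    have "word [gx a v, gy b v] + word [gy b v, gx a v] - word [gx a v, gy b v] \<in> ker"
      by (rule ker_diff[OF anti vertex_ker(1)[OF ab v False]])
    then show ?thesis by (intro reduces_zero) simp
  qed
qed

lemma reduces_xx:
  assumes "a \<in> {1..g}" "b \<in> {1..g}" "v < N"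
  shows "reduces S (gx a v) (gx b v)" "reduces S (gy a v) (gy b v)"
  using vertex_ker(2,3)[OF assms] letter_square_ker assms by (cases "a = b"; auto intro!: reduces_zero)+

text \<open>The edge relation replaces \<open>x\<^sub>v\<close> by \<open>x\<^sub>u\<close>, which has smaller level and moves to the end.\<close>

lemma reduces_edge:
  assumes a: "a \<in> {1..g}" and uv: "adj u v" and S: "Low v \<subseteq> S"
  shows "reduces S (gx a v) (ge u v)" "reduces S (gy a v) (ge u v)"
    "reduces S (ge u v) (gx a v)" "reduces S (ge u v) (gy a v)"
proof -
  have n: "u < N" "v < N" "u < v" using uv by (simp_all add: adj_def)
  have low: "gx a u \<in> S" "gy a u \<in> S" using S n a by (auto simp: Low_def)
  note L = letters_intro(1)[OF a n(1)] letters_intro(2)[OF a n(1)] letters_intro(1)[OF a n(2)] letters_intro(2)[OF a n(2)] letters_intro(3)[OF uv]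
  note e = edge_ker[OF a uv]
  note k = letters_anticommute_ker[OF L(1,5)] letters_anticommute_ker[OF L(2,5)]
    letters_anticommute_ker[OF L(3,5)] letters_anticommute_ker[OF L(4,5)]
  show "reduces S (gx a v) (ge u v)"
    using ker_add[OF e(1) k(1)] L low by (intro reduces_neg[of _ _ "ge u v" "gx a u"]) simp_all
  show "reduces S (gy a v) (ge u v)"
    using ker_add[OF e(2) k(2)] L low by (intro reduces_neg[of _ _ "ge u v" "gy a u"]) simp_all
  show "reduces S (ge u v) (gx a v)"
    using ker_diff[OF ker_diff[OF k(3) e(1)] k(1)] L low by (intro reduces_pos[of _ _ "ge u v" "gx a u"]) simp_all
  show "reduces S (ge u v) (gy a v)"
    using ker_diff[OF ker_diff[OF k(4) e(2)] k(2)] L low by (intro reduces_pos[of _ _ "ge u v" "gy a u"]) simp_all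
qed

text \<open>This is where chordality enters: the third edge of the triangle is available.\<close>

lemma reduces_edges:
  assumes uv: "adj u v" and wv: "adj w v" and S: "Low v \<subseteq> S"
  shows "reduces S (ge w v) (ge u v)"
proof -
  have main: "\<exists>q\<in>pres.ending_in S. word [ge i v, ge j v] - q \<in> ker" if ij: "i < j" and iv: "adj i v" and jv: "adj j v" for i j
  proof -
    note t = triangle_ker[OF iv jv ij]
    note L = letters_intro(3)[OF t(1)] letters_intro(3)[OF iv] letters_intro(3)[OF jv]
    have low: "ge i j \<in> S" using S t(1) L(1) jv by (auto simp: Low_def adj_def head_tail)
    let ?q = "- word [ge j v, ge i j] + word [ge i v, ge i j]"
    have "(word [ge i v, ge j v] - (word [ge i j, ge j v] - word [ge i j, ge i v]))
       + (word [ge i j, ge j v] + word [ge j v, ge i j]) - (word [ge i j, ge i v] + word [ge i v, ge i j]) \<in> ker"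
      by (intro ker_add ker_diff t(2) letters_anticommute_ker L)
    then have "word [ge i v, ge j v] - ?q \<in> ker" by (simp add: algebra_simps)
    moreover have "?q \<in> pres.ending_in S"
      by (intro pres.ending_in_closed(2,3) word2_ending L low)
    ultimately show ?thesis by blast
  qed
  note L = letters_intro(3)[OF uv] letters_intro(3)[OF wv]
  consider "w < u" | "w = u" | "u < w" by linarith
  then show ?thesis
  proof cases
    case 1
    show ?thesis unfolding reduces_def by (rule main[OF 1 wv uv])
  next
    case 2
    then show ?thesis using letter_square_ker[OF L(1)] by (intro reduces_zero) simp
  next
    case 3
    obtain q where q: "q \<in> pres.ending_in S" "word [ge u v, ge w v] - q \<in> ker" using main[OF 3 uv wv] by blast
    have "(word [ge u v, ge w v] + word [ge w v, ge u v]) - (word [ge u v, ge w v] - q) \<in> ker"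
      by (intro ker_diff letters_anticommute_ker L q)
    then have "word [ge w v, ge u v] - (- q) \<in> ker" by (simp add: algebra_simps)
    then show ?thesis unfolding reduces_def using pres.ending_in_closed(3)[OF q(1)] by blast
  qed
qed

text \<open>\<open>T\<close> is the set of letters of level \<open>v\<close> that come before \<open>s\<close>; \<open>x\<^sup>1\<close> comes first and \<open>y\<^sup>1\<close> last.\<close>

definition next_letter :: "nat \<Rightarrow> 'v arr_gen set \<Rightarrow> 'v arr_gen \<Rightarrow> bool" where
  "next_letter v T s \<longleftrightarrow> v < N \<and> s \<in> Lev v \<and> s \<notin> T \<and> T \<subseteq> Lev v \<and> (s = gx 1 v \<longleftrightarrow> T = {}) \<and>
     (T \<noteq> {} \<longrightarrow> gx 1 v \<in> T) \<and> gy 1 v \<notin> T"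

text \<open>The letters that cannot precede \<open>s\<close> in a normal word: those of level at most \<open>v\<close>, except that
  \<open>y\<^sup>1 x\<^sup>1\<close> is normal.\<close>

definition colon :: "nat \<Rightarrow> 'v arr_gen \<Rightarrow> 'v arr_gen set" where
  "colon v s = Low (Suc v) - (if s = gx 1 v then {gy 1 v} else {})"

lemma reduces_colon:
  assumes T: "next_letter v T s" and c: "c \<in> colon v s"
  shows "reduces (Low v \<union> T) c s"
proof -
  have v: "v < N" and s: "s \<in> Lev v" using T by (simp_all add: next_letter_def)
  have S: "Low v \<subseteq> Low v \<union> T" by blast
  consider "c \<in> Low v" | "c \<in> Lev v" using c by (auto simp: colon_def Low_Suc)
  then show ?thesis
  proof cases
    case 1
    then show ?thesis by (rule reduces_lower[OF _ s S])
  next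
    case 2
    have x1: "gx 1 v \<in> Low v \<union> T" if "s \<noteq> gx 1 v" using T that by (auto simp: next_letter_def)
    from Lev_cases[OF 2] consider (x) a where "a \<in> {1..g}" "c = gx a v" | (y) a where "a \<in> {1..g}" "c = gy a v"
      | (e) u where "adj u v" "c = ge u v" by blast
    note cc = this
    from Lev_cases[OF s] consider (x) b where "b \<in> {1..g}" "s = gx b v" | (y) b where "b \<in> {1..g}" "s = gy b v"
      | (e) u where "adj u v" "s = ge u v" by blast
    then show ?thesis
    proof cases
      case x
      note s = x
      from cc show ?thesis
      proof cases
        case x then show ?thesis using s v reduces_xx(1) by simp
      next
        case y
        have "gx 1 v \<in> Low v \<union> T" if "b = a"
          using x1 s y that c by (auto simp: colon_def split: if_splits)
        then show ?thesis using s y v reduces_xy(2) by simp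
      next
        case e then show ?thesis using s reduces_edge(3)[OF _ _ S] by simp
      qed
    next
      case y
      note s = y
      from cc show ?thesis
      proof cases
        case x
        then show ?thesis using s v x1 reduces_xy(1) by simp
      next
        case y then show ?thesis using s v reduces_xx(2) by simp
      next
        case e then show ?thesis using s reduces_edge(4)[OF _ _ S] by simp
      qed
    next
      case e
      note s = e
      from cc show ?thesis
      proof cases
        case x then show ?thesis using s reduces_edge(1)[OF _ _ S] by simp
      next
        case y then show ?thesis using s reduces_edge(2)[OF _ _ S] by simp
      next
        case e then show ?thesis using s reduces_edges[OF _ _ S] by simp
      qed
    qed
  qed
qed

section \<open>Normal words and their dual functionals\<close>

text \<open>Normal words correspond to states: each level contributes the block of the state of its vertex.\<close>

definition allowed :: "nat \<Rightarrow> fibre set" where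
  "allowed i = (if i < N then {Unit, FTop} \<union> FX ` {1..g} \<union> FY ` {1..g} \<union> FEdge ` {u. adj u i} else {Unit})"

definition valid :: "state \<Rightarrow> bool" where "valid \<sigma> \<longleftrightarrow> (\<forall>i. \<sigma> i \<in> allowed i)"

fun block :: "nat \<Rightarrow> fibre \<Rightarrow> 'v arr_gen list" where
  "block k Unit = []" | "block k (FX a) = [gx a k]" | "block k (FY a) = [gy a k]"
| "block k FTop = [gy 1 k, gx 1 k]" | "block k (FEdge u) = [ge u k]"

definition word_from :: "nat \<Rightarrow> state \<Rightarrow> 'v arr_gen list" where
  "word_from k \<sigma> = concat (map (\<lambda>i. block i (\<sigma> i)) (rev [k..<N]))"

abbreviation normal_word :: "state \<Rightarrow> 'v arr_gen list" where "normal_word \<equiv> word_from 0"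

text \<open>The forest of a state; a vertex that is not excited by an edge is a root.\<close>

definition parent :: "state \<Rightarrow> nat \<Rightarrow> nat" where
  "parent \<sigma> v = (case \<sigma> v of FEdge u \<Rightarrow> u | _ \<Rightarrow> v)"

definition at_state :: "state \<Rightarrow> state \<Rightarrow> rat" where "at_state \<sigma> \<tau> = (if \<tau> = \<sigma> then 1 else 0)"

abbreviation vacuum :: state where "vacuum \<equiv> (\<lambda>_. Unit)"

lemma word_from_Suc: "k < N \<Longrightarrow> word_from k \<sigma> = word_from (Suc k) \<sigma> @ block k (\<sigma> k)"
  by (simp add: word_from_def upt_conv_Cons)

lemma word_from_cong: "(\<And>i. k \<le> i \<Longrightarrow> i < N \<Longrightarrow> \<sigma> i = \<sigma>' i) \<Longrightarrow> word_from k \<sigma> = word_from k \<sigma>'"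
  unfolding word_from_def by (intro arg_cong[of _ _ concat] map_cong) auto

lemma normal_word_skip: "k \<le> N \<Longrightarrow> (\<And>i. i < k \<Longrightarrow> \<sigma> i = Unit) \<Longrightarrow> normal_word \<sigma> = word_from k \<sigma>"
proof (induction k)
  case (Suc k)
  then show ?case using word_from_Suc[of k \<sigma>] by simp
qed simp

lemma parent_edge: "valid \<sigma> \<Longrightarrow> \<sigma> k = FEdge u \<Longrightarrow> u < k \<and> adj u k \<and> parent \<sigma> k = u"
proof -
  assume "valid \<sigma>" "\<sigma> k = FEdge u"
  moreover from this have "FEdge u \<in> allowed k" unfolding valid_def by metis
  ultimately show ?thesis by (auto simp: allowed_def parent_def adj_def split: if_splits)
qed

lemma parent_root: "(\<And>u. \<sigma> k \<noteq> FEdge u) \<Longrightarrow> parent \<sigma> k = k"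
  by (cases "\<sigma> k") (auto simp: parent_def)

lemma climb_root: "parent \<sigma> k = k \<Longrightarrow> climb (parent \<sigma>) \<tau> k = k"
  by (subst climb.simps) simp

lemma meet_label_root: "parent \<sigma> k = k \<Longrightarrow> u < k \<Longrightarrow> meet_label (parent \<sigma>) u k = None"
  by (subst meet_label.simps) simp

lemma fock_image_edge: "adj u k \<Longrightarrow> fock_image p (ge u k) = map_option (\<lambda>z. (FEdge (p z), z)) (meet_label p u k)"
  by (auto simp: adj_def head_tail)

text \<open>An operator at a vertex above which, and at which, the state is trivial has no sign.\<close>

lemma letter_op_top:
  assumes "fock_image p c = Some (l, k)" "\<And>i. k \<le> i \<Longrightarrow> \<tau> i = Unit"
  shows "letter_op p c f \<tau> = f (\<tau>(k := l))"
proof -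
  have "jw_sign N k \<tau> = 1" unfolding jw_sign_def using assms(2) by simp
  then show ?thesis using assms by (simp add: letter_op_def fock_op_def)
qed

text \<open>One level of the evaluation.  \<open>F\<close> stands for the blocks of larger level; if these agree with
  \<open>\<sigma>\<close> (condition \<open>C\<close>), they leave the vertices up to \<open>k\<close> alone, so the block of level \<open>k\<close> has to put \<open>k\<close> into
  the state \<open>\<sigma> k\<close>.\<close>

lemma block_act:
  assumes vs: "valid \<sigma>" "valid \<sigma>'" and k: "k < N"
    and F: "\<And>\<tau>. (\<And>i. Suc k \<le> i \<Longrightarrow> \<tau> i = Unit) \<Longrightarrow> F \<tau> = (if C \<and> (\<forall>i<Suc k. \<tau> i = \<sigma> i) then 1 else 0)"
    and \<tau>: "\<And>i. k \<le> i \<Longrightarrow> \<tau> i = Unit"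
  shows "fock.word_act (parent \<sigma>) (block k (\<sigma>' k)) F \<tau> =
    (if C \<and> \<sigma> k = \<sigma>' k \<and> (\<forall>i<k. \<tau> i = \<sigma> i) then 1 else 0)"
proof -
  let ?p = "parent \<sigma>"
  have hit: "F (\<tau>(k := l)) = (if C \<and> \<sigma> k = l \<and> (\<forall>i<k. \<tau> i = \<sigma> i) then 1 else 0)" for l
    using \<tau> by (subst F) (auto simp: less_Suc_eq)
  have miss: "F (\<tau>(z := l)) = 0" if "z < k" "\<sigma> k \<noteq> Unit" for z l
  proof -
    have "F (\<tau>(z := l)) = (if C \<and> (\<forall>i<Suc k. (\<tau>(z := l)) i = \<sigma> i) then 1 else 0)"
      using \<tau> that by (intro F) auto
    moreover have "(\<tau>(z := l)) k \<noteq> \<sigma> k" using \<tau>[of k] that by auto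
    ultimately show ?thesis using lessI[of k] by (auto simp del: fun_upd_apply)
  qed
  have miss1: "letter_op ?p c F \<tau> = 0" if "fock_image ?p c = Some (l, z)" "z < k" "\<sigma> k \<noteq> Unit" for c l z
    using miss[OF that(2,3)] that(1) by (simp add: letter_op_def fock_op_def)
  have climb: "climb ?p 0 k = k \<and> (\<forall>u. \<sigma> k \<noteq> FEdge u) \<or> climb ?p 0 k < k \<and> (\<exists>u. \<sigma> k = FEdge u)"
  proof (cases "\<exists>u. \<sigma> k = FEdge u")
    case True
    then obtain u where u: "\<sigma> k = FEdge u" "u < k" "?p k = u" using parent_edge[OF vs(1)] by blast
    then have "climb ?p 0 k = climb ?p 0 u" by (subst climb.simps) simp
    then show ?thesis using climb_le[of ?p 0 u] u by auto
  next
    case False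
    then show ?thesis using climb_root parent_root by blast
  qed
  show ?thesis
  proof (cases "\<sigma>' k")
    case Unit
    then show ?thesis using hit[of Unit] \<tau>[of k] by (simp add: fun_upd_idem)
  next
    case (FX a)
    then show ?thesis using climb letter_op_top[OF _ \<tau>, of ?p "gx a k" "FX a"] miss1[of "gx a k" "FX a"] hit k by auto
  next
    case (FY a)
    then show ?thesis using climb letter_op_top[OF _ \<tau>, of ?p "gy a k" "FY a"] miss1[of "gy a k" "FY a"] hit k by auto
  next
    case FTop
    have "fock.word_act ?p (block k FTop) F \<tau> = fibre_coeff (FX 1) (\<tau> (climb ?p 0 k)) *
      fibre_coeff (FY 1) (fibre_next (FX 1) (\<tau> (climb ?p 0 k))) *
      F (\<tau>(climb ?p 0 k := fibre_next (FY 1) (fibre_next (FX 1) (\<tau> (climb ?p 0 k)))))"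
      using k by (simp add: letter_op_simps fock_op_same_vertex)
    note e = this
    from climb show ?thesis
    proof (elim disjE conjE)
      assume "climb ?p 0 k = k"
      then have "fock.word_act ?p (block k FTop) F \<tau> = F (\<tau>(k := FTop))" using e \<tau>[of k] by simp
      then show ?thesis unfolding FTop hit .
    next
      assume l: "climb ?p 0 k < k" "\<exists>u. \<sigma> k = FEdge u"
      then have "fock.word_act ?p (block k FTop) F \<tau> = 0" using e miss[OF l(1)] by auto
      then show ?thesis using l(2) FTop by auto
    qed
  next
    case (FEdge u)
    have uk: "adj u k" "u < k" using parent_edge[OF vs(2) FEdge] by simp_all
    note im = fock_image_edge[OF uk(1), of ?p]
    show ?thesis
    proof (cases "\<exists>u'. \<sigma> k = FEdge u'")
      case False
      then have "meet_label ?p u k = None" using meet_label_root parent_root uk(2) by blast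
      then show ?thesis using im FEdge False by (simp add: letter_op_def)
    next
      case True
      then obtain u' where u': "\<sigma> k = FEdge u'" by blast
      note e = parent_edge[OF vs(1) u']
      have m: "meet_label ?p u k = (if u' = u then Some k else meet_label ?p u u')"
        using uk(2) e by (subst meet_label.simps) simp
      show ?thesis
      proof (cases "u' = u")
        case True
        then have "fock_image ?p (ge u k) = Some (FEdge u, k)" using im m e by simp
        from letter_op_top[OF this \<tau>] show ?thesis using hit[of "FEdge u"] FEdge by simp
      next
        case False
        then have "fock.word_act ?p (block k (\<sigma>' k)) F \<tau> = 0"
        proof (cases "meet_label ?p u u'")
          case None
          then show ?thesis using im m False FEdge by (simp add: letter_op_def)
        next
          case (Some z)
          then have "z < k" using meet_label_le[OF Some] uk(2) e by linarith
          moreover have "fock_image ?p (ge u k) = Some (FEdge (?p z), z)" using im m False Some by simp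
          ultimately show ?thesis using miss1[of "ge u k" "FEdge (?p z)" z] u' FEdge by simp
        qed
        then show ?thesis using False u' FEdge by simp
      qed
    qed
  qed
qed

text \<open>Word and state are compared level by level, from the top: the empty part of the word leaves the
  function \<open>at_state \<sigma>\<close>.\<close>

lemma word_from_act:
  assumes vs: "valid \<sigma>" "valid \<sigma>'" and k: "k \<le> N" and \<tau>: "\<And>i. k \<le> i \<Longrightarrow> \<tau> i = Unit"
  shows "fock.word_act (parent \<sigma>) (word_from k \<sigma>') (at_state \<sigma>) \<tau> =
    (if (\<forall>i\<ge>k. \<sigma> i = \<sigma>' i) \<and> (\<forall>i<k. \<tau> i = \<sigma> i) then 1 else 0)"
  using k \<tau>
proof (induction k arbitrary: \<tau> rule: inc_induct)
  case base
  have "\<sigma> i = Unit" "\<sigma>' i = Unit" if "N \<le> i" for i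
    using vs that unfolding valid_def allowed_def by (metis leD singletonD)+
  then show ?case using base by (auto simp: word_from_def at_state_def fun_eq_iff) (metis leI)+
next
  case (step k)
  have "fock.word_act (parent \<sigma>) (word_from k \<sigma>') (at_state \<sigma>) \<tau> =
      fock.word_act (parent \<sigma>) (block k (\<sigma>' k)) (fock.word_act (parent \<sigma>) (word_from (Suc k) \<sigma>') (at_state \<sigma>)) \<tau>"
    using word_from_Suc[of k \<sigma>'] step.hyps by simp
  also have "\<dots> = (if (\<forall>i\<ge>Suc k. \<sigma> i = \<sigma>' i) \<and> \<sigma> k = \<sigma>' k \<and> (\<forall>i<k. \<tau> i = \<sigma> i) then 1 else 0)"
    by (rule block_act[OF vs step.hyps(2) step.IH step.prems])
  also have "((\<forall>i\<ge>Suc k. \<sigma> i = \<sigma>' i) \<and> \<sigma> k = \<sigma>' k \<and> (\<forall>i<k. \<tau> i = \<sigma> i)) =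
      ((\<forall>i\<ge>k. \<sigma> i = \<sigma>' i) \<and> (\<forall>i<k. \<tau> i = \<sigma> i))"
    by (metis Suc_le_eq le_eq_less_or_eq)
  finally show ?case .
qed

text \<open>The coefficient of the state \<open>\<sigma>\<close> in the image of the vacuum, in the representation given by the
  forest of \<open>\<sigma>\<close>.\<close>

definition functional :: "state \<Rightarrow> ('v arr_gen list \<Rightarrow>\<^sub>0 rat) \<Rightarrow> rat" where
  "functional \<sigma> t = fock.poly_act (parent \<sigma>) t (at_state \<sigma>) vacuum"

lemma functional_dual:
  assumes "valid \<sigma>" "valid \<sigma>'"
  shows "functional \<sigma> (word (normal_word \<sigma>')) = (if \<sigma> = \<sigma>' then 1 else 0)"
  using word_from_act[OF assms, of 0 vacuum] by (auto simp: functional_def fock.poly_act_single)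

text \<open>Operators never undo an excitation: they increase the state of each vertex in this order.\<close>

fun fibre_le :: "fibre \<Rightarrow> fibre \<Rightarrow> bool" where
  "fibre_le Unit l = True" | "fibre_le (FX a) l = (l = FX a \<or> l = FTop)" | "fibre_le (FY a) l = (l = FY a \<or> l = FTop)"
| "fibre_le FTop l = (l = FTop)" | "fibre_le (FEdge u) l = (l = FEdge u)"

lemma fibre_le_refl: "fibre_le l l" by (cases l) auto

lemma fibre_le_next: "fibre_coeff k l \<noteq> 0 \<Longrightarrow> fibre_le (fibre_next k l) m \<Longrightarrow> fibre_le l m"
  by (cases k; cases l; cases m) (auto split: if_splits)

lemma word_act_support:
  "fock.word_act p w (at_state \<sigma>) \<tau> \<noteq> 0 \<Longrightarrow> fibre_le (\<tau> z) (\<sigma> z)"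
proof -
  have "(\<forall>\<tau>. f \<tau> \<noteq> 0 \<longrightarrow> (\<forall>z. fibre_le (\<tau> z) (\<sigma> z))) \<Longrightarrow> fock.word_act p w f \<tau> \<noteq> 0 \<Longrightarrow> fibre_le (\<tau> z) (\<sigma> z)" for f
  proof (induction w arbitrary: f)
    case (Cons c w)
    have "fibre_le (\<tau> z) (\<sigma> z)" if n: "letter_op p c f \<tau> \<noteq> 0" for \<tau> z
    proof -
      obtain k y where im: "fock_image p c = Some (k, y)"
        using n by (cases "fock_image p c") (auto simp: letter_op_def)
      have f: "f (\<tau>(y := fibre_next k (\<tau> y))) \<noteq> 0" "fibre_coeff k (\<tau> y) \<noteq> 0"
        using n im by (auto simp: letter_op_def fock_op_def)
      then have "fibre_le ((\<tau>(y := fibre_next k (\<tau> y))) z) (\<sigma> z)" using Cons.prems(1) by blast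
      then show ?thesis using fibre_le_next[OF f(2)] by (cases "z = y") auto
    qed
    then show ?case using Cons.IH[of "letter_op p c f"] Cons.prems(2) by simp
  qed simp
  from this[of "at_state \<sigma>"] show "fock.word_act p w (at_state \<sigma>) \<tau> \<noteq> 0 \<Longrightarrow> fibre_le (\<tau> z) (\<sigma> z)"
    by (auto simp: at_state_def fibre_le_refl split: if_splits)
qed

text \<open>The last letter acts on the vacuum first, so what it creates must be part of \<open>\<sigma>\<close>.\<close>

lemma letter_kills:
  assumes "\<And>k z. fock_image p c = Some (k, z) \<Longrightarrow> \<not> fibre_le k (\<sigma> z)"
  shows "fock.word_act p (u @ [c]) (at_state \<sigma>) vacuum = 0"
proof (cases "fock_image p c")
  case (Some kz)
  then obtain k z where im: "fock_image p c = Some (k, z)" by (cases kz) auto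
  have "fock.word_act p u (at_state \<sigma>) (vacuum(z := k)) = 0"
    using word_act_support[of p u \<sigma> "vacuum(z := k)" z] assms[OF im] by auto
  then show ?thesis by (simp add: letter_op_def im fock_op_def)
qed (simp add: letter_op_def)

definition normal_words :: "'v arr_gen set \<Rightarrow> 'v arr_gen list set" where
  "normal_words S = {normal_word \<sigma> | \<sigma>. valid \<sigma> \<and> (normal_word \<sigma> = [] \<or> last (normal_word \<sigma>) \<notin> S)}"

lemma one_in: "1 \<in> {1..g}" using g_pos by simp

lemma x1_Lev: "v < N \<Longrightarrow> gx 1 v \<in> Lev v" and y1_Lev: "v < N \<Longrightarrow> gy 1 v \<in> Lev v"
  using letters_intro(1,2)[OF one_in, of v] by (simp_all add: Lev_def)

lemma block_letters:
  assumes "v < N" "l \<in> allowed v"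
  shows "set (block v l) \<subseteq> Lev v"
  using assms letters_intro[of _ v] level_simps(3)[of _ v] one_in x1_Lev y1_Lev by (auto simp: allowed_def Lev_def)

lemma normal_word_letters: "valid \<sigma> \<Longrightarrow> normal_word \<sigma> \<in> lists letters"
  using block_letters unfolding word_from_def valid_def Lev_def by fastforce

lemma finite_valid: "finite {\<sigma>. valid \<sigma>}"
proof -
  let ?R = "{Unit, FTop} \<union> FX ` {1..g} \<union> FY ` {1..g} \<union> FEdge ` {..<N}"
  have "finite {\<sigma>. \<forall>i. (i \<in> {..<N} \<longrightarrow> \<sigma> i \<in> ?R) \<and> (i \<notin> {..<N} \<longrightarrow> \<sigma> i = Unit)}"
    by (rule finite_set_of_finite_funs) auto
  moreover have "{\<sigma>. valid \<sigma>} \<subseteq> {\<sigma>. \<forall>i. (i \<in> {..<N} \<longrightarrow> \<sigma> i \<in> ?R) \<and> (i \<notin> {..<N} \<longrightarrow> \<sigma> i = Unit)}"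
  proof (clarify, intro conjI impI)
    fix \<sigma> i assume v: "valid \<sigma>"
    then have a: "\<sigma> i \<in> allowed i" by (simp add: valid_def)
    show "\<sigma> i \<in> ?R" if "i \<in> {..<N}" using a that by (auto simp: allowed_def adj_def)
    show "\<sigma> i = Unit" if "i \<notin> {..<N}" using a that by (auto simp: allowed_def)
  qed
  ultimately show ?thesis by (rule finite_subset[rotated])
qed

lemma last_letter:
  assumes v: "valid \<sigma>" and k: "\<sigma> k \<noteq> Unit" "\<And>i. i < k \<Longrightarrow> \<sigma> i = Unit"
  shows "k < N" "normal_word \<sigma> = word_from (Suc k) \<sigma> @ block k (\<sigma> k)" "normal_word \<sigma> \<noteq> []"
    "last (normal_word \<sigma>) = last (block k (\<sigma> k))" "last (normal_word \<sigma>) \<in> Lev k"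
proof -
  have a: "\<sigma> k \<in> allowed k" using v by (simp add: valid_def)
  show kN: "k < N" using a k(1) by (auto simp: allowed_def split: if_splits)
  show w: "normal_word \<sigma> = word_from (Suc k) \<sigma> @ block k (\<sigma> k)"
    using normal_word_skip[of k \<sigma>] k(2) kN word_from_Suc[OF kN] by simp
  have b: "block k (\<sigma> k) \<noteq> []" using k(1) by (cases "\<sigma> k") auto
  then show "normal_word \<sigma> \<noteq> []" "last (normal_word \<sigma>) = last (block k (\<sigma> k))" by (simp_all add: w)
  then show "last (normal_word \<sigma>) \<in> Lev k" using block_letters[OF kN a] b last_in_set by force
qed

text \<open>A word in \<open>normal_words (colon v s)\<close> has only blocks of levels greater than \<open>v\<close>, or ends in \<open>y\<^sub>v\<^sup>1\<close> while
  \<open>s\<close> is \<open>x\<^sub>v\<^sup>1\<close>; so \<open>s\<close> becomes the block of level \<open>v\<close> or completes it.\<close>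

lemma extend_normal_word:
  assumes T: "next_letter v T s" and w: "w \<in> normal_words (colon v s)"
  shows "\<exists>\<sigma>. valid \<sigma> \<and> normal_word \<sigma> = w @ [s] \<and> (\<forall>i<v. \<sigma> i = Unit) \<and>
    (block v (\<sigma> v) = [s] \<or> s = gx 1 v \<and> \<sigma> v = FTop)"
proof -
  have v: "v < N" and s: "s \<in> Lev v" using T by (simp_all add: next_letter_def)
  obtain \<tau> where \<tau>: "valid \<tau>" "w = normal_word \<tau>" "normal_word \<tau> = [] \<or> last (normal_word \<tau>) \<notin> colon v s"
    using w by (auto simp: normal_words_def)
  have low: "(\<forall>i<v. \<tau> i = Unit) \<and> (\<tau> v = Unit \<or> \<tau> v = FY 1 \<and> s = gx 1 v)"
  proof (cases "\<exists>i\<le>v. \<tau> i \<noteq> Unit")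
    case True
    then obtain i where i: "i \<le> v" "\<tau> i \<noteq> Unit" by blast
    define k where "k = (LEAST i. \<tau> i \<noteq> Unit)"
    have k: "\<tau> k \<noteq> Unit" "\<And>i. i < k \<Longrightarrow> \<tau> i = Unit" "k \<le> v"
      unfolding k_def using LeastI[of "\<lambda>i. \<tau> i \<noteq> Unit", OF i(2)] not_less_Least Least_le[of "\<lambda>i. \<tau> i \<noteq> Unit", OF i(2)] i(1)
      by (auto simp: le_trans)
    note l = last_letter[OF \<tau>(1) k(1,2)]
    have "last (normal_word \<tau>) \<in> Low (Suc v)" using l(5) k(3) by (auto simp: Low_def Lev_def)
    then have y: "last (normal_word \<tau>) = gy 1 v" "s = gx 1 v"
      using \<tau>(3) l(3) by (auto simp: colon_def split: if_splits)
    have "k = v" using l(5) y(1) v by (simp add: Lev_def)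
    then have "last (block v (\<tau> v)) = gy 1 v" using l(4) y(1) by simp
    then have "\<tau> v = FY 1" using k(1) \<open>k = v\<close> by (cases "\<tau> v") auto
    then show ?thesis using k(2) \<open>k = v\<close> y(2) by blast
  qed auto
  obtain l where l: "l \<in> allowed v" "block v l = [s]"
  proof -
    from Lev_cases[OF s] consider (x) a where "a \<in> {1..g}" "s = gx a v" | (y) a where "a \<in> {1..g}" "s = gy a v"
      | (e) u where "adj u v" "s = ge u v" by blast
    then show ?thesis
    proof cases
      case x then show ?thesis using that[of "FX a" for a] v unfolding allowed_def by auto
    next
      case y then show ?thesis using that[of "FY a" for a] v unfolding allowed_def by auto
    next
      case e then show ?thesis using that[of "FEdge u" for u] v unfolding allowed_def by auto
    qed
  qed
  \<comment> \<open>an occupied level \<open>v\<close> holds \<open>y\<^sup>1\<close>, which \<open>x\<^sup>1\<close> completes to the top class\<close>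
  define m where "m = (if \<tau> v = Unit then l else FTop)"
  define \<sigma> where "\<sigma> = \<tau>(v := m)"
  have "FTop \<in> allowed v" using v by (simp add: allowed_def)
  then have "m \<in> allowed v" using l(1) by (simp add: m_def)
  then have "valid \<sigma>" using \<tau>(1) by (simp add: valid_def \<sigma>_def)
  moreover have "normal_word \<sigma> = w @ [s]"
  proof -
    have "normal_word \<sigma> = word_from (Suc v) \<sigma> @ block v m"
      using normal_word_skip[of v \<sigma>] low v word_from_Suc[OF v, of \<sigma>] by (simp add: \<sigma>_def)
    also have "word_from (Suc v) \<sigma> = word_from (Suc v) \<tau>" by (rule word_from_cong) (simp add: \<sigma>_def)
    also have "block v m = block v (\<tau> v) @ [s]" using low l(2) by (auto simp: m_def)
    also have "word_from (Suc v) \<tau> @ block v (\<tau> v) @ [s] = normal_word \<tau> @ [s]"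
      using normal_word_skip[of v \<tau>] low v word_from_Suc[OF v, of \<tau>] by simp
    finally show ?thesis by (simp add: \<tau>(2))
  qed
  moreover have "block v (\<sigma> v) = [s] \<or> s = gx 1 v \<and> \<sigma> v = FTop"
    using low l(2) by (auto simp: \<sigma>_def m_def)
  ultimately show ?thesis using low by (intro exI[of _ \<sigma>]) (simp add: \<sigma>_def)
qed

text \<open>Vertices below \<open>v\<close> are roots of the forest of \<open>\<sigma>\<close> and unexcited in \<open>\<sigma>\<close>.  A letter of smaller level acts
  at such a vertex or as 0.  The same holds for a letter of level \<open>v\<close> different from \<open>s\<close> if \<open>s\<close> is
  an edge \<open>{w, v}\<close>, since \<open>v\<close> climbs to \<open>w\<close>; if \<open>s\<close> is not an edge, the letter acts as 0 or excites \<open>v\<close> to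
  a state not below that of \<open>\<sigma>\<close>.\<close>

lemma earlier_letters_killed:
  assumes T: "next_letter v T s" and sg: "valid \<sigma>" "\<And>i. i < v \<Longrightarrow> \<sigma> i = Unit"
    and sv: "block v (\<sigma> v) = [s] \<or> s = gx 1 v \<and> \<sigma> v = FTop" and c: "c \<in> Low v \<union> T"
  shows "fock.word_act (parent \<sigma>) (u @ [c]) (at_state \<sigma>) vacuum = 0"
proof (rule letter_kills)
  fix k z assume im: "fock_image (parent \<sigma>) c = Some (k, z)"
  let ?p = "parent \<sigma>"
  have v: "v < N" using T by (simp add: next_letter_def)
  have root: "?p i = i" if "i < v" for i using sg(2)[OF that] by (simp add: parent_def)
  consider "c \<in> Low v" | "c \<in> T" using c by blast
  then show "\<not> fibre_le k (\<sigma> z)"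
  proof cases
    case 1
    then obtain t where t: "t < v" "c \<in> Lev t" by (auto simp: Low_def Lev_def)
    note r = climb_root[OF root[OF t(1)], of 0]
    from Lev_cases[OF t(2)] consider (x) a where "c = gx a t" | (y) a where "c = gy a t"
      | (e) u where "adj u t" "c = ge u t" by blast
    then show ?thesis
    proof cases
      case (e u)
      then show ?thesis using im fock_image_edge[OF e(1), of ?p] meet_label_root[OF root[OF t(1)], of u]
        by (simp add: adj_def)
    qed (use im r sg(2)[OF t(1)] t(1) v in auto)
  next
    case 2
    then have T': "c \<in> Lev v" "s \<noteq> gx 1 v" "c \<noteq> s" using T by (auto simp: next_letter_def)
    then have sv': "block v (\<sigma> v) = [s]" using sv by simp
    show ?thesis
    proof (cases "\<exists>u. \<sigma> v = FEdge u")
      case False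
      then have rv: "?p v = v" by (intro parent_root) blast
      note r = climb_root[OF rv, of 0]
      from Lev_cases[OF T'(1)] consider (x) a where "c = gx a v" | (y) a where "c = gy a v"
        | (e) u where "adj u v" "c = ge u v" by blast
      then show ?thesis
      proof cases
        case x
        then show ?thesis using im r v sv' T'(3) by (cases "\<sigma> v") auto
      next
        case y
        then show ?thesis using im r v sv' T'(3) by (cases "\<sigma> v") auto
      next
        case (e u)
        then show ?thesis using im fock_image_edge[OF e(1), of ?p] meet_label_root[OF rv, of u]
          by (simp add: adj_def)
      qed
    next
      case True
      then obtain w where w: "\<sigma> v = FEdge w" by blast
      note pw = parent_edge[OF sg(1) w]
      have rw: "?p w = w" using root pw by blast
      have cv: "climb ?p 0 v = w"
        using pw climb_root[OF rw, of 0] by (subst climb.simps) simp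
      have sw: "\<sigma> w = Unit" using sg(2) pw by blast
      from Lev_cases[OF T'(1)] consider (x) a where "c = gx a v" | (y) a where "c = gy a v"
        | (e) u where "adj u v" "c = ge u v" by blast
      then show ?thesis
      proof cases
        case x
        then show ?thesis using im cv v sw by auto
      next
        case y
        then show ?thesis using im cv v sw by auto
      next
        case (e u)
        have uw: "u \<noteq> w" using sv' w e(2) T'(3) by auto
        have u: "u < v" "?p u = u" using e(1) root by (auto simp: adj_def)
        have "climb ?p 0 u \<noteq> climb ?p 0 w" using climb_root[OF u(2), of 0] climb_root[OF rw, of 0] uw by simp
        then have "meet_label ?p u w = None" using climb_eq_iff[OF uw, of ?p 0] by (cases "meet_label ?p u w") auto
        moreover have "meet_label ?p u v = meet_label ?p u w"
          using u(1) pw uw by (subst meet_label.simps) auto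
        ultimately show ?thesis using im e fock_image_edge[OF e(1), of ?p] by simp
      qed
    qed
  qed
qed

lemma Low_disjoint: "s \<in> Lev v \<Longrightarrow> s \<notin> Low v" by (simp add: Low_def Lev_def)

lemma word_step_arrangement:
  assumes T: "next_letter v T s"
  shows "pres.word_step normal_words (insert s (Low v \<union> T)) s (colon v s)"
proof -
  let ?S = "Low v \<union> T" and ?W = "normal_words (colon v s)"
  have v: "v < N" and s: "s \<in> Lev v" "s \<in> letters" and TL: "T \<subseteq> Lev v" and sT: "s \<notin> T"
    using T by (simp_all add: next_letter_def Lev_def)
  have d: "insert s ?S - {s} = ?S" using Low_disjoint[OF s(1)] sT by blast
  define st where "st w = (SOME \<sigma>. valid \<sigma> \<and> normal_word \<sigma> = w @ [s] \<and> (\<forall>i<v. \<sigma> i = Unit) \<and>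
    (block v (\<sigma> v) = [s] \<or> s = gx 1 v \<and> \<sigma> v = FTop))" for w
  have st: "valid (st w)" "normal_word (st w) = w @ [s]" "\<And>i. i < v \<Longrightarrow> st w i = Unit"
    "block v (st w v) = [s] \<or> s = gx 1 v \<and> st w v = FTop" if "w \<in> ?W" for w
    using someI_ex[OF extend_normal_word[OF T that]] unfolding st_def[symmetric] by blast+
  let ?l = "\<lambda>w. functional (st w)"
  have "pres.dual_functionals ?W ?S s ?l"
    unfolding pres.dual_functionals_def
  proof (intro conjI ballI allI impI)
    fix w p q c
    show "?l w (p + q) = ?l w p + ?l w q" by (simp add: functional_def fock.poly_act_add)
    show "?l w (scale c p) = c * ?l w p" by (simp add: functional_def fock.poly_act_scale)
  next
    fix w p assume "p \<in> tensors letters" "pres_map p = \<zero>\<^bsub>exterior_quotient letters relations\<^esub>"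
    then show "?l w p = 0" by (simp add: functional_def kernel_acts_zero)
  next
    fix w p assume w: "w \<in> ?W" and p: "p \<in> pres.ending_in ?S"
    from p show "?l w p = 0"
    proof (induction p rule: pres.ending_in_induct)
      case (single u c r)
      then show ?case
        using earlier_letters_killed[OF T st(1)[OF w] st(3)[OF w] st(4)[OF w], of c u]
        unfolding functional_def fock.poly_act_single by simp
    qed (simp_all add: functional_def fock.poly_act_zero fock.poly_act_add)
  next
    fix w w' assume w: "w \<in> ?W" "w' \<in> ?W"
    have "w = w'" if "st w = st w'"
    proof -
      have "normal_word (st w) = normal_word (st w')" using that by (rule arg_cong)
      then show ?thesis unfolding st(2)[OF w(1)] st(2)[OF w(2)] by simp
    qed
    then show "?l w (word (w' @ [s])) = (if w = w' then 1 else 0)"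
      using functional_dual[OF st(1)[OF w(1)] st(1)[OF w(2)]] unfolding st(2)[OF w(2)] by auto
  qed
  moreover have "pres.absorbs (insert s ?S) s (colon v s)"
  proof (rule reduces_absorbs)
    show "reduces (insert s ?S - {s}) c s" if "c \<in> colon v s" for c
      unfolding d by (rule reduces_colon[OF T that])
    show "colon v s \<subseteq> letters" by (auto simp: colon_def Low_def)
  qed (rule s(2))
  moreover have "insert s ?S \<subseteq> colon v s"
  proof (cases "T = {}")
    case True
    then have "s = gx 1 v" using T by (simp add: next_letter_def)
    then show ?thesis using s True Low_disjoint[OF y1_Lev[OF v]] by (auto simp: colon_def Low_Suc)
  next
    case False
    then have "s \<noteq> gx 1 v" using T by (auto simp: next_letter_def)
    then show ?thesis using s TL by (auto simp: colon_def Low_Suc)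
  qed
  moreover have "normal_words (insert s ?S) \<subseteq> normal_words ?S" by (auto simp: normal_words_def)
  moreover have "w @ [s] \<in> normal_words ?S" if w: "w \<in> ?W" for w
  proof -
    have "last (w @ [s]) \<notin> ?S" using Low_disjoint[OF s(1)] sT by simp
    then show ?thesis unfolding normal_words_def mem_Collect_eq
      using st(1)[OF w] st(2)[OF w] by (intro exI[of _ "st w"] conjI disjI2) simp_all
  qed
  ultimately have "insert s ?S \<subseteq> colon v s \<and> pres.absorbs (insert s ?S) s (colon v s) \<and>
      normal_words (insert s ?S) \<subseteq> normal_words ?S \<and> (\<forall>w\<in>?W. w @ [s] \<in> normal_words ?S) \<and>
      (\<exists>l. pres.dual_functionals ?W ?S s l)"
    by (intro conjI ballI exI[of _ ?l]) simp_all
  then show ?thesis unfolding pres.word_step_def d by simp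
qed

text \<open>In each level \<open>x\<^sup>1\<close> comes first and \<open>y\<^sup>1\<close> last; those in between may come in any order.\<close>

definition initial_segments :: "'v arr_gen set set" where
  "initial_segments = {Low v \<union> T | v T. v \<le> N \<and> T \<subseteq> Lev v \<and> (T \<noteq> {} \<longrightarrow> gx 1 v \<in> T) \<and> (gy 1 v \<in> T \<longrightarrow> T = Lev v)}"

lemma initial_segmentI:
  "\<lbrakk>v \<le> N; T \<subseteq> Lev v; T \<noteq> {} \<Longrightarrow> gx 1 v \<in> T; gy 1 v \<in> T \<Longrightarrow> T = Lev v\<rbrakk> \<Longrightarrow> Low v \<union> T \<in> initial_segments"
  unfolding initial_segments_def by blast

lemma Low_segment: "v \<le> N \<Longrightarrow> Low v \<in> initial_segments"
  using initial_segmentI[of v "{}"] by simp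

lemma Lev_N: "Lev N = {}" using Lev_cases[of _ N] by auto

lemma Low_N: "Low N = letters"
proof -
  have "level c < N" if "c \<in> letters" for c using Lev_cases[of c "level c"] that by (simp add: Lev_def)
  then show ?thesis by (auto simp: Low_def)
qed

lemma Low_0: "Low 0 = {}" by (simp add: Low_def)

lemma colon_segment: "next_letter v T s \<Longrightarrow> colon v s \<in> initial_segments"
proof -
  assume "next_letter v T s"
  then have v: "v < N" by (simp add: next_letter_def)
  have "Low v \<union> (Lev v - {gy 1 v}) \<in> initial_segments"
    using v x1_Lev[OF v] by (intro initial_segmentI) auto
  moreover have "Low (Suc v) - {gy 1 v} = Low v \<union> (Lev v - {gy 1 v})"
    using Low_disjoint[OF y1_Lev[OF v]] by (auto simp: Low_Suc)
  ultimately show ?thesis using Low_segment[of "Suc v"] v by (simp add: colon_def)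
qed

lemma segment_up:
  assumes "S \<in> initial_segments" "S \<noteq> letters"
  shows "\<exists>s S''. insert s S \<in> initial_segments \<and> S'' \<in> initial_segments \<and> s \<notin> S \<and> pres.word_step normal_words (insert s S) s S''"
proof -
  \<comment> \<open>a segment that fills the level \<open>v\<close> is also the empty segment of the next level\<close>
  have "\<exists>v T. v < N \<and> S = Low v \<union> T \<and> T \<subset> Lev v \<and> (T \<noteq> {} \<longrightarrow> gx 1 v \<in> T) \<and> gy 1 v \<notin> T"
  proof -
    obtain v T where vT: "v \<le> N" "S = Low v \<union> T" "T \<subseteq> Lev v" "T \<noteq> {} \<longrightarrow> gx 1 v \<in> T" "gy 1 v \<in> T \<longrightarrow> T = Lev v"
      using assms(1) unfolding initial_segments_def by blast
    have v: "v < N" using vT assms(2) Lev_N Low_N by (cases "v = N") auto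
    show ?thesis
    proof (cases "T = Lev v")
      case True
      then have S: "S = Low (Suc v) \<union> {}" using vT(2) by (simp add: Low_Suc)
      then have "Suc v < N" using v assms(2) Low_N by (cases "Suc v = N") auto
      then show ?thesis using S x1_Lev[of "Suc v"] by (intro exI[of _ "Suc v"] exI[of _ "{}"]) auto
    next
      case False
      then show ?thesis using vT v by blast
    qed
  qed
  then obtain v T where vT: "v < N" "S = Low v \<union> T" "T \<subset> Lev v" "T \<noteq> {} \<longrightarrow> gx 1 v \<in> T" "gy 1 v \<notin> T" by blast
  obtain s where s: "s \<in> Lev v - T" "T = {} \<longleftrightarrow> s = gx 1 v" "s = gy 1 v \<longrightarrow> insert s T = Lev v"
  proof (cases "T = {}")
    case True
    then show ?thesis using that[of "gx 1 v"] x1_Lev[OF vT(1)] by auto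
  next
    case False
    show ?thesis
    proof (cases "Lev v - T = {gy 1 v}")
      case True
      then show ?thesis using that[of "gy 1 v"] False vT by auto
    next
      case F: False
      then obtain s where "s \<in> Lev v - T" "s \<noteq> gy 1 v" using vT(3) by blast
      then show ?thesis using that[of s] False vT(4) by blast
    qed
  qed
  have n: "next_letter v T s" using vT s unfolding next_letter_def by blast
  have "Low v \<union> insert s T \<in> initial_segments"
    using vT s by (intro initial_segmentI) auto
  moreover have "s \<notin> S" using s(1) vT(2) Low_disjoint by blast
  ultimately show ?thesis using word_step_arrangement[OF n] colon_segment[OF n] vT(2) by auto
qed

lemma segment_down:
  assumes "S \<in> initial_segments" "S \<noteq> {}"
  shows "\<exists>s S''. S - {s} \<in> initial_segments \<and> S'' \<in> initial_segments \<and> pres.word_step normal_words S s S''"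
proof -
  \<comment> \<open>conversely, an empty segment of a level is taken as all of the level before\<close>
  have "\<exists>v T. v < N \<and> S = Low v \<union> T \<and> T \<subseteq> Lev v \<and> gx 1 v \<in> T \<and> (gy 1 v \<in> T \<longrightarrow> T = Lev v)"
  proof -
    obtain v T where vT: "v \<le> N" "S = Low v \<union> T" "T \<subseteq> Lev v" "T \<noteq> {} \<longrightarrow> gx 1 v \<in> T" "gy 1 v \<in> T \<longrightarrow> T = Lev v"
      using assms(1) unfolding initial_segments_def by blast
    show ?thesis
    proof (cases "T = {}")
      case True
      then obtain u where u: "v = Suc u" using vT(2) assms(2) Low_0 by (cases v) auto
      then show ?thesis using vT True x1_Lev[of u] by (intro exI[of _ u] exI[of _ "Lev u"]) (simp add: Low_Suc)
    next
      case False
      then have "v < N" using vT Lev_N by (cases "v = N") auto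
      then show ?thesis using vT False by blast
    qed
  qed
  then obtain v T where vT: "v < N" "S = Low v \<union> T" "T \<subseteq> Lev v" "gx 1 v \<in> T" "gy 1 v \<in> T \<longrightarrow> T = Lev v" by blast
  obtain s where s: "s \<in> T" "gy 1 v \<in> T \<longrightarrow> s = gy 1 v" "T = {gx 1 v} \<longleftrightarrow> s = gx 1 v"
  proof (cases "gy 1 v \<in> T")
    case True
    then show ?thesis using that[of "gy 1 v"] by auto
  next
    case F: False
    show ?thesis
    proof (cases "T = {gx 1 v}")
      case True
      then show ?thesis using that[of "gx 1 v"] by auto
    next
      case False
      then obtain s where "s \<in> T" "s \<noteq> gx 1 v" using vT(4) by blast
      then show ?thesis using that[of s] F False by blast
    qed
  qed
  have n: "next_letter v (T - {s}) s" using vT s unfolding next_letter_def by auto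
  have sL: "s \<notin> Low v" using s(1) vT(3) Low_disjoint by blast
  have "Low v \<union> (T - {s}) \<in> initial_segments"
    using vT s by (intro initial_segmentI) auto
  moreover have "S - {s} = Low v \<union> (T - {s})" using vT(2) s(1) sL by blast
  moreover have e: "insert s (Low v \<union> (T - {s})) = S" using vT(2) s(1) by blast
  ultimately show ?thesis
    using word_step_arrangement[OF n, unfolded e] colon_segment[OF n] by (intro exI[of _ s] exI[of _ "colon v s"]) simp
qed

lemma Koszul_exterior_quotient: "Koszul (exterior_quotient letters relations)"
proof (rule pres.Koszul_if_normal_words[of normal_words initial_segments])
  have "finite V" using bij bij_betw_finite by blast
  moreover have "finite E" using edges finite_subset[of E "Pow V"] \<open>finite V\<close> by blast
  moreover have "letters = (\<lambda>(i, v). GenX i v) ` ({1..g} \<times> V) \<union> (\<lambda>(i, v). GenY i v) ` ({1..g} \<times> V) \<union> GenE ` E"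
    unfolding arr_gens_def by auto
  ultimately show "finite letters" by simp
  have "valid vacuum" "normal_word vacuum = []" by (auto simp: valid_def allowed_def word_from_def)
  then show "[] \<in> normal_words letters" unfolding normal_words_def by (metis (mono_tags, lifting) mem_Collect_eq)
  show "letters \<in> initial_segments" using Low_segment[of N] Low_N by simp
  fix S assume S: "S \<in> initial_segments"
  have "S \<subseteq> letters" using S by (auto simp: initial_segments_def Low_def Lev_def)
  moreover have "normal_words S \<subseteq> lists letters" using normal_word_letters by (auto simp: normal_words_def)
  moreover have "finite (normal_words S)"
    by (rule finite_subset[OF _ finite_imageI[OF finite_valid, of normal_word]]) (auto simp: normal_words_def)
  ultimately show "S \<subseteq> letters \<and> normal_words S \<subseteq> lists letters \<and> finite (normal_words S)" by blast
qed (rule segment_up segment_down; assumption)+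

end

section \<open>The theorem\<close>

text \<open>The position of \<open>v\<close> is the number of smaller elements.\<close>

lemma finite_linear_order_enumeration:
  assumes "finite V" "linear_order_on V r"
  shows "\<exists>vtx. bij_betw vtx {..<card V} V \<and> (\<forall>i<card V. \<forall>j<card V. (vtx i, vtx j) \<in> r \<longleftrightarrow> i \<le> j)"
proof -
  define pos where "pos v = card {u \<in> V. (u, v) \<in> r \<and> u \<noteq> v}" for v
  have tr: "trans r" and anti: "antisym r" and total: "total_on V r" and rf: "refl_on V r"
    using assms(2) by (auto simp: linear_order_on_def partial_order_on_def preorder_on_def)
  have less: "pos u < pos v" if "u \<in> V" "v \<in> V" "(u, v) \<in> r" "u \<noteq> v" for u v
    unfolding pos_def
  proof (rule psubset_card_mono)
    show "{w \<in> V. (w, u) \<in> r \<and> w \<noteq> u} \<subset> {w \<in> V. (w, v) \<in> r \<and> w \<noteq> v}"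
      using that tr anti by (auto simp: trans_def antisym_def)
  qed (use assms(1) in simp)
  have iff: "(u, v) \<in> r \<longleftrightarrow> pos u \<le> pos v" if "u \<in> V" "v \<in> V" for u v
  proof (cases "u = v")
    case True
    then show ?thesis using rf that by (simp add: refl_on_def)
  next
    case False
    then have "(u, v) \<in> r \<or> (v, u) \<in> r" using total that by (simp add: total_on_def)
    then show ?thesis using less[OF that] less[OF that(2,1)] False by auto
  qed
  have inj: "inj_on pos V"
  proof (rule inj_onI, rule ccontr)
    fix u v assume uv: "u \<in> V" "v \<in> V" "pos u = pos v" "u \<noteq> v"
    then have "(u, v) \<in> r \<or> (v, u) \<in> r" using total by (simp add: total_on_def)
    then show False using less[OF uv(1,2)] less[OF uv(2,1)] uv(3,4) by auto
  qed
  have "pos v < card V" if "v \<in> V" for v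
    unfolding pos_def by (rule psubset_card_mono[OF assms(1)]) (use that in blast)
  then have "pos ` V = {..<card V}"
    using card_image[OF inj] by (intro card_subset_eq) auto
  then have b: "bij_betw (inv_into V pos) {..<card V} V"
    using inj by (metis bij_betw_def bij_betw_inv_into)
  have "pos (inv_into V pos i) = i" "inv_into V pos i \<in> V" if "i < card V" for i
    using that \<open>pos ` V = _\<close> by (auto intro: f_inv_into_f inv_into_into)
  then show ?thesis using b iff by (intro exI[of _ "inv_into V pos"]) simp
qed

theorem theorem3p5p3:
  fixes C :: "(complex ^ 'n::finite) set set" and g :: nat
    and V :: "'v set" and E :: "'v set set" and r :: "'v rel"
  assumes "smooth_connected_projective_curve C" and "has_genus C g" and "g > 1"
    and "chordal V E" and "perfect_elimination_ordering V E r"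
  shows "Koszul (arrangement_algebra g V E r)"
proof -
  have V: "finite V" and E: "\<And>e. e \<in> E \<Longrightarrow> e \<subseteq> V \<and> card e = 2"
    using assms(4) by (auto simp: chordal_def simple_graph_def)
  have r: "linear_order_on V r" using assms(5) by (simp add: perfect_elimination_ordering_def)
  from finite_linear_order_enumeration[OF V r] obtain vtx where bij: "bij_betw vtx {..<card V} V"
    and ord: "\<And>i j. i < card V \<Longrightarrow> j < card V \<Longrightarrow> (vtx i, vtx j) \<in> r \<longleftrightarrow> i \<le> j" by blast
  interpret ordered_graph g V E r "card V" vtx
  proof
    show "0 < g" using assms(3) by simp
    fix i j k assume ijk: "i < j" "j < k" "k < card V" "{vtx i, vtx k} \<in> E" "{vtx j, vtx k} \<in> E"
    have "inj_on vtx {..<card V}" "vtx ` {..<card V} = V" using bij by (simp_all add: bij_betw_def)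
    then have "vtx i \<in> V" "vtx j \<in> V" "vtx k \<in> V" "vtx i \<noteq> vtx j"
      using ijk inj_on_eq_iff[of vtx "{..<card V}" i j] by auto
    moreover have "(vtx i, vtx k) \<in> r" "(vtx j, vtx k) \<in> r" using ijk ord by simp_all
    ultimately show "{vtx i, vtx j} \<in> E"
      using assms(5) ijk(4,5) unfolding perfect_elimination_ordering_def by blast
  qed (use bij ord E in blast)+
  have "arrangement_algebra g V E r = exterior_quotient letters relations"
    by (simp add: arrangement_algebra_def exterior_quotient_def Let_def)
  then show ?thesis using Koszul_exterior_quotient by simp
qed

end
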